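(* Let $T>0$, $R>0$, and let $f$ be an isotropic probability density on $\mathbb{R}^2$. Let $\rho(T)=k/\hat\beta$ with $k=\int_{\mathbb{R}^2}\beta(R,y)f(y)\,dy$ and $\hat\beta=\sup_{y}\beta(R,y)$. For $0<\epsilon\le1-e^{-\rho(T)}$, the transmission capacity $C(\epsilon,T)$ of the Poisson clustered process with scattering density $f$ at link distance $R$ equals the transmission capacity of the Poisson point process: $$C(\epsilon,T)=C_p(\epsilon,T).$$
   Context: Neyman-Scott (Poisson) cluster process: the parents form a stationary Poisson point process on $\mathbb{R}^2$ of intensity $\lambda_p>0$; to each parent $x$ is attached an independent cluster with a Poisson number (mean $\bar c>0$) of points located at $x$ plus i.i.d. displacements with density $f$; $\phi$ is the union of all clusters (parents not included). Its success probability (Rayleigh fading, no noise) is $\mathbb{P}(\text{success})=\mathbb{P}^{!0}(h\,g(z)/I_\phi(z)\ge T)$ with $\|z\|=R$, where $I_\phi(z)=\sum_{x\in\phi}h_xg(x-z)$, $h$ and $h_x$ are i.i.d. exponential, independent of $\phi$, and $\mathbb{P}^{!0}$ is probability under the reduced Palm distribution of $\phi$ at the origin (conditioning on a point at the origin and removing it). Transmission capacity (unit bit rate): $C(\epsilon,T)=(1-\epsilon)\sup\{\lambda_p\bar c:\lambda_p>0,\ \bar c>0,\ \mathbb{P}(\text{success})\ge1-\epsilon\}$, with $R,T,f,g$ fixed. $\beta(R,y)=\int_{\mathbb{R}^2}\frac{g(x-y-z)}{g(R)/T+g(x-y-z)}f(x)\,dx$ with $z=(R,0)$, and $\beta_I=\int_{\mathbb{R}^2}\beta(R,y)\,dy$;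 $g(R)$ is the value of $g$ at any point of norm $R$. For a Poisson process of intensity $x$ the success probability is $P_p(x)=\exp(-x\beta_I)$, and $C_p(\epsilon,T)=(1-\epsilon)\sup\{\lambda:P_p(\lambda)\ge1-\epsilon\}=\frac{1-\epsilon}{\beta_I}\ln\frac1{1-\epsilon}$. The path-loss function $g:\mathbb{R}^2\setminus\{o\}\to\mathbb{R}^+$ is a continuous, positive, non-increasing function of $\|x\|$, with $\int_{\mathbb{R}^2\setminus B(o,\delta)}g(x)\,dx<\infty$ for all $\delta>0$, and $\lim_{\|x\|\to\infty}g(x)/g(x-y)=1$ for all $y\in\mathbb{R}^2$. *)

theory Defs
  imports "HOL-Probability.Probability"
begin

section \<open>Planar point processes\<close>

text \<open>A configuration is a locally finite subset of the plane; the sigma-algebra is generated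
  by the counts of points in bounded Borel sets.\<close>

definition configurations :: "(real^2) set measure" where
  "configurations = sigma {S. \<forall>B. bounded B \<longrightarrow> finite (S \<inter> B)}
     {{S. (\<forall>B'. bounded B' \<longrightarrow> finite (S \<inter> B')) \<and> card (S \<inter> B) = n} | B n.
        B \<in> sets borel \<and> bounded B}"

text \<open>The sequence \<open>X\<close> enumerates, almost surely without repetition, the points of a stationary
  Poisson point process of intensity \<open>l\<close>. Almost surely the process has infinitely many points,
  so every such process admits an enumeration by a sequence of random points. The count
  probabilities are written out because \<open>poisson_pmf\<close> excludes the rate \<open>0\<close>, which occurs
  for null sets \<open>B\<close>.\<close>

definition poisson_points :: "'w measure \<Rightarrow> real \<Rightarrow> (nat \<Rightarrow> 'w \<Rightarrow> real^2) \<Rightarrow> bool" where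
  "poisson_points M l X \<longleftrightarrow>
     prob_space M \<and>
     (\<forall>i. X i \<in> borel_measurable M) \<and>
     (AE \<omega> in M. inj (\<lambda>i. X i \<omega>)) \<and>
     (AE \<omega> in M. range (\<lambda>i. X i \<omega>) \<in> space configurations) \<and>
     (\<forall>B n. B \<in> sets borel \<and> bounded B \<longrightarrow>
        measure M {\<omega> \<in> space M. card (range (\<lambda>i. X i \<omega>) \<inter> B) = n} =
          (l * measure lborel B) ^ n / fact n * exp (- (l * measure lborel B))) \<and>
     (\<forall>B :: nat \<Rightarrow> (real^2) set. (\<forall>k. B k \<in> sets borel \<and> bounded (B k)) \<and> disjoint_family B \<longrightarrow>
        prob_space.indep_vars M (\<lambda>_. count_space UNIV)
          (\<lambda>k \<omega>. card (range (\<lambda>i. X i \<omega>) \<inter> B k)) UNIV)"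

definition poisson_process :: "'w measure \<Rightarrow> real \<Rightarrow> ('w \<Rightarrow> (real^2) set) \<Rightarrow> bool" where
  "poisson_process M l \<Phi> \<longleftrightarrow>
     (\<exists>X. poisson_points M l X \<and> (AE \<omega> in M. \<Phi> \<omega> = range (\<lambda>i. X i \<omega>)))"

text \<open>\<open>X i\<close> is the \<open>i\<close>-th parent, \<open>N i\<close> the size of its cluster, and \<open>D (i, j)\<close> the
  displacement of the \<open>j\<close>-th point of its cluster. The equation between joint laws says that
  \<open>X\<close>, all the \<open>N i\<close> and all the \<open>D (i, j)\<close> are independent, that each \<open>N i\<close> is Poisson with
  mean \<open>c\<close>, and that each \<open>D (i, j)\<close> has density \<open>f\<close>.\<close>

definition neyman_scott ::
    "'w measure \<Rightarrow> real \<Rightarrow> real \<Rightarrow> (real^2 \<Rightarrow> real) \<Rightarrow> ('w \<Rightarrow> (real^2) set) \<Rightarrow> bool" where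
  "neyman_scott M l c f \<Phi> \<longleftrightarrow>
     (\<exists>(X :: nat \<Rightarrow> 'w \<Rightarrow> real^2) (N :: nat \<Rightarrow> 'w \<Rightarrow> nat) (D :: nat \<times> nat \<Rightarrow> 'w \<Rightarrow> real^2).
        poisson_points M l X \<and>
        (\<forall>i. N i \<in> measurable M (count_space UNIV)) \<and>
        (\<forall>p. D p \<in> borel_measurable M) \<and>
        distr M
          (PiM UNIV (\<lambda>_. borel) \<Otimes>\<^sub>M PiM UNIV (\<lambda>_. count_space UNIV) \<Otimes>\<^sub>M PiM UNIV (\<lambda>_. borel))
          (\<lambda>\<omega>. (\<lambda>i. X i \<omega>, \<lambda>i. N i \<omega>, \<lambda>p. D p \<omega>))
        = distr M (PiM UNIV (\<lambda>_. borel)) (\<lambda>\<omega> i. X i \<omega>)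
          \<Otimes>\<^sub>M PiM UNIV (\<lambda>_. measure_pmf (poisson_pmf c))
          \<Otimes>\<^sub>M PiM UNIV (\<lambda>_. density lborel (\<lambda>x. ennreal (f x))) \<and>
        (AE \<omega> in M. \<Phi> \<omega> = (\<Union>i. {X i \<omega> + D (i, j) \<omega> | j. j < N i \<omega>})))"

text \<open>The reduced Palm distribution at the origin of a stationary simple point process, with
  the unit square as observation window (by stationarity the window does not matter):
  the expected number of points of the process in the window from which the rest of the process
  looks like an element of \<open>Y\<close>, divided by the intensity.\<close>

definition reduced_palm :: "'w measure \<Rightarrow> ('w \<Rightarrow> (real^2) set) \<Rightarrow> (real^2) set measure" where
  "reduced_palm M \<Phi> = measure_of (space configurations) (sets configurations)
     (\<lambda>Y. (\<integral>\<^sup>+ \<omega>. (\<Sum>x \<in> \<Phi> \<omega> \<inter> cbox 0 1. indicator Y ((\<lambda>y. y - x) ` (\<Phi> \<omega> - {x}))) \<partial>M)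
          / (\<integral>\<^sup>+ \<omega>. of_nat (card (\<Phi> \<omega> \<inter> cbox 0 1)) \<partial>M))"

section \<open>Success probability and transmission capacity\<close>

text \<open>The value of \<open>g\<close> at the origin is arbitrary.\<close>

definition path_loss :: "(real^2 \<Rightarrow> real) \<Rightarrow> bool" where
  "path_loss g \<longleftrightarrow>
     continuous_on (- {0}) g \<and>
     (\<forall>x. x \<noteq> 0 \<longrightarrow> 0 < g x) \<and>
     (\<forall>x y. x \<noteq> 0 \<and> norm x \<le> norm y \<longrightarrow> g y \<le> g x) \<and>
     (\<forall>\<delta>>0. set_integrable lborel (- ball 0 \<delta>) g) \<and>
     (\<forall>y. ((\<lambda>x. g x / g (x - y)) \<longlongrightarrow> 1) at_infinity)"

definition isotropic_density :: "(real^2 \<Rightarrow> real) \<Rightarrow> bool" where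
  "isotropic_density f \<longleftrightarrow>
     f \<in> borel_measurable borel \<and> (\<forall>x. 0 \<le> f x) \<and>
     (\<integral>\<^sup>+ x. ennreal (f x) \<partial>lborel) = 1 \<and>
     (\<forall>x y. norm x = norm y \<longrightarrow> f x = f y)"

definition interference ::
    "(real^2 \<Rightarrow> real) \<Rightarrow> real^2 \<Rightarrow> (real^2) set \<Rightarrow> (real^2 \<Rightarrow> real) \<Rightarrow> ennreal" where
  "interference g z S hs = (\<integral>\<^sup>+ x. ennreal (hs x * g (x - z)) \<partial>count_space S)"

text \<open>The success probability given the configuration \<open>S\<close> of interferers, where the fading
  variables are i.i.d. exponential with rate \<open>r\<close>. The ratio is taken in \<open>ennreal\<close>, so that it is
  infinite without interference and \<open>0\<close> under infinite interference.\<close>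

definition conditional_success_prob ::
    "real \<Rightarrow> (real^2 \<Rightarrow> real) \<Rightarrow> real^2 \<Rightarrow> real \<Rightarrow> (real^2) set \<Rightarrow> ennreal" where
  "conditional_success_prob r g z T S =
     (let E = density lborel (\<lambda>t. ennreal (exponential_density r t));
          P = E \<Otimes>\<^sub>M PiM S (\<lambda>_. E)
      in emeasure P {(h, hs) \<in> space P. ennreal T \<le> ennreal (h * g z) / interference g z S hs})"

definition success_prob ::
    "real \<Rightarrow> (real^2 \<Rightarrow> real) \<Rightarrow> real^2 \<Rightarrow> real \<Rightarrow> 'w measure \<Rightarrow> ('w \<Rightarrow> (real^2) set) \<Rightarrow> ennreal" where
  "success_prob r g z T M \<Phi> =
     (\<integral>\<^sup>+ S. conditional_success_prob r g z T S \<partial>reduced_palm M \<Phi>)"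

text \<open>In the two capacities \<open>P\<close> is the success probability as a function of the parameters.
  The suprema are taken in \<open>ennreal\<close>.\<close>

definition cluster_capacity :: "(real \<Rightarrow> real \<Rightarrow> ennreal) \<Rightarrow> real \<Rightarrow> ennreal" where
  "cluster_capacity P \<epsilon> = ennreal (1 - \<epsilon>) *
     Sup {ennreal (l * c) | l c. 0 < l \<and> 0 < c \<and> ennreal (1 - \<epsilon>) \<le> P l c}"

definition poisson_capacity :: "(real \<Rightarrow> ennreal) \<Rightarrow> real \<Rightarrow> ennreal" where
  "poisson_capacity P \<epsilon> = ennreal (1 - \<epsilon>) *
     Sup {ennreal l | l. 0 < l \<and> ennreal (1 - \<epsilon>) \<le> P l}"

definition beta ::
    "(real^2 \<Rightarrow> real) \<Rightarrow> (real^2 \<Rightarrow> real) \<Rightarrow> real \<Rightarrow> real \<Rightarrow> real^2 \<Rightarrow> real" where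
  "beta g f T R y = (let z = vector [R, 0] in
     LINT x|lborel. g (x - y - z) / (g z / T + g (x - y - z)) * f x)"

definition rho :: "(real^2 \<Rightarrow> real) \<Rightarrow> (real^2 \<Rightarrow> real) \<Rightarrow> real \<Rightarrow> real \<Rightarrow> real" where
  "rho g f T R = (LINT y|lborel. beta g f T R y * f y) / (SUP y. beta g f T R y)"

end

theory Submission
  imports Defs
begin

text \<open>Integrating out the exponential fading turns the conditional success probability into
  \<open>exp (- \<Sum>x\<in>S. V x)\<close> with \<open>V x = ln (1 + T g (x - z) / g z)\<close>, so the success
  probability is a Campbell average of an exponential functional under the reduced Palm measure.
  For the Poisson process it equals \<open>exp (- l \<integral>h)\<close> with \<open>h = 1 - exp (- V)\<close>, by Mecke's
  formula. Conditionally on the parents, each cluster contributes a factor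
  \<open>exp (- c b)\<close>, where \<open>b\<close> is the convolution of \<open>h\<close> with the reflected density, so Mecke's
  formula for the parents gives \<open>exp (- l \<integral>(1 - exp (- c b))) * \<integral>exp (- c b (- y)) f y\<close>.
  As \<open>\<integral>b = \<integral>h\<close>, letting \<open>c\<close> tend to \<open>0\<close> at fixed \<open>l c\<close> recovers the Poisson value. Conversely,
  bounding \<open>exp (- c b)\<close> by its chord on \<open>[0, Sup b]\<close> shows that for \<open>\<epsilon> \<le> 1 - exp (- rho)\<close>
  clustering cannot do better.\<close>

section \<open>Exponential functionals on product spaces\<close>

text \<open>The hypotheses on the Poisson process concern only counts in bounded Borel sets, so
  Mecke's formula is built up from cells: weights constant on cells, then fixed measurable weights,
  then weights \<open>\<phi> (y - x)\<close> of a difference. The last stage meets an obstacle: the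
  loss is continuous only away from the receiver \<open>z\<close>, where it may blow up and where
  its value comes from the arbitrary \<open>g 0\<close>. A squeeze deals with that point; for the
  parents it disappears, since convolution with a density makes \<open>b\<close> continuous.
  Everything is computed in \<open>ennreal\<close>, so infinite interference is just a factor 0 and
  every exchange of sum and integral is Tonelli. The threshold \<open>rho\<close> reflects a
  competition. At fixed \<open>l * c\<close>, larger \<open>c\<close> means fewer parents and
  improves the first factor of the success probability, while the companions of the tagged point in
  its own cluster worsen the second. With \<open>B\<close> the supremum and \<open>k\<close> the
  average of \<open>beta\<close>, at success level exp(- \<delta>) and small \<open>c\<close> the
  gain is at most of order \<open>\<delta> * c * B\<close> and the cost is of order
  \<open>c * k\<close>; hence a condition comparing \<delta> with \<open>k / B\<close>.\<close>

definition expm :: "ennreal \<Rightarrow> ennreal" where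
  "expm a = (if a = \<infinity> then 0 else ennreal (exp (- enn2real a)))"

text \<open>An infinite product of numbers in [0, 1] is written throughout as \<open>expm\<close> of
  the sum of their \<open>neglog\<close>s; a factor 0 becomes the exponent \<infinity>. Above 1 the
  negative value would be truncated to 0 by \<open>ennreal\<close>, whence the restriction in
  \<open>expm_neglog\<close>.\<close>

definition neglog :: "ennreal \<Rightarrow> ennreal" where
  "neglog a = (if a = 0 then \<infinity> else ennreal (- ln (enn2real a)))"

lemma expm_ennreal [simp]: "0 \<le> x \<Longrightarrow> expm (ennreal x) = ennreal (exp (- x))"
  by (simp add: expm_def)

lemma expm_0 [simp]: "expm 0 = 1"
  by (simp add: expm_def)

lemma expm_top [simp]: "expm \<infinity> = 0" "expm top = 0"
  by (simp_all add: expm_def)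

lemma expm_neglog: "a \<le> 1 \<Longrightarrow> expm (neglog a) = a"
proof (cases "a = 0")
  case False
  assume a: "a \<le> 1"
  obtain x where x: "0 \<le> x" "a = ennreal x"
    using a by (cases a) (auto simp: top_unique)
  then have "0 < x" "x \<le> 1" using False a by (auto simp: ennreal_le_1)
  then show ?thesis using x False by (simp add: neglog_def)
qed (simp add: neglog_def)

lemma expm_antimono: "a \<le> b \<Longrightarrow> expm b \<le> expm a"
  by (cases a; cases b) (auto simp: expm_def top_unique intro!: ennreal_leI)

lemma expm_le_1: "expm a \<le> 1"
  using expm_antimono[of 0 a] by simp

lemma expm_add: "expm (a + b) = expm a * expm b"
proof (cases "a = \<infinity> \<or> b = \<infinity>")
  case False
  then obtain x y where "0 \<le> x" "a = ennreal x" "0 \<le> y" "b = ennreal y"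
    by (cases a; cases b) auto
  then show ?thesis
    by (simp flip: ennreal_plus ennreal_mult' add: exp_add exp_diff exp_minus divide_inverse)
qed auto

lemma expm_sum: "finite I \<Longrightarrow> expm (\<Sum>i\<in>I. f i) = (\<Prod>i\<in>I. expm (f i))"
  by (induction I rule: finite_induct) (auto simp: expm_add)

lemma measurable_expm [measurable]: "expm \<in> borel_measurable borel"
  unfolding expm_def[abs_def] by measurable

text \<open>Exponents may run off to \<infinity>, where \<open>enn2real\<close> jumps to 0; the
  value \<open>expm \<infinity> = 0\<close> makes the function continuous there too.\<close>

lemma tendsto_expm:
  assumes "(f \<longlongrightarrow> a) F"
  shows "((\<lambda>x. expm (f x)) \<longlongrightarrow> expm a) F"
proof (cases "a = \<infinity>")
  case True
  have "((\<lambda>x. expm (f x)) \<longlongrightarrow> 0) F"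
  proof (rule order_tendstoI)
    fix e :: ennreal assume "0 < e"
    then obtain d where d: "0 < d" "ennreal d < e"
      by (metis ennreal_0 ennreal_less_zero_iff dense ennreal_cases infinity_ennreal_def not_less_iff_gr_or_eq order_less_imp_not_less top.not_eq_extremum zero_less_iff_neq_zero)
    have "\<forall>\<^sub>F x in F. ennreal (max 0 (- ln d)) < f x"
      using assms True by (intro order_tendstoD(1)) auto
    then show "\<forall>\<^sub>F x in F. expm (f x) < e"
    proof eventually_elim
      case (elim x)
      have "expm (f x) \<le> ennreal (exp (- max 0 (- ln d)))"
        using expm_antimono[OF less_imp_le[OF elim]] by (simp add: max_def split: if_splits)
      also have "\<dots> \<le> ennreal (exp (ln d))" by (intro ennreal_leI) simp
      also have "\<dots> < e" using d by simp
      finally show ?case .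
    qed
  qed auto
  with True show ?thesis by simp
next
  case False
  then have "((\<lambda>x. ennreal (exp (- enn2real (f x)))) \<longlongrightarrow> ennreal (exp (- enn2real a))) F"
    using assms by (intro tendsto_intros) (auto simp: less_top)
  moreover have "\<forall>\<^sub>F x in F. f x < top"
    using assms False by (intro order_tendstoD(2)[of f a]) (auto simp: less_top)
  then have "\<forall>\<^sub>F x in F. ennreal (exp (- enn2real (f x))) = expm (f x)"
    by eventually_elim (auto simp: expm_def)
  ultimately show ?thesis using False
    by (auto simp: expm_def intro: Lim_transform_eventually)
qed

text \<open>Increasing partial sums become decreasing exponentials bounded by 1, which on a
  probability space admit monotone convergence from above.\<close>

lemma expm_SUP:
  fixes f :: "nat \<Rightarrow> ennreal"
  assumes "incseq f"
  shows "expm (SUP n. f n) = (INF n. expm (f n))"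
proof (rule LIMSEQ_unique)
  show "(\<lambda>n. expm (f n)) \<longlonglongrightarrow> expm (SUP n. f n)"
    by (intro tendsto_expm LIMSEQ_SUP assms)
  show "(\<lambda>n. expm (f n)) \<longlonglongrightarrow> (INF n. expm (f n))"
    using assms by (intro LIMSEQ_INF) (auto simp: decseq_def incseq_def intro: expm_antimono)
qed

lemma (in prob_space) nn_integral_expm_le_1: "(\<integral>\<^sup>+x. expm (f x) \<partial>M) \<le> 1"
proof -
  have "(\<integral>\<^sup>+x. expm (f x) \<partial>M) \<le> (\<integral>\<^sup>+x. 1 \<partial>M)"
    by (intro nn_integral_mono expm_le_1)
  then show ?thesis by (simp add: emeasure_space_1)
qed

section \<open>Countable sums and infinite products of independent factors\<close>

lemma nn_integral_count_space_SUP_finite: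
  fixes f :: "'i \<Rightarrow> ennreal"
  assumes "countable I"
  shows "(\<integral>\<^sup>+i. f i \<partial>count_space I) = (SUP n. \<Sum>i\<in>{i\<in>I. to_nat_on I i < n}. f i)"
    and "finite {i\<in>I. to_nat_on I i < n}"
    and "incseq (\<lambda>n. \<Sum>i\<in>{i\<in>I. to_nat_on I i < n}. f i)"
proof -
  have fin: "finite {i\<in>I. to_nat_on I i < n}" for n
    by (rule inj_on_finite[of "to_nat_on I" _ "{..<n}"])
       (auto intro: inj_on_subset[OF inj_on_to_nat_on[OF assms]])
  then show "finite {i\<in>I. to_nat_on I i < n}" .
  show inc: "incseq (\<lambda>n. \<Sum>i\<in>{i\<in>I. to_nat_on I i < n}. f i)"
    by (intro monoI sum_mono2 fin) auto
  have eq: "(\<Sum>i\<in>{i\<in>I. to_nat_on I i < n}. f i) =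
      (\<integral>\<^sup>+i. f i * indicator {i. to_nat_on I i < n} i \<partial>count_space I)" for n
    by (subst nn_integral_count_space'[where A="{i\<in>I. to_nat_on I i < n}"])
       (auto simp: fin split: split_indicator)
  have "(\<integral>\<^sup>+i. f i \<partial>count_space I) =
      (\<integral>\<^sup>+i. (SUP n. f i * indicator {i. to_nat_on I i < n} i) \<partial>count_space I)"
  proof (intro nn_integral_cong antisym)
    fix i
    show "f i \<le> (SUP n. f i * indicator {i. to_nat_on I i < n} i)"
      by (rule SUP_upper2[of "Suc (to_nat_on I i)"]) auto
  qed (auto intro!: SUP_least split: split_indicator)
  also have "\<dots> = (SUP n. \<integral>\<^sup>+i. f i * indicator {i. to_nat_on I i < n} i \<partial>count_space I)"
    by (intro nn_integral_monotone_convergence_SUP)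
       (auto simp: incseq_def le_fun_def split: split_indicator)
  finally show "(\<integral>\<^sup>+i. f i \<partial>count_space I) = (SUP n. \<Sum>i\<in>{i\<in>I. to_nat_on I i < n}. f i)"
    by (simp add: eq)
qed

lemma borel_measurable_nn_integral_count_space:
  fixes f :: "'i \<Rightarrow> 'a \<Rightarrow> ennreal"
  assumes "countable I" and [measurable]: "\<And>i. i \<in> I \<Longrightarrow> f i \<in> borel_measurable M"
  shows "(\<lambda>x. \<integral>\<^sup>+i. f i x \<partial>count_space I) \<in> borel_measurable M"
  unfolding nn_integral_count_space_SUP_finite(1)[OF assms(1)]
  by (intro borel_measurable_SUP borel_measurable_sum assms) auto

lemma nn_integral_PiM_prod:
  assumes "\<And>i. prob_space (M i)" "finite J" "J \<subseteq> I"
    and U: "\<And>i. i \<in> J \<Longrightarrow> U i \<in> borel_measurable (M i)"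
  shows "(\<integral>\<^sup>+\<omega>. (\<Prod>i\<in>J. U i (\<omega> i) :: ennreal) \<partial>PiM I M) = (\<Prod>i\<in>J. \<integral>\<^sup>+x. U i x \<partial>M i)"
proof -
  interpret product_prob_space M
    using assms(1) by (simp add: product_prob_space_def product_prob_space_axioms_def product_sigma_finite_def prob_space_imp_sigma_finite)
  note U[measurable]
  have "(\<integral>\<^sup>+\<omega>. (\<Prod>i\<in>J. U i (\<omega> i)) \<partial>PiM I M) = (\<integral>\<^sup>+\<omega>. (\<Prod>i\<in>J. U i (restrict \<omega> J i)) \<partial>PiM I M)"
    by (intro nn_integral_cong prod.cong) auto
  also have "\<dots> = (\<integral>\<^sup>+\<omega>. (\<Prod>i\<in>J. U i (\<omega> i)) \<partial>distr (PiM I M) (PiM J M) (\<lambda>x. restrict x J))"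
    using assms(3) by (subst nn_integral_distr) (auto intro!: measurable_restrict_subset)
  also have "\<dots> = (\<integral>\<^sup>+\<omega>. (\<Prod>i\<in>J. U i (\<omega> i)) \<partial>PiM J M)"
    using assms by (subst distr_PiM_restrict_finite) auto
  also have "\<dots> = (\<Prod>i\<in>J. \<integral>\<^sup>+x. U i x \<partial>M i)"
    using assms by (intro product_nn_integral_prod) auto
  finally show ?thesis .
qed

text \<open>Coordinates are independent, so each finite partial sum yields a finite product by
  \<open>nn_integral_PiM_prod\<close>; these products decrease along the enumeration of
  \<open>I\<close> and stay below 1, so they pass to the limit. The lemma serves the fading
  variables, the displacements and the cluster sizes alike.\<close>

lemma nn_integral_PiM_expm:
  assumes "\<And>i. prob_space (M i)" "countable I"
    and U: "\<And>i. i \<in> I \<Longrightarrow> U i \<in> borel_measurable (M i)"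
  shows "(\<integral>\<^sup>+\<omega>. expm (\<integral>\<^sup>+i. U i (\<omega> i) \<partial>count_space I) \<partial>PiM I M) =
    expm (\<integral>\<^sup>+i. neglog (\<integral>\<^sup>+x. expm (U i x) \<partial>M i) \<partial>count_space I)"
proof -
  note U[measurable]
  define J where "J n = {i\<in>I. to_nat_on I i < n}" for n
  note J = nn_integral_count_space_SUP_finite[OF assms(2), folded J_def]
  interpret P: prob_space "PiM I M" using assms(1) by (intro prob_space_PiM)
  have JI: "J n \<subseteq> I" for n by (auto simp: J_def)
  have [measurable]: "(\<lambda>\<omega>. \<Sum>i\<in>J n. U i (\<omega> i)) \<in> borel_measurable (PiM I M)" for n
    using JI[of n] by (intro borel_measurable_sum) (auto intro!: measurable_compose[OF measurable_component_singleton])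
  have "(\<integral>\<^sup>+\<omega>. expm (\<integral>\<^sup>+i. U i (\<omega> i) \<partial>count_space I) \<partial>PiM I M) =
    (\<integral>\<^sup>+\<omega>. (INF n. expm (\<Sum>i\<in>J n. U i (\<omega> i))) \<partial>PiM I M)"
    by (simp add: J(1) expm_SUP[OF J(3)])
  also have "\<dots> = (INF n. \<integral>\<^sup>+\<omega>. expm (\<Sum>i\<in>J n. U i (\<omega> i)) \<partial>PiM I M)"
  proof (intro nn_integral_monotone_convergence_INF_decseq)
    show "decseq (\<lambda>n \<omega>. expm (\<Sum>i\<in>J n. U i (\<omega> i)))"
      by (intro antimonoI le_funI expm_antimono monoD[OF J(3)])
    show "(\<integral>\<^sup>+\<omega>. expm (\<Sum>i\<in>J 0. U i (\<omega> i)) \<partial>PiM I M) < \<infinity>"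
      by (rule le_less_trans[OF P.nn_integral_expm_le_1]) simp
  qed (rule measurable_compose[OF _ measurable_expm], simp)
  also have "(\<lambda>n. \<integral>\<^sup>+\<omega>. expm (\<Sum>i\<in>J n. U i (\<omega> i)) \<partial>PiM I M) =
      (\<lambda>n. expm (\<Sum>i\<in>J n. neglog (\<integral>\<^sup>+x. expm (U i x) \<partial>M i)))"
  proof
    fix n
    have "(\<integral>\<^sup>+\<omega>. expm (\<Sum>i\<in>J n. U i (\<omega> i)) \<partial>PiM I M) = (\<Prod>i\<in>J n. \<integral>\<^sup>+x. expm (U i x) \<partial>M i)"
      using JI[of n] by (subst nn_integral_PiM_prod[symmetric, OF assms(1) J(2)])
        (auto simp: expm_sum[OF J(2)])
    also have "\<dots> = (\<Prod>i\<in>J n. expm (neglog (\<integral>\<^sup>+x. expm (U i x) \<partial>M i)))"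
      by (intro prod.cong refl expm_neglog[symmetric] prob_space.nn_integral_expm_le_1 assms)
    finally show "(\<integral>\<^sup>+\<omega>. expm (\<Sum>i\<in>J n. U i (\<omega> i)) \<partial>PiM I M) =
      expm (\<Sum>i\<in>J n. neglog (\<integral>\<^sup>+x. expm (U i x) \<partial>M i))"
      by (simp add: expm_sum[OF J(2)])
  qed
  finally show ?thesis by (simp add: J(1) expm_SUP[OF J(3)])
qed

section \<open>Fading\<close>

text \<open>At \<open>x = z\<close> the path loss is evaluated at the origin, where it is arbitrary
  and possibly negative; \<open>max 0\<close> repeats the truncation that \<open>ennreal\<close>
  performs in \<open>interference\<close>.\<close>

definition loss_exponent :: "(real^2 \<Rightarrow> real) \<Rightarrow> real^2 \<Rightarrow> real \<Rightarrow> real^2 \<Rightarrow> real" where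
  "loss_exponent g z T x = ln (1 + T * max 0 (g (x - z)) / g z)"

text \<open>With \<open>s = r\<close> this is an exponential tail; with \<open>s = r + a\<close> and
  \<open>b = 0\<close> it is the Laplace transform \<open>r / (r + a)\<close>.\<close>

lemma nn_integral_exponential_atLeast:
  assumes "0 \<le> r" "0 < s"
  shows "(\<integral>\<^sup>+h. ennreal (r * exp (- (h * s))) * indicator {b..} h \<partial>lborel) =
    ennreal (r / s * exp (- (b * s)))"
proof -
  have lim: "((\<lambda>h. - (r / s) * exp (- (h * s))) \<longlongrightarrow> - (r / s) * 0) at_top"
    using assms
    by (intro tendsto_mult tendsto_const filterlim_compose[OF exp_at_bot] filterlim_compose[OF filterlim_uminus_at_bot_at_top])
       (auto intro!: filterlim_at_top_mult_tendsto_pos[where c=s] filterlim_ident tendsto_const)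
  have "(\<integral>\<^sup>+h. ennreal (r * exp (- (h * s))) * indicator {b..} h \<partial>lborel) =
    ennreal (- (r / s) * 0 - (- (r / s) * exp (- (b * s))))"
    using assms
    by (intro nn_integral_FTC_atLeast[OF _ _ _ lim])
       (auto intro!: derivative_eq_intros simp: field_simps)
  then show ?thesis by simp
qed

text \<open>Given the fading of the interferers, success means that \<open>h\<close> exceeds
  \<open>T\<close> times the interference over \<open>g z\<close>, an exponential tail. Being the
  exponential of a sum, it splits over the interferers, and each contributes a Laplace transform in
  which the rate \<open>r\<close> cancels.\<close>

lemma conditional_success_prob_eq:
  assumes r: "0 < r" and T: "0 < T" and gz: "0 < g z" and S: "countable S"
  shows "conditional_success_prob r g z T S =
    expm (\<integral>\<^sup>+x. ennreal (loss_exponent g z T x) \<partial>count_space S)"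
proof -
  define E where "E = density lborel (\<lambda>t. ennreal (exponential_density r t))"
  define Q where "Q = PiM S (\<lambda>_. E)"
  interpret E: prob_space E unfolding E_def by (rule prob_space_exponential_density[OF r])
  interpret Q: prob_space Q unfolding Q_def by (intro prob_space_PiM E.prob_space_axioms)
  interpret EQ: pair_sigma_finite E Q ..
  have [measurable_cong]: "sets E = sets borel" by (simp add: E_def)
  have [simp]: "space E = UNIV" by (simp add: E_def)
  have dens: "integral\<^sup>N E f = (\<integral>\<^sup>+h. ennreal (r * exp (- (h * r))) * f h * indicator {0..} h \<partial>lborel)"
    if "f \<in> borel_measurable borel" for f
    using that unfolding E_def
    by (subst nn_integral_density) (auto intro!: nn_integral_cong simp: exponential_density_def split: split_indicator)
  have Imeas[measurable]: "interference g z S \<in> borel_measurable Q"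
    unfolding interference_def[abs_def] Q_def
    by (intro borel_measurable_nn_integral_count_space S) measurable
  have tail: "emeasure E {h. ennreal T \<le> ennreal (h * g z) / a} = expm (ennreal (r * T / g z) * a)" for a
  proof -
    have m: "{h::real. ennreal T \<le> ennreal (h * g z) / a} \<in> sets borel" by measurable
    have e: "emeasure E {h. ennreal T \<le> ennreal (h * g z) / a} =
      (\<integral>\<^sup>+h. ennreal (r * exp (- (h * r))) * indicator {h. ennreal T \<le> ennreal (h * g z) / a} h * indicator {0..} h \<partial>lborel)"
      using dens[OF borel_measurable_indicator[OF m]] nn_integral_indicator[of _ E] m by simp
    consider "a = 0" | "a = \<infinity>" | t where "0 < t" "a = ennreal t"
      by (cases a) (auto simp: less_le)
    then show ?thesis
    proof cases
      \<comment> \<open>Without interference the ratio is infinite except at \<open>h = 0\<close>,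
        where 0 / 0 = 0 in \<open>ennreal\<close> makes the event fail; that point is null.\<close>
      case 1
      have "(\<integral>\<^sup>+h. ennreal (r * exp (- (h * r))) * indicator {h. ennreal T \<le> ennreal (h * g z) / a} h * indicator {0..} h \<partial>lborel)
         = (\<integral>\<^sup>+h. ennreal (r * exp (- (h * r))) * indicator {0..} h \<partial>lborel)"
        using AE_lborel_singleton[of "0::real"]
        by (intro nn_integral_cong_AE, eventually_elim)
           (use gz in \<open>auto simp: 1 ennreal_divide_zero zero_less_mult_iff ennreal_zero_divide split: split_indicator\<close>)
      then show ?thesis using r unfolding e by (simp add: nn_integral_exponential_atLeast[of r r 0] 1)
    next
      case 2
      have "{h. ennreal T \<le> ennreal (h * g z) / a} = {}" using T by (auto simp: 2)
      then show ?thesis using r T gz by (simp add: 2 ennreal_mult_top)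
    next
      case 3
      have "ennreal T \<le> ennreal (h * g z) / a \<longleftrightarrow> T * t / g z \<le> h" if "0 \<le> h" for h
        using that 3 gz T by (simp add: divide_ennreal field_simps)
      moreover have "0 \<le> T * t / g z" using T gz 3 by simp
      ultimately have "(\<integral>\<^sup>+h. ennreal (r * exp (- (h * r))) * indicator {h. ennreal T \<le> ennreal (h * g z) / a} h * indicator {0..} h \<partial>lborel)
         = (\<integral>\<^sup>+h. ennreal (r * exp (- (h * r))) * indicator {T * t / g z..} h \<partial>lborel)"
        by (intro nn_integral_cong) (auto split: split_indicator)
      also have "\<dots> = ennreal (exp (- (T * t / g z * r)))"
        using r by (simp add: nn_integral_exponential_atLeast[of r r])
      also have "\<dots> = expm (ennreal (r * T / g z) * a)"
        using 3 r T gz by (simp flip: ennreal_mult' add: mult_ac)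
      finally show ?thesis unfolding e .
    qed
  qed
  have single: "neglog (\<integral>\<^sup>+h. expm (ennreal (r * T / g z) * ennreal (h * b)) \<partial>E) =
      ennreal (ln (1 + T * max 0 b / g z))" for b
  proof -
    define a where "a = r * T / g z * max 0 b"
    have a: "0 \<le> a" using r T gz by (simp add: a_def)
    have "expm (ennreal (r * T / g z) * ennreal (h * b)) = ennreal (exp (- (h * a)))" if "0 \<le> h" for h
    proof -
      have "ennreal (h * b) = ennreal (h * max 0 b)"
        using that by (auto simp: max_def ennreal_neg mult_nonneg_nonpos)
      moreover have "ennreal (r * T / g z) * ennreal (h * max 0 b) = ennreal (h * a)"
        using r T gz that by (simp flip: ennreal_mult' add: a_def mult_ac)
      ultimately show ?thesis using a that by simp
    qed
    then have "(\<integral>\<^sup>+h. expm (ennreal (r * T / g z) * ennreal (h * b)) \<partial>E) =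
       (\<integral>\<^sup>+h. ennreal (r * exp (- (h * (r + a)))) * indicator {0..} h \<partial>lborel)"
      using r by (subst dens) (auto intro!: nn_integral_cong split: split_indicator
        simp flip: ennreal_mult' exp_add simp: algebra_simps)
    also have "\<dots> = ennreal (r / (r + a))"
      using r a nn_integral_exponential_atLeast[of r "r + a" 0] by simp
    finally have "neglog (\<integral>\<^sup>+h. expm (ennreal (r * T / g z) * ennreal (h * b)) \<partial>E) = ennreal (ln ((r + a) / r))"
      using r a by (simp add: neglog_def ln_div)
    also have "(r + a) / r = 1 + T * max 0 b / g z" using r gz by (simp add: a_def field_simps)
    finally show ?thesis .
  qed
  have "conditional_success_prob r g z T S =
    emeasure (E \<Otimes>\<^sub>M Q) {(h, hs) \<in> space (E \<Otimes>\<^sub>M Q). ennreal T \<le> ennreal (h * g z) / interference g z S hs}"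
    by (simp add: conditional_success_prob_def E_def Q_def Let_def)
  also have "{(h, hs) \<in> space (E \<Otimes>\<^sub>M Q). ennreal T \<le> ennreal (h * g z) / interference g z S hs} =
      {p \<in> space (E \<Otimes>\<^sub>M Q). ennreal T \<le> ennreal (fst p * g z) / interference g z S (snd p)}"
    by auto
  also have "emeasure (E \<Otimes>\<^sub>M Q) \<dots> =
      (\<integral>\<^sup>+hs. emeasure E {h. ennreal T \<le> ennreal (h * g z) / interference g z S hs} \<partial>Q)"
    by (subst EQ.emeasure_pair_measure_alt2)
       (auto intro!: nn_integral_cong arg_cong[where f="emeasure E"] simp: space_pair_measure)
  also have "\<dots> = (\<integral>\<^sup>+hs. expm (\<integral>\<^sup>+x. ennreal (r * T / g z) * ennreal (hs x * g (x - z)) \<partial>count_space S) \<partial>Q)"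
    by (simp add: tail interference_def nn_integral_cmult)
  also have "\<dots> = expm (\<integral>\<^sup>+x. neglog (\<integral>\<^sup>+h. expm (ennreal (r * T / g z) * ennreal (h * g (x - z))) \<partial>E) \<partial>count_space S)"
    unfolding Q_def using S
    by (intro nn_integral_PiM_expm[where U="\<lambda>x h. ennreal (r * T / g z) * ennreal (h * g (x - z))"] E.prob_space_axioms) auto
  finally show ?thesis by (simp add: single loss_exponent_def)
qed

section \<open>The reduced Palm distribution\<close>

lemma space_configurations: "space configurations = {S. \<forall>B. bounded B \<longrightarrow> finite (S \<inter> B)}"
  unfolding configurations_def by (rule space_measure_of) auto

lemma countable_configuration:
  assumes "S \<in> space configurations"
  shows "countable S"
proof -
  have "S = (\<Union>n. S \<inter> ball 0 (real n))"
    by (auto simp: reals_Archimedean2)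
  moreover have "countable (S \<inter> ball 0 (real n))" for n
    using assms by (auto simp: space_configurations intro: countable_finite)
  then have "countable (\<Union>n. S \<inter> ball 0 (real n))" by (intro countable_UN) auto
  ultimately show ?thesis by simp
qed

lemma measurable_card_configurations:
  assumes "B \<in> sets borel" "bounded B"
  shows "(\<lambda>S. card (S \<inter> B)) \<in> measurable configurations (count_space UNIV)"
proof (subst measurable_count_space_eq2_countable, safe)
  fix n
  have "(\<lambda>S. card (S \<inter> B)) -` {n} \<inter> space configurations =
      {S. (\<forall>B'. bounded B' \<longrightarrow> finite (S \<inter> B')) \<and> card (S \<inter> B) = n}"
    by (auto simp: space_configurations)
  also have "\<dots> \<in> sets configurations"
    unfolding configurations_def using assms by (subst sets_measure_of) (auto intro!: sigma_sets.Basic)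
  finally show "(\<lambda>S. card (S \<inter> B)) -` {n} \<inter> space configurations \<in> sets configurations" .
qed auto

lemma borel_measurable_sum_configurations:
  fixes U :: "real^2 \<Rightarrow> ennreal"
  assumes "U \<in> borel_measurable borel"
  shows "(\<lambda>S. \<integral>\<^sup>+x. U x \<partial>count_space S) \<in> borel_measurable configurations"
  using assms
proof (induction U rule: borel_measurable_induct)
  case (cong f g)
  then have "f = g" by auto
  with cong show ?case by simp
next
  \<comment> \<open>Only counts in bounded Borel sets generate the sigma-algebra, and
    \<open>card\<close> would be 0 on an infinite set, so \<open>A\<close> is exhausted by bounded
    pieces.\<close>
  case (set A)
  have "(\<integral>\<^sup>+x. indicator A x \<partial>count_space S) = (SUP n. of_nat (card (S \<inter> (A \<inter> ball 0 (real n)))))"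
    if "S \<in> space configurations" for S
  proof -
    have fin: "finite (S \<inter> (A \<inter> ball 0 (real n)))" for n
      using that by (auto simp: space_configurations intro: bounded_subset[OF bounded_ball])
    have "(\<integral>\<^sup>+x. indicator A x \<partial>count_space S) =
      (\<integral>\<^sup>+x. (SUP n. indicator (A \<inter> ball 0 (real n)) x) \<partial>count_space S)"
    proof (intro nn_integral_cong antisym)
      fix x :: "real^2"
      obtain n where "norm x < real n" using reals_Archimedean2 by blast
      then show "indicator A x \<le> (SUP n. indicator (A \<inter> ball 0 (real n)) x :: ennreal)"
        by (intro SUP_upper2[of n]) (auto split: split_indicator)
    qed (auto intro!: SUP_least split: split_indicator)
    also have "\<dots> = (SUP n. \<integral>\<^sup>+x. indicator (A \<inter> ball 0 (real n)) x \<partial>count_space S)"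
      by (intro nn_integral_monotone_convergence_SUP)
         (auto simp: incseq_def le_fun_def split: split_indicator)
    also have "\<dots> = (SUP n. of_nat (card (S \<inter> (A \<inter> ball 0 (real n)))))"
    proof (intro SUP_cong refl)
      fix n
      have "(\<integral>\<^sup>+x. indicator (A \<inter> ball 0 (real n)) x \<partial>count_space S) =
        (\<Sum>x\<in>S \<inter> (A \<inter> ball 0 (real n)). indicator (A \<inter> ball 0 (real n)) x)"
        using fin by (intro nn_integral_count_space') (auto split: split_indicator)
      then show "(\<integral>\<^sup>+x. indicator (A \<inter> ball 0 (real n)) x \<partial>count_space S) = of_nat (card (S \<inter> (A \<inter> ball 0 (real n))))"
        by simp
    qed
    finally show ?thesis .
  qed
  moreover have "(\<lambda>S. SUP n. of_nat (card (S \<inter> (A \<inter> ball 0 (real n)))) :: ennreal) \<in> borel_measurable configurations"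
  proof (intro borel_measurable_SUP measurable_compose[OF measurable_card_configurations])
    show "A \<inter> ball 0 (real n) \<in> sets borel" "bounded (A \<inter> ball 0 (real n))" for n
      using set by (auto intro: bounded_subset[OF bounded_ball])
  qed auto
  ultimately show ?case by (subst measurable_cong) auto
next
  case (mult u c)
  then show ?case by (simp add: nn_integral_cmult)
next
  case (add u v)
  then show ?case by (simp add: nn_integral_add)
next
  case (seq U)
  have "(\<integral>\<^sup>+x. (SUP i. U i) x \<partial>count_space S) = (SUP i. \<integral>\<^sup>+x. U i x \<partial>count_space S)" for S
    unfolding SUP_apply using seq(3) by (intro nn_integral_monotone_convergence_SUP) auto
  moreover have "(\<lambda>S. SUP i. \<integral>\<^sup>+x. U i x \<partial>count_space S) \<in> borel_measurable configurations"
    by (intro borel_measurable_SUP seq) auto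
  ultimately show ?case by (simp only:)
qed

text \<open>\<open>measure_of\<close> returns the prescribed values only for a set function that is
  a measure, and \<open>\<Phi>\<close> is known only almost surely. Indexing the points by a
  countable type with a random active set \<open>J\<close> exhibits the Palm distribution as the
  image of a weighted measure on pairs of an index and an outcome; this settles additivity and
  measurability and turns integrals into sums over indices. \<open>I0\<close> is the mean number of
  points in the window.\<close>

lemma success_prob_indexed:
  fixes Z :: "'i :: countable \<Rightarrow> 'w \<Rightarrow> real^2" and J :: "'w \<Rightarrow> 'i set" and M :: "'w measure"
  assumes M: "prob_space M"
    and Z[measurable]: "\<And>p. Z p \<in> borel_measurable M"
    and J[measurable]: "\<And>p. Measurable.pred M (\<lambda>\<omega>. p \<in> J \<omega>)"
    and inj: "AE \<omega> in M. inj_on (\<lambda>p. Z p \<omega>) (J \<omega>)"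
    and locfin: "AE \<omega> in M. \<forall>B. bounded B \<longrightarrow> finite {p\<in>J \<omega>. Z p \<omega> \<in> B}"
    and \<Phi>: "AE \<omega> in M. \<Phi> \<omega> = (\<lambda>p. Z p \<omega>) ` J \<omega>"
    and I0: "I0 = (\<integral>\<^sup>+\<omega>. \<integral>\<^sup>+p. indicator (J \<omega>) p * indicator (cbox 0 1) (Z p \<omega>) \<partial>count_space UNIV \<partial>M)"
    and r: "0 < r" and T: "0 < T" and gz: "0 < g z" and [measurable]: "g \<in> borel_measurable borel"
  shows "success_prob r g z T M \<Phi> =
    (\<integral>\<^sup>+\<omega>. \<integral>\<^sup>+p. indicator (J \<omega>) p * indicator (cbox 0 1) (Z p \<omega>) *
        expm (\<integral>\<^sup>+q. indicator (J \<omega> - {p}) q * ennreal (loss_exponent g z T (Z q \<omega> - Z p \<omega>)) \<partial>count_space UNIV)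
      \<partial>count_space UNIV \<partial>M) / I0"
proof -
  interpret prob_space M by fact
  have U[measurable]: "(\<lambda>x. ennreal (loss_exponent g z T x)) \<in> borel_measurable borel"
    unfolding loss_exponent_def by measurable
  have "AE \<omega> in M. inj_on (\<lambda>p. Z p \<omega>) (J \<omega>) \<and> (\<forall>B. bounded B \<longrightarrow> finite {p\<in>J \<omega>. Z p \<omega> \<in> B}) \<and> \<Phi> \<omega> = (\<lambda>p. Z p \<omega>) ` J \<omega>"
    using inj locfin \<Phi> by eventually_elim auto
  then obtain N where N: "{\<omega>\<in>space M. \<not> (inj_on (\<lambda>p. Z p \<omega>) (J \<omega>) \<and> (\<forall>B. bounded B \<longrightarrow> finite {p\<in>J \<omega>. Z p \<omega> \<in> B}) \<and> \<Phi> \<omega> = (\<lambda>p. Z p \<omega>) ` J \<omega>)} \<subseteq> N"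
    "N \<in> null_sets M"
    by (elim AE_E) (auto simp: null_sets_def)
  define G where "G = space M - N"
  have G[measurable]: "G \<in> sets M" using N by (auto simp: G_def)
  have AEG: "AE \<omega> in M. \<omega> \<in> G"
    using AE_not_in[OF N(2)] AE_space by eventually_elim (auto simp: G_def)
  have Ginj: "inj_on (\<lambda>p. Z p \<omega>) (J \<omega>)" and Gfin: "\<And>B. bounded B \<Longrightarrow> finite {p\<in>J \<omega>. Z p \<omega> \<in> B}"
    and G\<Phi>: "\<Phi> \<omega> = (\<lambda>p. Z p \<omega>) ` J \<omega>" if "\<omega> \<in> G" for \<omega>
    using that N(1) by (auto simp: G_def)
  \<comment> \<open>The configuration seen from the point with index \<open>p\<close>. The empty one
    is the default off \<open>G\<close> and for inactive indices, so that the map is total and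
    measurable.\<close>
  define \<tau> where "\<tau> p \<omega> = (if \<omega> \<in> G \<and> p \<in> J \<omega> then (\<lambda>y. y - Z p \<omega>) ` (\<Phi> \<omega> - {Z p \<omega>}) else {})" for p \<omega>
  have \<tau>_bij: "bij_betw (\<lambda>q. Z q \<omega> - Z p \<omega>) (J \<omega> - {p}) (\<tau> p \<omega>)" if "\<omega> \<in> G" "p \<in> J \<omega>" for p \<omega>
    using Ginj[OF that(1)] that by (auto simp: bij_betw_def inj_on_def \<tau>_def G\<Phi>)
  have \<tau>_fin: "finite (\<tau> p \<omega> \<inter> B)" if "bounded B" for p \<omega> B
  proof (cases "\<omega> \<in> G \<and> p \<in> J \<omega>")
    case True
    have "\<tau> p \<omega> \<inter> B \<subseteq> (\<lambda>q. Z q \<omega> - Z p \<omega>) ` {q\<in>J \<omega>. Z q \<omega> \<in> (+) (Z p \<omega>) ` B}"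
      using bij_betw_imp_surj_on[OF \<tau>_bij[of \<omega> p]] True by (force simp: image_iff)
    moreover have "finite {q\<in>J \<omega>. Z q \<omega> \<in> (+) (Z p \<omega>) ` B}"
      using True that by (intro Gfin bounded_translation) auto
    ultimately show ?thesis by (meson finite_imageI finite_subset)
  qed (auto simp: \<tau>_def)
  have \<tau>_sum: "(\<integral>\<^sup>+x. f x \<partial>count_space (\<tau> p \<omega>)) = (\<integral>\<^sup>+q. indicator (J \<omega> - {p}) q * f (Z q \<omega> - Z p \<omega>) \<partial>count_space UNIV)"
    if "\<omega> \<in> G" "p \<in> J \<omega>" for p \<omega> and f :: "real^2 \<Rightarrow> ennreal"
    by (subst nn_integral_bij_count_space[OF \<tau>_bij[OF that], symmetric])
       (simp add: nn_integral_count_space_indicator mult.commute)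
  have Jind[measurable]: "(\<lambda>\<omega>. indicator (J \<omega>) p :: ennreal) \<in> borel_measurable M"
     "(\<lambda>\<omega>. indicator (J \<omega> - {q}) p :: ennreal) \<in> borel_measurable M" for p q
    by (simp_all add: indicator_def of_bool_def)
  have summeas[measurable]: "(\<lambda>\<omega>. \<integral>\<^sup>+q. indicator (J \<omega> - {p}) q * f (Z q \<omega> - Z p \<omega>) \<partial>count_space UNIV) \<in> borel_measurable M"
    if [measurable]: "f \<in> borel_measurable borel" for f :: "real^2 \<Rightarrow> ennreal" and p
    by (intro borel_measurable_nn_integral_count_space) auto
  have \<tau>[measurable]: "\<tau> p \<in> measurable M configurations" for p
    unfolding configurations_def
  proof (rule measurable_measure_of)
    show "\<tau> p \<in> space M \<rightarrow> {S. \<forall>B. bounded B \<longrightarrow> finite (S \<inter> B)}" using \<tau>_fin by auto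
  next
    fix Y assume "Y \<in> {{S. (\<forall>B'. bounded B' \<longrightarrow> finite (S \<inter> B')) \<and> card (S \<inter> B) = n} | B n. B \<in> sets borel \<and> bounded (B :: (real^2) set)}"
    then obtain B n where Y: "Y = {S. (\<forall>B'. bounded B' \<longrightarrow> finite (S \<inter> B')) \<and> card (S \<inter> B) = n}"
      and B[measurable]: "B \<in> sets borel" and bB: "bounded B" by auto
    \<comment> \<open>The count in \<open>B\<close>, rewritten as a sum over indices whose terms are
      measurable in \<open>\<omega>\<close>.\<close>
    define c where "c \<omega> = (if \<omega> \<in> G \<and> p \<in> J \<omega> then \<integral>\<^sup>+q. indicator (J \<omega> - {p}) q * indicator B (Z q \<omega> - Z p \<omega>) \<partial>count_space UNIV else 0 :: ennreal)" for \<omega>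
    have [measurable]: "c \<in> borel_measurable M" unfolding c_def by measurable
    have "c \<omega> = of_nat (card (\<tau> p \<omega> \<inter> B))" for \<omega>
    proof (cases "\<omega> \<in> G \<and> p \<in> J \<omega>")
      case True
      then have "c \<omega> = (\<integral>\<^sup>+x. indicator B x \<partial>count_space (\<tau> p \<omega>))"
        by (simp add: c_def \<tau>_sum)
      also have "\<dots> = (\<Sum>x\<in>\<tau> p \<omega> \<inter> B. indicator B x)"
        using \<tau>_fin[OF bB] by (intro nn_integral_count_space') (auto split: split_indicator)
      finally show ?thesis by simp
    next
      case False
      then show ?thesis by (auto simp: c_def \<tau>_def)
    qed
    then have "\<tau> p -` Y \<inter> space M = {\<omega>\<in>space M. c \<omega> = of_nat n}"
      using \<tau>_fin by (auto simp: Y)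
    then show "\<tau> p -` Y \<inter> space M \<in> sets M" by simp
  qed auto
  define w where "w p \<omega> = (indicator (J \<omega>) p * indicator (cbox 0 1) (Z p \<omega>) :: ennreal)" for p \<omega>
  have w[measurable]: "w p \<in> borel_measurable M" for p unfolding w_def by measurable
  \<comment> \<open>An image measure, hence countably additive by construction; below it is found to
    agree with the Palm set function on every measurable set.\<close>
  define K where "K = distr (density (count_space UNIV \<Otimes>\<^sub>M M) (\<lambda>(p, \<omega>). w p \<omega> * inverse I0)) configurations (\<lambda>(p, \<omega>). \<tau> p \<omega>)"
  have wm: "(\<lambda>(p, \<omega>). w p \<omega> * inverse I0) \<in> borel_measurable (count_space UNIV \<Otimes>\<^sub>M M)"
    by (intro measurable_pair_measure_countable1) auto
  have \<tau>m: "(\<lambda>(p, \<omega>). \<tau> p \<omega>) \<in> measurable (count_space UNIV \<Otimes>\<^sub>M M) configurations"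
    by (intro measurable_pair_measure_countable1) auto
  have K_int: "integral\<^sup>N K F = (\<integral>\<^sup>+\<omega>. \<integral>\<^sup>+p. w p \<omega> * F (\<tau> p \<omega>) \<partial>count_space UNIV \<partial>M) / I0"
    if [measurable]: "F \<in> borel_measurable configurations" for F
  proof -
    have Fm: "(\<lambda>(p, \<omega>). F (\<tau> p \<omega>)) \<in> borel_measurable (count_space UNIV \<Otimes>\<^sub>M M)"
      by (intro measurable_pair_measure_countable1) auto
    have "integral\<^sup>N K F = (\<integral>\<^sup>+x. (case x of (p, \<omega>) \<Rightarrow> w p \<omega> * inverse I0) * F (case x of (p, \<omega>) \<Rightarrow> \<tau> p \<omega>) \<partial>(count_space UNIV \<Otimes>\<^sub>M M))"
      unfolding K_def using \<tau>m wm Fm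
      by (subst nn_integral_distr) (auto simp: nn_integral_density split_beta')
    also have "\<dots> = (\<integral>\<^sup>+p. \<integral>\<^sup>+\<omega>. w p \<omega> * inverse I0 * F (\<tau> p \<omega>) \<partial>M \<partial>count_space UNIV)"
      using wm Fm by (subst nn_integral_fst[symmetric]) (auto simp: split_beta')
    also have "\<dots> = (\<integral>\<^sup>+\<omega>. \<integral>\<^sup>+p. (w p \<omega> * F (\<tau> p \<omega>)) * inverse I0 \<partial>count_space UNIV \<partial>M)"
      by (subst nn_integral_count_space_nn_integral) (auto simp: mult_ac)
    also have "\<dots> = (\<integral>\<^sup>+\<omega>. \<integral>\<^sup>+p. w p \<omega> * F (\<tau> p \<omega>) \<partial>count_space UNIV \<partial>M) * inverse I0"
      by (simp add: nn_integral_multc borel_measurable_nn_integral_count_space)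
    finally show ?thesis by (simp add: divide_ennreal_def)
  qed
  have fin_sum: "(\<Sum>x\<in>\<Phi> \<omega> \<inter> cbox 0 1. F ((\<lambda>y. y - x) ` (\<Phi> \<omega> - {x}))) = (\<integral>\<^sup>+p. w p \<omega> * F (\<tau> p \<omega>) \<partial>count_space UNIV)"
    if \<omega>: "\<omega> \<in> G" for \<omega> and F :: "_ \<Rightarrow> ennreal"
  proof -
    define I where "I = {p\<in>J \<omega>. Z p \<omega> \<in> cbox 0 1}"
    have I: "finite I" unfolding I_def by (intro Gfin \<omega> bounded_cbox)
    have "\<Phi> \<omega> \<inter> cbox 0 1 = (\<lambda>p. Z p \<omega>) ` I" using G\<Phi>[OF \<omega>] by (auto simp: I_def)
    moreover have "inj_on (\<lambda>p. Z p \<omega>) I" using Ginj[OF \<omega>] by (rule inj_on_subset) (auto simp: I_def)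
    ultimately have "(\<Sum>x\<in>\<Phi> \<omega> \<inter> cbox 0 1. F ((\<lambda>y. y - x) ` (\<Phi> \<omega> - {x}))) = (\<Sum>p\<in>I. w p \<omega> * F (\<tau> p \<omega>))"
      using \<omega> by (auto simp: sum.reindex I_def w_def \<tau>_def intro!: sum.cong)
    also have "\<dots> = (\<integral>\<^sup>+p. w p \<omega> * F (\<tau> p \<omega>) \<partial>count_space UNIV)"
      using I by (intro nn_integral_count_space'[symmetric]) (auto simp: I_def w_def split: split_indicator)
    finally show ?thesis .
  qed
  have den: "(\<integral>\<^sup>+\<omega>. of_nat (card (\<Phi> \<omega> \<inter> cbox 0 1)) \<partial>M) = I0"
    unfolding I0 using AEG fin_sum[of _ "\<lambda>_. 1"]
    by (intro nn_integral_cong_AE) (auto simp: w_def)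
  have sK[simp]: "space K = space configurations" "sets K = sets configurations"
    by (simp_all add: K_def)
  have "reduced_palm M \<Phi> = measure_of (space K) (sets K) (emeasure K)"
    unfolding reduced_palm_def sK
  proof (rule measure_of_eq)
    fix Y assume "Y \<in> sigma_sets (space configurations) (sets configurations)"
    then have Y[measurable]: "Y \<in> sets configurations" by (simp add: sets.sigma_sets_eq)
    have "emeasure K Y = (\<integral>\<^sup>+S. indicator Y S \<partial>K)" using Y by simp
    also have "\<dots> = (\<integral>\<^sup>+\<omega>. \<integral>\<^sup>+p. w p \<omega> * indicator Y (\<tau> p \<omega>) \<partial>count_space UNIV \<partial>M) / I0"
      by (intro K_int) simp
    also have "(\<integral>\<^sup>+\<omega>. \<integral>\<^sup>+p. w p \<omega> * indicator Y (\<tau> p \<omega>) \<partial>count_space UNIV \<partial>M) =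
       (\<integral>\<^sup>+\<omega>. (\<Sum>x\<in>\<Phi> \<omega> \<inter> cbox 0 1. indicator Y ((\<lambda>y. y - x) ` (\<Phi> \<omega> - {x}))) \<partial>M)"
      using AEG by (intro nn_integral_cong_AE) (auto simp: fin_sum)
    finally show "(\<integral>\<^sup>+\<omega>. (\<Sum>x\<in>\<Phi> \<omega> \<inter> cbox 0 1. indicator Y ((\<lambda>y. y - x) ` (\<Phi> \<omega> - {x}))) \<partial>M) / (\<integral>\<^sup>+\<omega>. of_nat (card (\<Phi> \<omega> \<inter> cbox 0 1)) \<partial>M) = emeasure K Y"
      by (simp add: den)
  qed (rule sets.space_closed)
  then have palm: "reduced_palm M \<Phi> = K" by (simp only: measure_of_of_measure)
  have "success_prob r g z T M \<Phi> = (\<integral>\<^sup>+S. conditional_success_prob r g z T S \<partial>K)"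
    by (simp add: success_prob_def palm)
  also have "\<dots> = (\<integral>\<^sup>+S. expm (\<integral>\<^sup>+x. ennreal (loss_exponent g z T x) \<partial>count_space S) \<partial>K)"
    by (intro nn_integral_cong conditional_success_prob_eq[where g=g and z=z, OF r T gz] countable_configuration) simp
  also have "\<dots> = (\<integral>\<^sup>+\<omega>. \<integral>\<^sup>+p. w p \<omega> * expm (\<integral>\<^sup>+x. ennreal (loss_exponent g z T x) \<partial>count_space (\<tau> p \<omega>)) \<partial>count_space UNIV \<partial>M) / I0"
    by (intro K_int measurable_compose[OF borel_measurable_sum_configurations measurable_expm] U)
  also have "(\<integral>\<^sup>+\<omega>. \<integral>\<^sup>+p. w p \<omega> * expm (\<integral>\<^sup>+x. ennreal (loss_exponent g z T x) \<partial>count_space (\<tau> p \<omega>)) \<partial>count_space UNIV \<partial>M) =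
    (\<integral>\<^sup>+\<omega>. \<integral>\<^sup>+p. indicator (J \<omega>) p * indicator (cbox 0 1) (Z p \<omega>) *
        expm (\<integral>\<^sup>+q. indicator (J \<omega> - {p}) q * ennreal (loss_exponent g z T (Z q \<omega> - Z p \<omega>)) \<partial>count_space UNIV)
      \<partial>count_space UNIV \<partial>M)"
    using AEG
  proof (intro nn_integral_cong_AE, eventually_elim)
    case (elim \<omega>)
    then show ?case
      by (intro nn_integral_cong) (auto simp: w_def \<tau>_sum split: split_indicator)
  qed
  finally show ?thesis .
qed

section \<open>Mecke's formula\<close>

lemma nn_integral_poisson_power:
  assumes "0 \<le> m" "0 \<le> u"
  shows "(\<integral>\<^sup>+n. ennreal (u ^ n) * ennreal (m ^ n / fact n * exp (- m)) \<partial>count_space UNIV) =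
    ennreal (exp (- (m * (1 - u))))"
proof -
  have "(\<lambda>n. (m * u) ^ n / fact n * exp (- m)) sums (exp (m * u) * exp (- m))"
    using exp_converges[of "m * u"] by (intro sums_mult2) (simp add: field_simps)
  then have "(\<Sum>n. ennreal ((m * u) ^ n / fact n * exp (- m))) = ennreal (exp (m * u) * exp (- m))"
    using assms by (intro suminf_ennreal_eq) auto
  also have "exp (m * u) * exp (- m) = exp (- (m * (1 - u)))"
    by (simp add: algebra_simps flip: exp_add)
  also have "(\<lambda>n. ennreal ((m * u) ^ n / fact n * exp (- m))) =
      (\<lambda>n. ennreal (u ^ n) * ennreal (m ^ n / fact n * exp (- m)))"
    using assms by (simp add: power_mult_distrib mult_ac flip: ennreal_mult')
  finally show ?thesis by (simp add: nn_integral_count_space_nat)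
qed

text \<open>This is the derivative in \<open>u\<close> of the generating function: one of the
  \<open>n\<close> points is marked and removed. The factor \<open>n\<close> annihilates the term
  \<open>n = 0\<close>, where \<open>n - 1\<close> is truncated.\<close>

lemma nn_integral_poisson_size_biased:
  assumes "0 \<le> m" "0 \<le> u"
  shows "(\<integral>\<^sup>+n. of_nat n * ennreal (u ^ (n - 1)) * ennreal (m ^ n / fact n * exp (- m)) \<partial>count_space UNIV) =
    ennreal (m * exp (- (m * (1 - u))))"
proof -
  define F where "F n = real n * u ^ (n - 1) * (m ^ n / fact n * exp (- m))" for n
  have "(\<lambda>n. m * exp (- m) * ((m * u) ^ n / fact n)) sums (m * exp (- m) * exp (m * u))"
    using exp_converges[of "m * u"] by (intro sums_mult) (simp add: field_simps)
  also have "(\<lambda>n. m * exp (- m) * ((m * u) ^ n / fact n)) = (\<lambda>n. F (Suc n))"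
  proof
    fix n
    show "m * exp (- m) * ((m * u) ^ n / fact n) = F (Suc n)"
      by (simp add: F_def power_mult_distrib fact_Suc mult_ac del: of_nat_Suc)
  qed
  finally have "F sums (m * exp (- m) * exp (m * u) + F 0)"
    by (rule sums_Suc)
  then have "(\<Sum>n. ennreal (F n)) = ennreal (m * exp (- m) * exp (m * u) + F 0)"
    by (intro suminf_ennreal_eq) (use assms in \<open>simp add: F_def\<close>)
  also have "m * exp (- m) * exp (m * u) + F 0 = m * exp (- (m * (1 - u)))"
    by (simp add: F_def algebra_simps flip: exp_add)
  also have "(\<lambda>n. ennreal (F n)) = (\<lambda>n. of_nat n * ennreal (u ^ (n - 1)) * ennreal (m ^ n / fact n * exp (- m)))"
    using assms by (simp add: F_def ennreal_of_nat_eq_real_of_nat flip: ennreal_mult')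
  finally show ?thesis by (simp add: nn_integral_count_space_nat)
qed

text \<open>The left side of Mecke's formula for the exponential of minus a sum over the other
  points. The weight takes both points, so that fixed weights and weights of the difference are
  covered at once.\<close>

definition mecke_sum ::
    "'w measure \<Rightarrow> (nat \<Rightarrow> 'w \<Rightarrow> real^2) \<Rightarrow> (real^2) set \<Rightarrow> (real^2 \<Rightarrow> real^2 \<Rightarrow> ennreal) \<Rightarrow> ennreal" where
  "mecke_sum M X A W = (\<integral>\<^sup>+\<omega>. \<integral>\<^sup>+i. indicator A (X i \<omega>) *
      expm (\<integral>\<^sup>+j. indicator (- {i}) j * W (X i \<omega>) (X j \<omega>) \<partial>count_space UNIV) \<partial>count_space UNIV \<partial>M)"

text \<open>Dominated convergence is used twice: for each index on the probability space, then for
  the sum over indices, where the integrals of the \<open>w i\<close> dominate.\<close>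

lemma nn_integral_nested_dominated_convergence:
  fixes w :: "'i::countable \<Rightarrow> 'w \<Rightarrow> ennreal"
  assumes [measurable]: "\<And>i. w i \<in> borel_measurable M" "\<And>n i. f n i \<in> borel_measurable M" "\<And>i. h i \<in> borel_measurable M"
    and w: "(\<integral>\<^sup>+\<omega>. \<integral>\<^sup>+i. w i \<omega> \<partial>count_space UNIV \<partial>M) < \<infinity>"
    and le: "\<And>n i \<omega>. f n i \<omega> \<le> w i \<omega>"
    and lim: "\<And>i. AE \<omega> in M. (\<lambda>n. f n i \<omega>) \<longlonglongrightarrow> h i \<omega>"
  shows "(\<lambda>n. \<integral>\<^sup>+\<omega>. \<integral>\<^sup>+i. f n i \<omega> \<partial>count_space UNIV \<partial>M) \<longlonglongrightarrow> (\<integral>\<^sup>+\<omega>. \<integral>\<^sup>+i. h i \<omega> \<partial>count_space UNIV \<partial>M)"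
proof -
  have swap: "(\<integral>\<^sup>+\<omega>. \<integral>\<^sup>+i. k i \<omega> \<partial>count_space UNIV \<partial>M) = (\<integral>\<^sup>+i. \<integral>\<^sup>+\<omega>. k i \<omega> \<partial>M \<partial>count_space UNIV)"
    if "\<And>i. k i \<in> borel_measurable M" for k :: "'i \<Rightarrow> 'w \<Rightarrow> ennreal"
    using that by (intro nn_integral_count_space_nn_integral) auto
  have wfin: "(\<integral>\<^sup>+i. \<integral>\<^sup>+\<omega>. w i \<omega> \<partial>M \<partial>count_space UNIV) < \<infinity>" using w by (simp add: swap)
  have wi: "(\<integral>\<^sup>+\<omega>. w i \<omega> \<partial>M) < \<infinity>" for i
    using nn_integral_ge_point[of i UNIV "\<lambda>i. \<integral>\<^sup>+\<omega>. w i \<omega> \<partial>M"] wfin by (auto intro: le_less_trans)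
  have "(\<lambda>n. \<integral>\<^sup>+i. \<integral>\<^sup>+\<omega>. f n i \<omega> \<partial>M \<partial>count_space UNIV) \<longlonglongrightarrow> (\<integral>\<^sup>+i. \<integral>\<^sup>+\<omega>. h i \<omega> \<partial>M \<partial>count_space UNIV)"
  proof (rule nn_integral_dominated_convergence[where w="\<lambda>i. \<integral>\<^sup>+\<omega>. w i \<omega> \<partial>M"])
    show "AE i in count_space UNIV. (\<lambda>n. \<integral>\<^sup>+\<omega>. f n i \<omega> \<partial>M) \<longlonglongrightarrow> (\<integral>\<^sup>+\<omega>. h i \<omega> \<partial>M)"
    proof (rule AE_I2)
      fix i
      show "(\<lambda>n. \<integral>\<^sup>+\<omega>. f n i \<omega> \<partial>M) \<longlonglongrightarrow> (\<integral>\<^sup>+\<omega>. h i \<omega> \<partial>M)"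
        by (rule nn_integral_dominated_convergence[where w="w i"]) (use wi[of i] le lim in auto)
    qed
    show "AE i in count_space UNIV. (\<integral>\<^sup>+\<omega>. f n i \<omega> \<partial>M) \<le> (\<integral>\<^sup>+\<omega>. w i \<omega> \<partial>M)" for n
      by (intro AE_I2 nn_integral_mono le)
  qed (use wfin in auto)
  then show ?thesis by (simp add: swap)
qed

section \<open>Counts of a Poisson process in disjoint bounded cells\<close>

locale poisson_sequence = prob_space M for M :: "'w measure" +
  fixes l :: real and X :: "nat \<Rightarrow> 'w \<Rightarrow> real^2"
  assumes X_poisson: "poisson_points M l X" and l_pos: "0 < l"
begin

lemma X_measurable [measurable]: "X i \<in> borel_measurable M"
  using X_poisson by (simp add: poisson_points_def)

definition npts :: "(real^2) set \<Rightarrow> 'w \<Rightarrow> nat" where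
  "npts B \<omega> = card (range (\<lambda>i. X i \<omega>) \<inter> B)"

lemma AE_good: "AE \<omega> in M. inj (\<lambda>i. X i \<omega>) \<and> (\<forall>B. bounded B \<longrightarrow> finite {i. X i \<omega> \<in> B})"
proof -
  have "AE \<omega> in M. inj (\<lambda>i. X i \<omega>)" "AE \<omega> in M. range (\<lambda>i. X i \<omega>) \<in> space configurations"
    using X_poisson by (auto simp: poisson_points_def)
  then show ?thesis
  proof eventually_elim
    case (elim \<omega>)
    have "finite {i. X i \<omega> \<in> B}" if "bounded B" for B
    proof (rule finite_imageD)
      have "(\<lambda>i. X i \<omega>) ` {i. X i \<omega> \<in> B} = range (\<lambda>i. X i \<omega>) \<inter> B" by auto
      then show "finite ((\<lambda>i. X i \<omega>) ` {i. X i \<omega> \<in> B})"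
        using elim(2) that by (simp add: space_configurations)
      show "inj_on (\<lambda>i. X i \<omega>) {i. X i \<omega> \<in> B}"
        using elim(1) by (rule inj_on_subset) auto
    qed
    with elim show ?case by auto
  qed
qed

lemma npts_eq_card:
  assumes "inj (\<lambda>i. X i \<omega>)"
  shows "npts B \<omega> = card {i. X i \<omega> \<in> B}"
proof -
  have "(\<lambda>i. X i \<omega>) ` {i. X i \<omega> \<in> B} = range (\<lambda>i. X i \<omega>) \<inter> B" by auto
  moreover have "inj_on (\<lambda>i. X i \<omega>) {i. X i \<omega> \<in> B}" using assms by (rule inj_on_subset) auto
  ultimately show ?thesis unfolding npts_def by (metis card_image)
qed

abbreviation poisson_weight :: "(real^2) set \<Rightarrow> nat \<Rightarrow> ennreal" where
  "poisson_weight B n \<equiv> ennreal ((l * measure lborel B) ^ n / fact n * exp (- (l * measure lborel B)))"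

lemma nn_integral_npts:
  assumes B: "B \<in> sets borel" "bounded B" and m: "npts B \<in> measurable M (count_space UNIV)"
  shows "(\<integral>\<^sup>+\<omega>. F (npts B \<omega>) \<partial>M) =
    (\<integral>\<^sup>+n. F n * poisson_weight B n \<partial>count_space UNIV)"
proof -
  note m[measurable]
  have "(\<integral>\<^sup>+\<omega>. F (npts B \<omega>) \<partial>M) = (\<integral>\<^sup>+\<omega>. \<integral>\<^sup>+n. F n * indicator {\<omega>\<in>space M. npts B \<omega> = n} \<omega> \<partial>count_space UNIV \<partial>M)"
  proof (intro nn_integral_cong)
    fix \<omega> assume "\<omega> \<in> space M"
    then show "F (npts B \<omega>) = (\<integral>\<^sup>+n. F n * indicator {\<omega>\<in>space M. npts B \<omega> = n} \<omega> \<partial>count_space UNIV)"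
      by (subst nn_integral_count_space'[where A="{npts B \<omega>}"]) auto
  qed
  also have "\<dots> = (\<integral>\<^sup>+n. \<integral>\<^sup>+\<omega>. F n * indicator {\<omega>\<in>space M. npts B \<omega> = n} \<omega> \<partial>M \<partial>count_space UNIV)"
    by (intro nn_integral_count_space_nn_integral) auto
  also have "\<dots> = (\<integral>\<^sup>+n. F n * poisson_weight B n \<partial>count_space UNIV)"
  proof (intro nn_integral_cong)
    fix n
    have "measure M {\<omega>\<in>space M. npts B \<omega> = n} = (l * measure lborel B) ^ n / fact n * exp (- (l * measure lborel B))"
      using X_poisson B unfolding poisson_points_def npts_def by blast
    moreover have "{\<omega>\<in>space M. npts B \<omega> = n} \<in> sets M" by measurable
    ultimately show "(\<integral>\<^sup>+\<omega>. F n * indicator {\<omega>\<in>space M. npts B \<omega> = n} \<omega> \<partial>M) =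
      F n * poisson_weight B n"
      by (simp only: nn_integral_cmult_indicator emeasure_eq_measure)
  qed
  finally show ?thesis .
qed

text \<open>Independence is assumed for sequences of disjoint sets; a finite family is enumerated
  and padded with empty cells. The measurability of the counts is extracted from
  \<open>indep_vars\<close>, of which it is a part.\<close>

lemma nn_integral_prod_npts:
  assumes I: "finite I" and B: "\<And>k. k \<in> I \<Longrightarrow> B k \<in> sets borel \<and> bounded (B k)" "disjoint_family_on B I"
  shows "(\<integral>\<^sup>+\<omega>. (\<Prod>k\<in>I. F k (npts (B k) \<omega>)) \<partial>M) =
    (\<Prod>k\<in>I. \<integral>\<^sup>+n. F k n * poisson_weight (B k) n \<partial>count_space UNIV)"
    and "\<And>k. k \<in> I \<Longrightarrow> npts (B k) \<in> measurable M (count_space UNIV)"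
proof -
  obtain e where e: "bij_betw e {0..<card I} I" using ex_bij_betw_nat_finite[OF I] by blast
  define B' where "B' n = (if n < card I then B (e n) else {})" for n
  have eI: "e n \<in> I" if "n < card I" for n using e that by (auto simp: bij_betw_def)
  have einj: "e n = e m \<longleftrightarrow> n = m" if "n < card I" "m < card I" for n m
    using e that by (auto simp: bij_betw_def inj_on_def)
  have "disjoint_family B'"
    using B(2) eI einj by (auto simp: disjoint_family_on_def B'_def split: if_splits)
  moreover have B': "B' k \<in> sets borel \<and> bounded (B' k)" for k using B(1) eI by (auto simp: B'_def)
  ultimately have ind: "indep_vars (\<lambda>_. count_space UNIV) (\<lambda>k. npts (B' k)) UNIV"
    using X_poisson unfolding poisson_points_def npts_def by auto
  then have m: "npts (B' k) \<in> measurable M (count_space UNIV)" for k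
    by (auto simp: indep_vars_def)
  { fix k assume "k \<in> I"
    then have "k \<in> e ` {0..<card I}" using e by (simp add: bij_betw_def)
    then obtain n where "n < card I" "k = e n" by auto
    then show "npts (B k) \<in> measurable M (count_space UNIV)" using m[of n] by (simp add: B'_def) }
  have "(\<integral>\<^sup>+\<omega>. (\<Prod>k\<in>I. F k (npts (B k) \<omega>)) \<partial>M) = (\<integral>\<^sup>+\<omega>. (\<Prod>n\<in>{0..<card I}. F (e n) (npts (B' n) \<omega>)) \<partial>M)"
    by (intro nn_integral_cong) (subst prod.reindex_bij_betw[OF e, symmetric], auto simp: B'_def intro!: prod.cong)
  also have "\<dots> = (\<Prod>n\<in>{0..<card I}. \<integral>\<^sup>+\<omega>. F (e n) (npts (B' n) \<omega>) \<partial>M)"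
    by (intro indep_vars_nn_integral indep_vars_compose2[OF indep_vars_subset[OF ind]]) auto
  also have "\<dots> = (\<Prod>k\<in>I. \<integral>\<^sup>+n. F k n * poisson_weight (B k) n \<partial>count_space UNIV)"
    unfolding prod.reindex_bij_betw[OF e, symmetric]
  proof (intro prod.cong refl)
    fix n assume "n \<in> {0..<card I}"
    then have "B' n = B (e n)" by (simp add: B'_def)
    then show "(\<integral>\<^sup>+\<omega>. F (e n) (npts (B' n) \<omega>) \<partial>M) = (\<integral>\<^sup>+i. F (e n) i *
        poisson_weight (B (e n)) i \<partial>count_space UNIV)"
      using nn_integral_npts[of "B' n" "F (e n)"] B' m by metis
  qed
  finally show "(\<integral>\<^sup>+\<omega>. (\<Prod>k\<in>I. F k (npts (B k) \<omega>)) \<partial>M) =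
    (\<Prod>k\<in>I. \<integral>\<^sup>+n. F k n * poisson_weight (B k) n \<partial>count_space UNIV)" .
qed

text \<open>Independence of the counts factorises the expectation over the cells. A marked point is
  removed from its own cell only: that cell contributes the size-biased value, with the extra factor
  \<open>l\<close> times its area, and every other cell the plain generating function.\<close>

lemma mecke_sum_cells:
  fixes I :: "'k set"
  assumes I: "finite I" and B: "\<And>k. k \<in> I \<Longrightarrow> B k \<in> sets borel \<and> bounded (B k)" "disjoint_family_on B I"
    and K: "K \<subseteq> I" and a: "\<And>k. k \<in> I \<Longrightarrow> 0 \<le> a k"
  shows "mecke_sum M X (\<Union>k\<in>K. B k) (\<lambda>_ y. \<Sum>k\<in>I. ennreal (a k) * indicator (B k) y) =
    (\<Sum>k\<in>K. ennreal (l * measure lborel (B k))) *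
      expm (\<Sum>k\<in>I. ennreal (l * measure lborel (B k) * (1 - exp (- a k))))"
proof -
  define u where "u k = exp (- a k)" for k
  define m where "m k = l * measure lborel (B k)" for k
  \<comment> \<open>The factor of cell \<open>k'\<close> when the marked point lies in cell
    \<open>k\<close>.\<close>
  define F where "F k k' n = (if k' = k then of_nat n * ennreal (u k' ^ (n - 1)) else ennreal (u k' ^ n))" for k k' and n :: nat
  have finK: "finite K" using I K by (rule finite_subset[rotated])
  note meas = nn_integral_prod_npts(2)[OF I B]
  have path: "(\<integral>\<^sup>+i. indicator (\<Union>k\<in>K. B k) (X i \<omega>) *
      expm (\<integral>\<^sup>+j. indicator (- {i}) j * (\<Sum>k\<in>I. ennreal (a k) * indicator (B k) (X j \<omega>)) \<partial>count_space UNIV) \<partial>count_space UNIV)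
    = (\<Sum>k\<in>K. \<Prod>k'\<in>I. F k k' (npts (B k') \<omega>))"
    if inj: "inj (\<lambda>i. X i \<omega>)" and lf: "\<And>B. bounded B \<Longrightarrow> finite {i. X i \<omega> \<in> B}" for \<omega>
  proof -
    define c where "c k = (\<Prod>k'\<in>I. ennreal (u k' ^ (if k' = k then npts (B k') \<omega> - 1 else npts (B k') \<omega>)))" for k
    have inner: "expm (\<integral>\<^sup>+j. indicator (- {i}) j * (\<Sum>k\<in>I. ennreal (a k) * indicator (B k) (X j \<omega>)) \<partial>count_space UNIV) = c k"
      if k: "k \<in> I" "X i \<omega> \<in> B k" for i k
    proof -
      have cnt: "(\<integral>\<^sup>+j. indicator (- {i}) j * indicator (B k') (X j \<omega>) \<partial>count_space UNIV) =
        of_nat (if k' = k then npts (B k') \<omega> - 1 else npts (B k') \<omega>)" if k': "k' \<in> I" for k'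
      proof -
        have f: "finite {j. X j \<omega> \<in> B k'}" using B(1) k' by (intro lf) auto
        have "(\<integral>\<^sup>+j. indicator (- {i}) j * indicator (B k') (X j \<omega>) \<partial>count_space UNIV) =
          (\<Sum>j\<in>{j. X j \<omega> \<in> B k'} - {i}. indicator (- {i}) j * indicator (B k') (X j \<omega>))"
          using f by (intro nn_integral_count_space') (auto split: split_indicator)
        also have "\<dots> = of_nat (card ({j. X j \<omega> \<in> B k'} - {i}))"
          by simp
        also have "card ({j. X j \<omega> \<in> B k'} - {i}) = (if k' = k then npts (B k') \<omega> - 1 else npts (B k') \<omega>)"
        proof (cases "k' = k")
          case True
          then show ?thesis using k f by (simp add: npts_eq_card[OF inj] card_Diff_singleton)
        next
          case False
          then have "X i \<omega> \<notin> B k'" using B(2) k k' by (auto simp: disjoint_family_on_def)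
          then show ?thesis using False by (simp add: npts_eq_card[OF inj])
        qed
        finally show ?thesis .
      qed
      have "(\<integral>\<^sup>+j. indicator (- {i}) j * (\<Sum>k\<in>I. ennreal (a k) * indicator (B k) (X j \<omega>)) \<partial>count_space UNIV) =
        (\<Sum>k'\<in>I. ennreal (a k') * (\<integral>\<^sup>+j. indicator (- {i}) j * indicator (B k') (X j \<omega>) \<partial>count_space UNIV))"
        by (simp add: sum_distrib_left nn_integral_sum mult.left_commute nn_integral_cmult)
      also have "expm \<dots> = (\<Prod>k'\<in>I. expm (ennreal (a k' * real (if k' = k then npts (B k') \<omega> - 1 else npts (B k') \<omega>))))"
        using a by (auto simp: expm_sum[OF I] cnt ennreal_of_nat_eq_real_of_nat ennreal_mult' intro!: prod.cong)
      also have "\<dots> = c k" unfolding c_def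
        using a by (intro prod.cong) (auto simp: u_def exp_of_nat_mult[symmetric] mult.commute)
      finally show ?thesis .
    qed
    have "(\<integral>\<^sup>+i. indicator (\<Union>k\<in>K. B k) (X i \<omega>) *
        expm (\<integral>\<^sup>+j. indicator (- {i}) j * (\<Sum>k\<in>I. ennreal (a k) * indicator (B k) (X j \<omega>)) \<partial>count_space UNIV) \<partial>count_space UNIV)
      = (\<integral>\<^sup>+i. (\<Sum>k\<in>K. indicator (B k) (X i \<omega>) * c k) \<partial>count_space UNIV)"
    proof (intro nn_integral_cong)
      fix i
      show "indicator (\<Union>k\<in>K. B k) (X i \<omega>) *
        expm (\<integral>\<^sup>+j. indicator (- {i}) j * (\<Sum>k\<in>I. ennreal (a k) * indicator (B k) (X j \<omega>)) \<partial>count_space UNIV)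
        = (\<Sum>k\<in>K. indicator (B k) (X i \<omega>) * c k)"
      proof (cases "\<exists>k\<in>K. X i \<omega> \<in> B k")
        case True
        then obtain k where k: "k \<in> K" "X i \<omega> \<in> B k" by auto
        then have "indicator (B k') (X i \<omega>) = (if k' = k then 1 else 0 :: ennreal)" if "k' \<in> K" for k'
          using that K B(2) by (auto simp: disjoint_family_on_def split: split_indicator)
        then have "(\<Sum>k'\<in>K. indicator (B k') (X i \<omega>) * c k') = (\<Sum>k'\<in>K. if k' = k then c k' else 0)"
          by (intro sum.cong) auto
        then show ?thesis using k K finK inner[of k i] True by (auto split: split_indicator)
      qed auto
    qed
    also have "\<dots> = (\<Sum>k\<in>K. of_nat (npts (B k) \<omega>) * c k)"
    proof -
      have "(\<integral>\<^sup>+i. indicator (B k) (X i \<omega>) \<partial>count_space UNIV) = of_nat (npts (B k) \<omega>)" if "k \<in> K" for k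
      proof -
        have "(\<integral>\<^sup>+i. indicator (B k) (X i \<omega>) \<partial>count_space UNIV) = (\<Sum>i\<in>{i. X i \<omega> \<in> B k}. indicator (B k) (X i \<omega>))"
          using B(1) K that by (intro nn_integral_count_space' lf) (auto split: split_indicator)
        then show ?thesis by (simp add: npts_eq_card[OF inj])
      qed
      then show ?thesis by (simp add: nn_integral_sum nn_integral_multc)
    qed
    also have "\<dots> = (\<Sum>k\<in>K. \<Prod>k'\<in>I. F k k' (npts (B k') \<omega>))"
    proof (intro sum.cong refl)
      fix k assume "k \<in> K"
      with K have k: "k \<in> I" by auto
      show "of_nat (npts (B k) \<omega>) * c k = (\<Prod>k'\<in>I. F k k' (npts (B k') \<omega>))"
        unfolding c_def prod.remove[OF I k] by (simp add: F_def mult.assoc)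
    qed
    finally show ?thesis .
  qed
  have "mecke_sum M X (\<Union>k\<in>K. B k) (\<lambda>_ y. \<Sum>k\<in>I. ennreal (a k) * indicator (B k) y) =
    (\<integral>\<^sup>+\<omega>. (\<Sum>k\<in>K. \<Prod>k'\<in>I. F k k' (npts (B k') \<omega>)) \<partial>M)"
    unfolding mecke_sum_def using AE_good path by (intro nn_integral_cong_AE) auto
  also have "\<dots> = (\<Sum>k\<in>K. \<integral>\<^sup>+\<omega>. (\<Prod>k'\<in>I. F k k' (npts (B k') \<omega>)) \<partial>M)"
    by (intro nn_integral_sum borel_measurable_prod_ennreal) (auto intro!: measurable_compose[OF meas])
  also have "\<dots> = (\<Sum>k\<in>K. \<Prod>k'\<in>I. \<integral>\<^sup>+n. F k k' n * ennreal (m k' ^ n / fact n * exp (- m k')) \<partial>count_space UNIV)"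
    unfolding m_def by (intro sum.cong refl nn_integral_prod_npts(1) I B) auto
  also have "\<dots> = (\<Sum>k\<in>K. \<Prod>k'\<in>I. (if k' = k then ennreal (m k') else 1) * ennreal (exp (- (m k' * (1 - u k')))))"
  proof (intro sum.cong prod.cong refl)
    fix k k'
    have "0 \<le> m k'" "0 \<le> u k'" using l_pos by (auto simp: m_def u_def)
    from nn_integral_poisson_power[OF this] nn_integral_poisson_size_biased[OF this] this
    show "(\<integral>\<^sup>+n. F k k' n * ennreal (m k' ^ n / fact n * exp (- m k')) \<partial>count_space UNIV) =
      (if k' = k then ennreal (m k') else 1) * ennreal (exp (- (m k' * (1 - u k'))))"
      by (cases "k' = k") (simp_all only: F_def if_True if_False ennreal_mult' mult_1 simp_thms)
  qed
  also have "\<dots> = (\<Sum>k\<in>K. ennreal (m k) * (\<Prod>k'\<in>I. ennreal (exp (- (m k' * (1 - u k'))))))"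
    using K I by (intro sum.cong refl) (auto simp: prod.distrib prod.delta)
  also have "(\<Prod>k'\<in>I. ennreal (exp (- (m k' * (1 - u k'))))) = expm (\<Sum>k\<in>I. ennreal (m k * (1 - u k)))"
    unfolding expm_sum[OF I] using l_pos a by (intro prod.cong) (auto simp: m_def u_def)
  finally show ?thesis by (simp add: m_def u_def sum_distrib_right)
qed

end

lemma emeasure_lborel_bounded: "bounded (A :: 'a::euclidean_space set) \<Longrightarrow> emeasure lborel A < \<infinity>"
  by (rule emeasure_bounded_finite)

lemma nn_integral_lborel_shift:
  fixes k :: "'a::euclidean_space \<Rightarrow> ennreal"
  assumes [measurable]: "k \<in> borel_measurable borel"
  shows "(\<integral>\<^sup>+y. k (y + e) \<partial>lborel) = (\<integral>\<^sup>+y. k y \<partial>lborel)"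
proof -
  have "(\<integral>\<^sup>+y. k y \<partial>lborel) = (\<integral>\<^sup>+y. k y \<partial>distr lborel borel ((+) e))"
    by (simp add: lborel_distr_plus)
  then show ?thesis by (subst (asm) nn_integral_distr) (auto simp: add.commute)
qed

lemma tendsto_one_minus_expm:
  "(f \<longlongrightarrow> a) F \<Longrightarrow> ((\<lambda>x. 1 - expm (f x)) \<longlongrightarrow> 1 - expm a) F"
  using expm_le_1[of a] by (intro tendsto_diff_ennreal tendsto_const tendsto_expm) (auto simp: top_unique)

section \<open>Mecke's formula: from weights constant on cells to stationary weights\<close>

context poisson_sequence
begin

text \<open>The right side of Mecke's formula. Removing a marked point leaves the law of a Poisson
  process unchanged, so the mean number of points in \<open>A\<close> is multiplied by the Laplace
  functional of the whole process.\<close>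

definition mecke_value :: "(real^2) set \<Rightarrow> (real^2 \<Rightarrow> ennreal) \<Rightarrow> ennreal" where
  "mecke_value A U = ennreal l * emeasure lborel A * expm (ennreal l * (\<integral>\<^sup>+y. 1 - expm (U y) \<partial>lborel))"

lemma mecke_measurable:
  assumes [measurable]: "A \<in> sets borel" "case_prod W \<in> borel_measurable (borel \<Otimes>\<^sub>M borel)"
  shows "(\<lambda>\<omega>. indicator A (X i \<omega>) *
      expm (\<integral>\<^sup>+j. indicator (- {i}) j * W (X i \<omega>) (X j \<omega>) \<partial>count_space UNIV)) \<in> borel_measurable M"
proof -
  have [measurable]: "(\<lambda>\<omega>. W (X i \<omega>) (X j \<omega>)) \<in> borel_measurable M" for j
    by (rule measurable_compose[OF _ assms(2), of "\<lambda>\<omega>. (X i \<omega>, X j \<omega>)", simplified]) measurable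
  have [measurable]: "(\<lambda>\<omega>. \<integral>\<^sup>+j. indicator (- {i}) j * W (X i \<omega>) (X j \<omega>) \<partial>count_space UNIV) \<in> borel_measurable M"
    by (intro borel_measurable_nn_integral_count_space) auto
  show ?thesis by measurable
qed

lemma mecke_sum_antimono:
  assumes "\<And>x y. W x y \<le> W' x y"
  shows "mecke_sum M X A W' \<le> mecke_sum M X A W"
  unfolding mecke_sum_def
  by (intro nn_integral_mono mult_left_mono expm_antimono assms) auto

lemma mecke_sum_simple:
  assumes s: "simple_function borel U" and Ufin: "\<And>y. U y < top"
    and U0: "\<And>y. y \<notin> ball 0 r \<Longrightarrow> U y = 0" and A: "A \<in> sets borel" "A \<subseteq> ball 0 r"
  shows "mecke_sum M X A (\<lambda>_. U) = mecke_value A U"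
proof -
  \<comment> \<open>A cell is a level set of \<open>U\<close> within the ball, split further by
    membership in \<open>A\<close>: then \<open>A\<close> is a union of cells, and cells are bounded
    because \<open>U\<close> vanishes off the ball.\<close>
  define I where "I = U ` UNIV \<times> (UNIV :: bool set)"
  define B where "B k = {x\<in>ball 0 r. U x = fst k \<and> (x \<in> A \<longleftrightarrow> snd k)}" for k
  define K where "K = U ` UNIV \<times> {True}"
  define a where "a k = enn2real (fst k)" for k :: "ennreal \<times> bool"
  have [measurable]: "U \<in> borel_measurable borel" using s by (rule borel_measurable_simple_function)
  have I: "finite I" using s by (auto simp: I_def simple_function_def)
  have KI: "K \<subseteq> I" by (auto simp: K_def I_def)
  have Bm[measurable]: "B k \<in> sets borel" for k unfolding B_def using A(1) by measurable
  have Bb: "bounded (B k)" for k by (rule bounded_subset[OF bounded_ball[of 0 r]]) (auto simp: B_def)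
  have disj: "disjoint_family_on B I" by (auto simp: disjoint_family_on_def B_def)
  have AU: "(\<Union>k\<in>K. B k) = A"
  proof (intro antisym subsetI)
    fix x assume "x \<in> A"
    then have "x \<in> B (U x, True)" using A(2) by (auto simp: B_def)
    then show "x \<in> (\<Union>k\<in>K. B k)" by (force simp: K_def)
  qed (auto simp: K_def B_def)
  have cells: "(\<Sum>k\<in>I. \<phi> (fst k) * indicator (B k) y) = (if y \<in> ball 0 r then \<phi> (U y) else 0)"
    for \<phi> :: "ennreal \<Rightarrow> ennreal" and y
  proof (cases "y \<in> ball 0 r")
    case True
    have "(\<Sum>k\<in>I. \<phi> (fst k) * indicator (B k) y) = (\<Sum>k\<in>I. if k = (U y, y \<in> A) then \<phi> (fst k) else 0)"
      using True by (intro sum.cong) (auto simp: B_def split: split_indicator)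
    then show ?thesis using I True by (simp add: sum.delta) (auto simp: I_def)
  qed (auto simp: B_def)
  have fin: "ennreal (measure lborel (B k)) = emeasure lborel (B k)" for k
    using emeasure_lborel_bounded[OF Bb, of k] by (intro emeasure_eq_ennreal_measure[symmetric]) auto
  have "(\<lambda>_::real^2. U) = (\<lambda>_ y. \<Sum>k\<in>I. ennreal (a k) * indicator (B k) y)" (is "_ = ?r")
  proof (intro ext)
    fix x y
    have "?r x y = (\<Sum>k\<in>I. fst k * indicator (B k) y)"
      using Ufin by (intro sum.cong) (auto simp: I_def a_def less_top)
    then show "U y = ?r x y" using cells[of "\<lambda>x. x" y] U0 by auto
  qed
  then have "mecke_sum M X A (\<lambda>_. U) = mecke_sum M X (\<Union>k\<in>K. B k) (\<lambda>_ y. \<Sum>k\<in>I. ennreal (a k) * indicator (B k) y)"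
    by (simp add: AU)
  also have "\<dots> = (\<Sum>k\<in>K. ennreal (l * measure lborel (B k))) *
      expm (\<Sum>k\<in>I. ennreal (l * measure lborel (B k) * (1 - exp (- a k))))"
    using Bm Bb by (intro mecke_sum_cells I KI disj) (auto simp: a_def)
  also have "(\<Sum>k\<in>K. ennreal (l * measure lborel (B k))) = ennreal l * (\<Sum>k\<in>K. emeasure lborel (B k))"
    using l_pos by (simp add: ennreal_mult' fin sum_distrib_left)
  also have "(\<Sum>k\<in>K. emeasure lborel (B k)) = emeasure lborel A"
    unfolding AU[symmetric] using finite_subset[OF KI I] disjoint_family_on_mono[OF KI disj]
    by (intro sum_emeasure) auto
  also have "(\<Sum>k\<in>I. ennreal (l * measure lborel (B k) * (1 - exp (- a k)))) =
    ennreal l * (\<Sum>k\<in>I. (1 - expm (fst k)) * emeasure lborel (B k))"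
    unfolding sum_distrib_left
  proof (intro sum.cong refl)
    fix k assume "k \<in> I"
    then have "1 - expm (fst k) = ennreal (1 - exp (- a k))"
      using Ufin by (auto simp: I_def a_def expm_def less_top ennreal_minus[symmetric])
    then show "ennreal (l * measure lborel (B k) * (1 - exp (- a k))) = ennreal l * ((1 - expm (fst k)) * emeasure lborel (B k))"
      using l_pos by (simp add: ennreal_mult' fin mult_ac a_def)
  qed
  also have "(\<Sum>k\<in>I. (1 - expm (fst k)) * emeasure lborel (B k)) = (\<integral>\<^sup>+y. (\<Sum>k\<in>I. (1 - expm (fst k)) * indicator (B k) y) \<partial>lborel)"
    by (subst nn_integral_sum) (auto simp: nn_integral_cmult_indicator)
  also have "\<dots> = (\<integral>\<^sup>+y. 1 - expm (U y) \<partial>lborel)"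
    using U0 by (intro nn_integral_cong) (simp add: cells[of "\<lambda>x. 1 - expm x"])
  finally show ?thesis by (simp add: mecke_value_def)
qed

text \<open>The case of zero weight. Finiteness of the mean number of points in \<open>A\<close> is
  the domination behind all further limits in the weight.\<close>

lemma mecke_sum_zero:
  assumes A: "A \<in> sets borel" "bounded A"
  shows "(\<integral>\<^sup>+\<omega>. \<integral>\<^sup>+i. indicator A (X i \<omega>) \<partial>count_space UNIV \<partial>M) = ennreal l * emeasure lborel A"
    and "(\<integral>\<^sup>+\<omega>. \<integral>\<^sup>+i. indicator A (X i \<omega>) \<partial>count_space UNIV \<partial>M) < \<infinity>"
proof -
  obtain r where "A \<subseteq> ball 0 r" using A(2) bounded_subset_ballD by blast
  from mecke_sum_simple[of "\<lambda>_. 0", OF _ _ _ A(1) this]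
  show "(\<integral>\<^sup>+\<omega>. \<integral>\<^sup>+i. indicator A (X i \<omega>) \<partial>count_space UNIV \<partial>M) = ennreal l * emeasure lborel A"
    by (simp add: mecke_sum_def mecke_value_def)
  then show "(\<integral>\<^sup>+\<omega>. \<integral>\<^sup>+i. indicator A (X i \<omega>) \<partial>count_space UNIV \<partial>M) < \<infinity>"
    using emeasure_lborel_bounded[OF A(2)] by (simp add: ennreal_mult_less_top)
qed

lemma mecke_sum_tendsto:
  assumes A[measurable]: "A \<in> sets borel" and bA: "bounded A"
    and m: "\<And>n. case_prod (W n) \<in> borel_measurable (borel \<Otimes>\<^sub>M borel)" "case_prod W' \<in> borel_measurable (borel \<Otimes>\<^sub>M borel)"
    and lim: "\<And>i. AE \<omega> in M. (\<lambda>n. \<integral>\<^sup>+j. indicator (- {i}) j * W n (X i \<omega>) (X j \<omega>) \<partial>count_space UNIV)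
      \<longlonglongrightarrow> (\<integral>\<^sup>+j. indicator (- {i}) j * W' (X i \<omega>) (X j \<omega>) \<partial>count_space UNIV)"
  shows "(\<lambda>n. mecke_sum M X A (W n)) \<longlonglongrightarrow> mecke_sum M X A W'"
  unfolding mecke_sum_def
proof (rule nn_integral_nested_dominated_convergence[where w="\<lambda>i \<omega>. indicator A (X i \<omega>)"])
  show "AE \<omega> in M. (\<lambda>n. indicator A (X i \<omega>) *
      expm (\<integral>\<^sup>+j. indicator (- {i}) j * W n (X i \<omega>) (X j \<omega>) \<partial>count_space UNIV))
      \<longlonglongrightarrow> indicator A (X i \<omega>) *
      expm (\<integral>\<^sup>+j. indicator (- {i}) j * W' (X i \<omega>) (X j \<omega>) \<partial>count_space UNIV)" for i
    using lim[of i] by eventually_elim (intro ennreal_tendsto_cmult tendsto_expm, auto split: split_indicator)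
  show "(\<lambda>\<omega>. indicator A (X i \<omega>) * expm (\<integral>\<^sup>+j. indicator (- {i}) j * W n (X i \<omega>) (X j \<omega>) \<partial>count_space UNIV)) \<in> borel_measurable M" for n i
    by (intro mecke_measurable A m)
  show "(\<lambda>\<omega>. indicator A (X i \<omega>) * expm (\<integral>\<^sup>+j. indicator (- {i}) j * W' (X i \<omega>) (X j \<omega>) \<partial>count_space UNIV)) \<in> borel_measurable M" for i
    by (intro mecke_measurable A m)
  show "indicator A (X i \<omega>) * expm (\<integral>\<^sup>+j. indicator (- {i}) j * W n (X i \<omega>) (X j \<omega>) \<partial>count_space UNIV) \<le> indicator A (X i \<omega>)" for n i \<omega>
    using mult_left_mono[OF expm_le_1, of "indicator A (X i \<omega>)"] by simp
qed (use mecke_sum_zero(2)[OF A bA] in auto)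

lemma mecke_value_tendsto:
  assumes bA: "bounded A"
    and lim: "(\<lambda>n. \<integral>\<^sup>+y. 1 - expm (U n y) \<partial>lborel) \<longlonglongrightarrow> (\<integral>\<^sup>+y. 1 - expm (U' y) \<partial>lborel)"
  shows "(\<lambda>n. mecke_value A (U n)) \<longlonglongrightarrow> mecke_value A U'"
  unfolding mecke_value_def using emeasure_lborel_bounded[OF bA]
  by (intro ennreal_tendsto_cmult tendsto_expm lim) (auto simp: ennreal_mult_less_top)

lemma mecke_value_tendsto_incseq:
  assumes bA: "bounded A" and "incseq U" and [measurable]: "\<And>n. U n \<in> borel_measurable borel"
    and "\<And>y. (\<lambda>n. U n y) \<longlonglongrightarrow> U' y"
  shows "(\<lambda>n. mecke_value A (U n)) \<longlonglongrightarrow> mecke_value A U'"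
proof (intro mecke_value_tendsto bA nn_integral_LIMSEQ tendsto_one_minus_expm assms)
  show "incseq (\<lambda>n y. 1 - expm (U n y))"
    using assms(2) by (auto simp: incseq_def le_fun_def intro!: ennreal_mono_minus expm_antimono)
qed measurable

lemma mecke_sum_tendsto_incseq:
  assumes A: "A \<in> sets borel" "bounded A" and inc: "incseq W"
    and m: "\<And>n. case_prod (W n) \<in> borel_measurable (borel \<Otimes>\<^sub>M borel)" "case_prod W' \<in> borel_measurable (borel \<Otimes>\<^sub>M borel)"
    and lim: "\<And>x y. (\<lambda>n. W n x y) \<longlonglongrightarrow> W' x y"
  shows "(\<lambda>n. mecke_sum M X A (W n)) \<longlonglongrightarrow> mecke_sum M X A W'"
proof (intro mecke_sum_tendsto A m AE_I2 nn_integral_LIMSEQ ennreal_tendsto_cmult lim)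
  show "incseq (\<lambda>n j. indicator (- {i}) j * W n (X i \<omega>) (X j \<omega>))" for i \<omega>
    using inc by (auto simp: incseq_def le_fun_def intro!: mult_left_mono)
qed (auto split: split_indicator)

lemma mecke_sum_fixed:
  assumes A: "A \<in> sets borel" "bounded A" and U[measurable]: "U \<in> borel_measurable borel"
  shows "mecke_sum M X A (\<lambda>_. U) = mecke_value A U"
proof -
  obtain r where r: "A \<subseteq> ball 0 r" using A(2) bounded_subset_ballD by blast
  obtain s where s: "\<And>n. simple_function borel (s n)" "incseq s" "\<And>n y. s n y < top" "\<And>y. (SUP n. s n y) = U y"
    using borel_measurable_implies_simple_function_sequence'[OF U] by metis
  \<comment> \<open>The radius starts at \<open>r\<close> so that each ball contains
    \<open>A\<close>, as \<open>mecke_sum_simple\<close> demands, and grows to exhaust the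
    plane.\<close>
  define V where "V n y = s n y * indicator (ball 0 (r + real n)) y" for n y
  have Vs: "simple_function borel (V n)" for n
    unfolding V_def by (intro simple_function_mult s simple_function_indicator) auto
  have [measurable]: "V n \<in> borel_measurable borel" for n
    using Vs by (rule borel_measurable_simple_function)
  have V_inc: "incseq V"
    using s(2) by (auto simp: incseq_def le_fun_def V_def split: split_indicator)
  have V_lim: "(\<lambda>n. V n y) \<longlonglongrightarrow> U y" for y
  proof -
    have "(\<lambda>n. s n y) \<longlonglongrightarrow> U y"
      using LIMSEQ_SUP[of "\<lambda>n. s n y"] s(2) by (simp add: s(4) incseq_def le_fun_def)
    moreover obtain N where "norm y - r < real N" using reals_Archimedean2 by blast
    then have "\<forall>\<^sub>F n in sequentially. s n y = V n y"
      by (intro eventually_sequentiallyI[of N]) (auto simp: V_def split: split_indicator)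
    ultimately show ?thesis by (rule Lim_transform_eventually)
  qed
  have eq: "mecke_sum M X A (\<lambda>_. V n) = mecke_value A (V n)" for n
  proof (rule mecke_sum_simple[where r="r + real n"])
    show "V n y < top" for y using s(3)[of n y] by (simp add: V_def split: split_indicator)
    show "A \<subseteq> ball 0 (r + real n)" by (rule order_trans[OF r subset_ball]) simp
  qed (use A Vs in \<open>auto simp: V_def\<close>)
  have "(\<lambda>n. mecke_sum M X A (\<lambda>_. V n)) \<longlonglongrightarrow> mecke_sum M X A (\<lambda>_. U)"
  proof (rule mecke_sum_tendsto_incseq)
    show "incseq (\<lambda>n (_::real^2). V n)" using V_inc by (auto simp: incseq_def le_fun_def)
  qed (use A V_lim in auto)
  moreover have "(\<lambda>n. mecke_value A (V n)) \<longlonglongrightarrow> mecke_value A U"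
    by (intro mecke_value_tendsto_incseq V_inc V_lim A) auto
  ultimately show ?thesis unfolding eq by (rule LIMSEQ_unique)
qed

lemma mecke_value_shift:
  assumes [measurable]: "U \<in> borel_measurable borel"
  shows "mecke_value A (\<lambda>y. U (y - x)) = mecke_value A U"
  using nn_integral_lborel_shift[of "\<lambda>y. 1 - expm (U y)" "- x"] by (simp add: mecke_value_def)

text \<open>Rounding the first argument of \<open>\<phi> (X j - X i)\<close> to finitely many values reduces the
  stationary formula to the one with a fixed weight.\<close>

lemma mecke_sum_continuous_compact:
  fixes \<phi> :: "real^2 \<Rightarrow> real"
  assumes A: "A \<in> sets borel" "bounded A" and \<phi>: "continuous_on UNIV \<phi>" "\<And>y. 0 \<le> \<phi> y" "\<And>y. \<rho> \<le> norm y \<Longrightarrow> \<phi> y = 0"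
  shows "mecke_sum M X A (\<lambda>x y. ennreal (\<phi> (y - x))) = mecke_value A (\<lambda>y. ennreal (\<phi> y))"
proof -
  note A(1)[measurable]
  have \<phi>m[measurable]: "\<phi> \<in> borel_measurable borel" using \<phi>(1) by (rule borel_measurable_continuous_onI)
  obtain s where s: "\<And>n. simple_function borel (s n)" "\<And>x::real^2. (\<lambda>n. s n x) \<longlonglongrightarrow> x"
      "\<And>n x. dist (s n x) 0 \<le> 2 * dist x 0"
    using borel_measurable_implies_sequence_metric[of "\<lambda>x::real^2. x" borel 0] by auto
  have [measurable]: "s n \<in> borel_measurable borel" for n
    using s(1) by (rule borel_measurable_simple_function)
  have "mecke_sum M X A (\<lambda>x y. ennreal (\<phi> (y - s n x))) = mecke_value A (\<lambda>y. ennreal (\<phi> y))" for n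
  proof -
    define R where "R = range (s n)"
    have R: "finite R" using s(1)[of n] by (simp add: R_def simple_function_def)
    \<comment> \<open>On \<open>C v\<close> the rounded point is the constant \<open>v\<close>,
      which leaves a fixed weight.\<close>
    define C where "C v = A \<inter> s n -` {v}" for v
    have Cm[measurable]: "C v \<in> sets borel" for v
      using measurable_sets[of "s n" borel borel "{v}"] by (auto simp: C_def)
    have Cb: "bounded (C v)" for v using A(2) by (rule bounded_subset) (auto simp: C_def)
    have "mecke_sum M X A (\<lambda>x y. ennreal (\<phi> (y - s n x))) =
      (\<integral>\<^sup>+\<omega>. \<integral>\<^sup>+i. (\<Sum>v\<in>R. indicator (C v) (X i \<omega>) * expm (\<integral>\<^sup>+j. indicator (- {i}) j * ennreal (\<phi> (X j \<omega> - v)) \<partial>count_space UNIV)) \<partial>count_space UNIV \<partial>M)"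
      unfolding mecke_sum_def
    proof (intro nn_integral_cong)
      fix i \<omega>
      have "(\<Sum>v\<in>R. indicator (C v) (X i \<omega>) * expm (\<integral>\<^sup>+j. indicator (- {i}) j * ennreal (\<phi> (X j \<omega> - v)) \<partial>count_space UNIV)) =
        (\<Sum>v\<in>R. if v = s n (X i \<omega>) then indicator A (X i \<omega>) * expm (\<integral>\<^sup>+j. indicator (- {i}) j * ennreal (\<phi> (X j \<omega> - s n (X i \<omega>))) \<partial>count_space UNIV) else 0)"
        by (intro sum.cong) (auto simp: C_def split: split_indicator)
      then show "indicator A (X i \<omega>) * expm (\<integral>\<^sup>+j. indicator (- {i}) j * ennreal (\<phi> (X j \<omega> - s n (X i \<omega>))) \<partial>count_space UNIV) =
        (\<Sum>v\<in>R. indicator (C v) (X i \<omega>) * expm (\<integral>\<^sup>+j. indicator (- {i}) j * ennreal (\<phi> (X j \<omega> - v)) \<partial>count_space UNIV))"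
        using R by (simp add: sum.delta R_def)
    qed
    also have "\<dots> = (\<Sum>v\<in>R. mecke_sum M X (C v) (\<lambda>_ y. ennreal (\<phi> (y - v))))"
    proof -
      have m: "(\<lambda>\<omega>. indicator (C v) (X i \<omega>) * expm (\<integral>\<^sup>+j. indicator (- {i}) j * ennreal (\<phi> (X j \<omega> - v)) \<partial>count_space UNIV)) \<in> borel_measurable M" for v i
        by (rule mecke_measurable[where W="\<lambda>_ y. ennreal (\<phi> (y - v))"]) auto
      then show ?thesis unfolding mecke_sum_def
        by (simp add: nn_integral_sum borel_measurable_nn_integral_count_space)
    qed
    \<comment> \<open>Translation invariance makes the exponential factor independent of
      \<open>v\<close>, so the pieces add up to the full window, with the same value for every
      \<open>n\<close>.\<close>
    also have "\<dots> = (\<Sum>v\<in>R. mecke_value (C v) (\<lambda>y. ennreal (\<phi> y)))"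
    proof (intro sum.cong refl)
      fix v
      show "mecke_sum M X (C v) (\<lambda>_ y. ennreal (\<phi> (y - v))) = mecke_value (C v) (\<lambda>y. ennreal (\<phi> y))"
        using mecke_sum_fixed[of "C v" "\<lambda>y. ennreal (\<phi> (y - v))"] Cb
          mecke_value_shift[of "\<lambda>y. ennreal (\<phi> y)" "C v" v] by simp
    qed
    also have "\<dots> = mecke_value A (\<lambda>y. ennreal (\<phi> y))"
    proof -
      have "(\<Sum>v\<in>R. emeasure lborel (C v)) = emeasure lborel (\<Union>v\<in>R. C v)"
        using R by (intro sum_emeasure) (auto simp: disjoint_family_on_def C_def)
      also have "(\<Union>v\<in>R. C v) = A" by (auto simp: C_def R_def)
      finally show ?thesis
        unfolding mecke_value_def sum_distrib_right[symmetric] sum_distrib_left[symmetric] by simp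
    qed
    finally show ?thesis .
  qed
  moreover have "(\<lambda>n. mecke_sum M X A (\<lambda>x y. ennreal (\<phi> (y - s n x)))) \<longlonglongrightarrow> mecke_sum M X A (\<lambda>x y. ennreal (\<phi> (y - x)))"
  proof (rule mecke_sum_tendsto[OF A])
    fix i
    show "AE \<omega> in M. (\<lambda>n. \<integral>\<^sup>+j. indicator (- {i}) j * ennreal (\<phi> (X j \<omega> - s n (X i \<omega>))) \<partial>count_space UNIV)
      \<longlonglongrightarrow> (\<integral>\<^sup>+j. indicator (- {i}) j * ennreal (\<phi> (X j \<omega> - X i \<omega>)) \<partial>count_space UNIV)"
      using AE_good
    proof eventually_elim
      case (elim \<omega>)
      define x where "x = X i \<omega>"
      \<comment> \<open>As \<open>s n x\<close> has norm at most \<open>2 * norm x\<close>, for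
        every \<open>n\<close> only points in this ball give a nonzero term; the limit is one of
        finite sums over a fixed index set.\<close>
      define J where "J = {j. X j \<omega> \<in> ball 0 (\<rho> + 2 * norm x)}"
      have J: "finite J" using elim bounded_ball unfolding J_def by blast
      have fin: "(\<integral>\<^sup>+j. indicator (- {i}) j * ennreal (\<phi> (X j \<omega> - v)) \<partial>count_space UNIV) =
         (\<Sum>j\<in>J. indicator (- {i}) j * ennreal (\<phi> (X j \<omega> - v)))" if v: "norm v \<le> 2 * norm x" for v
      proof (rule nn_integral_count_space'[OF J])
        fix j assume "j \<notin> J"
        then have "\<rho> + 2 * norm x \<le> norm (X j \<omega>)" by (simp add: J_def)
        also have "\<dots> \<le> norm (X j \<omega> - v) + norm v" by norm
        finally have "\<rho> \<le> norm (X j \<omega> - v)" using v by simp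
        then show "indicator (- {i}) j * ennreal (\<phi> (X j \<omega> - v)) = 0" by (simp add: \<phi>(3))
      qed auto
      have "isCont \<phi> y" for y using \<phi>(1) by (simp add: continuous_on_eq_continuous_at)
      then have "(\<lambda>n. \<Sum>j\<in>J. indicator (- {i}) j * ennreal (\<phi> (X j \<omega> - s n x))) \<longlonglongrightarrow> (\<Sum>j\<in>J. indicator (- {i}) j * ennreal (\<phi> (X j \<omega> - x)))"
        using s(2)
        by (intro tendsto_sum ennreal_tendsto_cmult tendsto_ennrealI isCont_tendsto_compose[where g=\<phi>] tendsto_intros)
           (auto split: split_indicator)
      then show ?case
        using s(3)[of _ x] by (simp add: fin flip: x_def)
    qed
  qed auto
  ultimately show ?thesis by (simp add: LIMSEQ_const_iff)
qed

text \<open>This covers lower semicontinuous weights, which are increasing limits of continuous ones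
  with bounded support; both sides of the formula follow such limits.\<close>

lemma mecke_sum_lsc:
  fixes \<phi> :: "nat \<Rightarrow> real^2 \<Rightarrow> real"
  assumes A: "A \<in> sets borel" "bounded A"
    and \<phi>: "\<And>n. continuous_on UNIV (\<phi> n)" "\<And>n y. 0 \<le> \<phi> n y" "\<And>n y. \<rho> n \<le> norm y \<Longrightarrow> \<phi> n y = 0"
    and inc: "\<And>n m y. n \<le> m \<Longrightarrow> \<phi> n y \<le> \<phi> m y"
    and lim: "\<And>y. (\<lambda>n. \<phi> n y) \<longlonglongrightarrow> U y"
  shows "mecke_sum M X A (\<lambda>x y. ennreal (U (y - x))) = mecke_value A (\<lambda>y. ennreal (U y))"
proof -
  have \<phi>m[measurable]: "\<phi> n \<in> borel_measurable borel" for n using \<phi>(1) by (rule borel_measurable_continuous_onI)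
  have [measurable]: "U \<in> borel_measurable borel"
    by (rule borel_measurable_LIMSEQ_real[OF lim]) auto
  have "(\<lambda>n. mecke_sum M X A (\<lambda>x y. ennreal (\<phi> n (y - x)))) \<longlonglongrightarrow> mecke_sum M X A (\<lambda>x y. ennreal (U (y - x)))"
  proof (rule mecke_sum_tendsto_incseq[OF A])
    show "incseq (\<lambda>n x y. ennreal (\<phi> n (y - x)))"
      by (auto simp: incseq_def le_fun_def intro!: ennreal_leI inc)
  qed (auto intro!: lim)
  moreover have "(\<lambda>n. mecke_value A (\<lambda>y. ennreal (\<phi> n y))) \<longlonglongrightarrow> mecke_value A (\<lambda>y. ennreal (U y))"
  proof (rule mecke_value_tendsto_incseq[OF A(2)])
    show "incseq (\<lambda>n y. ennreal (\<phi> n y))"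
      by (auto simp: incseq_def le_fun_def intro!: ennreal_leI inc)
  qed (auto intro!: lim)
  moreover have eq: "mecke_sum M X A (\<lambda>x y. ennreal (\<phi> n (y - x))) = mecke_value A (\<lambda>y. ennreal (\<phi> n y))" for n
    using \<phi> by (intro mecke_sum_continuous_compact[OF A]) auto
  ultimately show ?thesis unfolding eq by (intro LIMSEQ_unique)
qed

text \<open>A nonnegative function that is continuous off \<open>z\<close> becomes lower
  semicontinuous once its value at \<open>z\<close> is set to 0, however it behaves nearby. The
  continuous summand \<open>b\<close> allows a chosen value at \<open>z\<close> to be put
  back.\<close>

lemma mecke_sum_stationary_punctured:
  fixes \<phi> :: "real^2 \<Rightarrow> real"
  assumes A: "A \<in> sets borel" "bounded A"
    and \<phi>: "continuous_on (- {z}) \<phi>" "\<And>y. 0 \<le> \<phi> y" and b: "continuous_on UNIV b" "\<And>y. 0 \<le> b y"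
  shows "mecke_sum M X A (\<lambda>x y. ennreal (\<phi> (y - x) * indicator (- {z}) (y - x) + b (y - x))) =
    mecke_value A (\<lambda>y. ennreal (\<phi> y * indicator (- {z}) y + b y))"
proof (rule mecke_sum_lsc[OF A, where U="\<lambda>y. \<phi> y * indicator (- {z}) y + b y"])
  \<comment> \<open>Truncated at height \<open>n\<close>, since \<open>\<phi>\<close> may be
    unbounded near \<open>z\<close>, and faded out linearly within distance \<open>1 / n\<close> of
    \<open>z\<close>.\<close>
  define h where "h n y = min (\<phi> y) (real n) * min 1 (real n * norm (y - z))" for n y
  define cut where "cut n y = max 0 (min 1 (real n + 1 - norm y))" for n and y :: "real^2"
  let ?f = "\<lambda>n y. (h n y + b y) * cut n y"
  have h0: "0 \<le> h n y" for n y by (simp add: h_def \<phi>)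
  show "continuous_on UNIV (?f n)" for n
  proof -
    have "isCont (h n) y" for y
    proof (cases "y = z")
      case True
      have "(h n \<longlongrightarrow> 0) (at z)"
      proof (rule tendsto_sandwich)
        show "\<forall>\<^sub>F y in at z. 0 \<le> h n y" by (simp add: h0)
        show "\<forall>\<^sub>F y in at z. h n y \<le> real n * (real n * norm (y - z))"
          by (intro always_eventually allI) (auto simp: h_def \<phi> intro!: mult_mono)
        show "((\<lambda>y. real n * (real n * norm (y - z))) \<longlongrightarrow> 0) (at z)"
          by (auto intro!: tendsto_eq_intros)
      qed auto
      then show ?thesis using True by (simp add: isCont_def h_def)
    next
      case False
      then have "isCont \<phi> y" using \<phi>(1) continuous_on_eq_continuous_at[of "- {z}" \<phi>] by auto
      then show ?thesis unfolding h_def by (intro continuous_intros)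
    qed
    then have "continuous_on UNIV (h n)" by (simp add: continuous_at_imp_continuous_on)
    then show ?thesis unfolding cut_def by (intro continuous_intros b)
  qed
  show "0 \<le> ?f n y" for n y by (intro mult_nonneg_nonneg add_nonneg_nonneg h0 b) (simp add: cut_def)
  show "real n + 1 \<le> norm y \<Longrightarrow> ?f n y = 0" for n y by (simp add: cut_def)
  show "?f n y \<le> ?f m y" if "n \<le> m" for n m y
  proof (intro mult_mono add_mono)
    show "h n y \<le> h m y" using that \<phi>(2)[of y] unfolding h_def
      by (intro mult_mono min.mono mult_right_mono) auto
    show "cut n y \<le> cut m y" using that by (auto simp: cut_def)
    show "0 \<le> h m y + b y" using h0 b by simp
  qed (auto simp: cut_def)
  show "(\<lambda>n. ?f n y) \<longlonglongrightarrow> \<phi> y * indicator (- {z}) y + b y" for y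
  proof (rule tendsto_eventually)
    obtain N where N: "max (norm y) (max (\<phi> y) (1 / norm (y - z))) < real N"
      using reals_Archimedean2 by blast
    have "?f n y = \<phi> y * indicator (- {z}) y + b y" if "N \<le> n" for n
    proof (cases "y = z")
      case True
      then show ?thesis using N that by (simp add: h_def cut_def)
    next
      case False
      have "1 / norm (y - z) \<le> real n" "\<phi> y \<le> real n" using N that by auto
      then have "1 \<le> real n * norm (y - z)" using False by (simp add: field_simps)
      then show ?thesis using False N that \<open>\<phi> y \<le> real n\<close> by (simp add: h_def cut_def)
    qed
    then show "\<forall>\<^sub>F n in sequentially. ?f n y = \<phi> y * indicator (- {z}) y + b y"
      unfolding eventually_sequentially by blast
  qed
qed

text \<open>The value \<open>\<phi> z\<close> is arbitrary, so \<open>\<phi>\<close> need not be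
  semicontinuous. It is squeezed: erasing the value at \<open>z\<close> lowers the weight and bounds
  the sum from above, while replacing it by a cone of height \<open>\<phi> z\<close> shrinking onto
  \<open>z\<close> raises the weight and bounds the sum from below. In the limit both bounds have
  the same Lebesgue integral. Coincidences of a difference of points with \<open>z\<close> thus
  never have to be discussed.\<close>

lemma mecke_sum_stationary:
  fixes \<phi> :: "real^2 \<Rightarrow> real"
  assumes A: "A \<in> sets borel" "bounded A"
    and \<phi>: "continuous_on (- {z}) \<phi>" "\<And>y. 0 \<le> \<phi> y" and [measurable]: "\<phi> \<in> borel_measurable borel"
    and fin: "(\<integral>\<^sup>+y. 1 - expm (ennreal (\<phi> y)) \<partial>lborel) < \<infinity>"
  shows "mecke_sum M X A (\<lambda>x y. ennreal (\<phi> (y - x))) = mecke_value A (\<lambda>y. ennreal (\<phi> y))"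
proof (rule antisym)
  have "mecke_sum M X A (\<lambda>x y. ennreal (\<phi> (y - x))) \<le> mecke_sum M X A (\<lambda>x y. ennreal (\<phi> (y - x) * indicator (- {z}) (y - x) + 0))"
    by (intro mecke_sum_antimono ennreal_leI) (auto simp: \<phi> split: split_indicator)
  also have "\<dots> = mecke_value A (\<lambda>y. ennreal (\<phi> y * indicator (- {z}) y + 0))"
    by (intro mecke_sum_stationary_punctured A \<phi>) auto
  also have "\<dots> = mecke_value A (\<lambda>y. ennreal (\<phi> y))"
    unfolding mecke_value_def using AE_lborel_singleton[of z]
    by (intro arg_cong2[where f="(*)"] arg_cong[where f=expm] refl nn_integral_cong_AE)
       (auto elim!: eventually_mono)
  finally show "mecke_sum M X A (\<lambda>x y. ennreal (\<phi> (y - x))) \<le> mecke_value A (\<lambda>y. ennreal (\<phi> y))" .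
next
  define b where "b n y = \<phi> z * max 0 (1 - real n * norm (y - z))" for n :: nat and y
  have b0: "0 \<le> b n y" for n y by (simp add: b_def \<phi>)
  have bm[measurable]: "b n \<in> borel_measurable borel" for n unfolding b_def by measurable
  define V where "V n y = ennreal (\<phi> y * indicator (- {z}) y + b n y)" for n y
  have [measurable]: "V n \<in> borel_measurable borel" for n unfolding V_def by measurable
  have le: "mecke_value A (V n) \<le> mecke_sum M X A (\<lambda>x y. ennreal (\<phi> (y - x)))" for n
  proof -
    have "mecke_value A (V n) = mecke_sum M X A (\<lambda>x y. ennreal (\<phi> (y - x) * indicator (- {z}) (y - x) + b n (y - x)))"
      unfolding V_def b_def
      by (intro mecke_sum_stationary_punctured[symmetric] A \<phi> continuous_intros mult_nonneg_nonneg) auto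
    also have "\<dots> \<le> mecke_sum M X A (\<lambda>x y. ennreal (\<phi> (y - x)))"
      using b0 by (intro mecke_sum_antimono ennreal_leI) (auto simp: b_def split: split_indicator)
    finally show ?thesis .
  qed
  \<comment> \<open>The index is \<open>Suc n\<close> because for \<open>n = 0\<close> the cone is
    the constant \<open>\<phi> z\<close> on the whole plane; from 1 on it lives in
    \<open>ball z 1\<close>, which supplies an integrable bound.\<close>
  have "(\<lambda>n. \<integral>\<^sup>+y. 1 - expm (V (Suc n) y) \<partial>lborel) \<longlonglongrightarrow> (\<integral>\<^sup>+y. 1 - expm (ennreal (\<phi> y)) \<partial>lborel)"
  proof (rule nn_integral_dominated_convergence[where w="\<lambda>y. (1 - expm (ennreal (\<phi> y))) + indicator (ball z 1) y"])
    show "AE y in lborel. 1 - expm (V (Suc n) y) \<le> (1 - expm (ennreal (\<phi> y))) + indicator (ball z 1) y" for n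
    proof (rule AE_I2)
      fix y
      show "1 - expm (V (Suc n) y) \<le> (1 - expm (ennreal (\<phi> y))) + indicator (ball z 1) y"
      proof (cases "dist z y < 1")
        case True
        have "1 - expm (V (Suc n) y) \<le> 1" by simp
        also have "\<dots> \<le> (1 - expm (ennreal (\<phi> y))) + 1" by simp
        finally show ?thesis using True by simp
      next
        case False
        then have "1 \<le> norm (y - z)" by (simp add: dist_norm norm_minus_commute)
        also have "\<dots> \<le> real (Suc n) * norm (y - z)" by (simp add: algebra_simps)
        finally have "b (Suc n) y = 0" by (simp add: b_def del: of_nat_Suc)
        moreover have "y \<noteq> z" using False by auto
        ultimately show ?thesis using False by (auto simp: V_def)
      qed
    qed
    have "emeasure lborel (ball z 1) < \<infinity>" by (intro emeasure_lborel_bounded) auto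
    then show "(\<integral>\<^sup>+y. (1 - expm (ennreal (\<phi> y))) + indicator (ball z 1) y \<partial>lborel) < \<infinity>"
      using fin by (subst nn_integral_add) (auto intro!: borel_measurable_indicator)
    show "AE y in lborel. (\<lambda>n. 1 - expm (V (Suc n) y)) \<longlonglongrightarrow> 1 - expm (ennreal (\<phi> y))"
      using AE_lborel_singleton[of z]
    proof eventually_elim
      case (elim y)
      obtain N where "1 / norm (y - z) < real N" using reals_Archimedean2 by blast
      then have N: "1 \<le> real N * norm (y - z)" using elim by (simp add: field_simps)
      have "b (Suc n) y = 0" if "N \<le> n" for n
      proof -
        have "real N * norm (y - z) \<le> real (Suc n) * norm (y - z)" using that by (intro mult_right_mono) auto
        with N show ?thesis by (simp add: b_def del: of_nat_Suc)
      qed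
      then have "V (Suc n) y = ennreal (\<phi> y)" if "N \<le> n" for n
        using that elim by (simp add: V_def)
      then have "\<forall>\<^sub>F n in sequentially. V (Suc n) y = ennreal (\<phi> y)"
        unfolding eventually_sequentially by blast
      then show ?case by (intro tendsto_one_minus_expm tendsto_eventually)
    qed
    show "(\<lambda>y. 1 - expm (ennreal (\<phi> y)) + indicator (ball z 1) y) \<in> borel_measurable lborel"
      by (intro borel_measurable_add borel_measurable_indicator) auto
    show "(\<lambda>y. 1 - expm (V (Suc n) y)) \<in> borel_measurable lborel" for n by measurable
    show "(\<lambda>y. 1 - expm (ennreal (\<phi> y))) \<in> borel_measurable lborel" by measurable
  qed
  then have lim: "(\<lambda>n. mecke_value A (V (Suc n))) \<longlonglongrightarrow> mecke_value A (\<lambda>y. ennreal (\<phi> y))"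
    by (rule mecke_value_tendsto[OF A(2), where U="\<lambda>n. V (Suc n)" and U'="\<lambda>y. ennreal (\<phi> y)"])
  show "mecke_value A (\<lambda>y. ennreal (\<phi> y)) \<le> mecke_sum M X A (\<lambda>x y. ennreal (\<phi> (y - x)))"
    by (rule LIMSEQ_le_const2[OF lim]) (use le in blast)
qed

end

section \<open>Poisson clusters\<close>

lemma neglog_expm: "neglog (expm a) = a"
proof (cases "a = \<infinity>")
  case False
  then obtain x where "0 \<le> x" "a = ennreal x" by (cases a) auto
  then show ?thesis by (simp add: neglog_def)
qed (simp add: neglog_def)

lemma measurable_neglog [measurable]: "neglog \<in> borel_measurable borel"
  unfolding neglog_def[abs_def] by measurable

lemma expm_of_nat_mult: "expm (of_nat m * b) = expm b ^ m"
  by (induction m) (auto simp: expm_add distrib_right)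

section \<open>Integrating out displacements and cluster sizes\<close>

lemma nn_integral_PiM_split:
  assumes E: "prob_space E" and H: "H \<in> borel_measurable (PiM UNIV (\<lambda>_. E))"
  shows "(\<integral>\<^sup>+d. H d \<partial>PiM UNIV (\<lambda>_. E)) = (\<integral>\<^sup>+e. \<integral>\<^sup>+d. H (d(p := e)) \<partial>PiM (UNIV - {p}) (\<lambda>_. E) \<partial>E)"
proof -
  let ?P = "PiM (UNIV - {p}) (\<lambda>_. E)"
  interpret E: prob_space E by fact
  interpret P: prob_space "?P" by (intro prob_space_PiM E)
  have ins: "insert p (UNIV - {p}) = UNIV" by auto
  have m: "(\<lambda>(e, d). d(p := e)) \<in> measurable (E \<Otimes>\<^sub>M ?P) (PiM UNIV (\<lambda>_. E))"
    using measurable_fun_upd[of UNIV "UNIV - {p}" p snd "E \<Otimes>\<^sub>M ?P" "\<lambda>_. E" fst] ins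
    by (simp add: split_beta')
  have "(\<integral>\<^sup>+d. H d \<partial>PiM UNIV (\<lambda>_. E)) = (\<integral>\<^sup>+d. H d \<partial>distr (E \<Otimes>\<^sub>M ?P) (PiM UNIV (\<lambda>_. E)) (\<lambda>(e, d). d(p := e)))"
    using distr_pair_PiM_eq_PiM[of "UNIV - {p}" "\<lambda>_. E" p] E by (simp add: ins)
  also have "\<dots> = (\<integral>\<^sup>+x. H (case x of (e, d) \<Rightarrow> d(p := e)) \<partial>(E \<Otimes>\<^sub>M ?P))"
    using H by (intro nn_integral_distr m) simp
  also have "\<dots> = (\<integral>\<^sup>+e. \<integral>\<^sup>+d. H (d(p := e)) \<partial>?P \<partial>E)"
    using measurable_compose[OF m H] by (subst P.nn_integral_fst[symmetric]) auto
  finally show ?thesis .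
qed

text \<open>The displacement of the marked point \<open>p\<close> enters the term of every other
  point. Once it is frozen at \<open>e\<close>, the remaining displacements are independent and the
  functional splits.\<close>

lemma nn_integral_displacements:
  fixes p :: "'i :: countable" and E :: "'a::{real_normed_vector, second_countable_topology} measure"
  assumes E: "prob_space E" "sets E = sets borel" and p: "p \<notin> W"
    and [measurable]: "h \<in> borel_measurable borel" "V \<in> borel_measurable borel"
  shows "(\<integral>\<^sup>+d. h (d p) * expm (\<integral>\<^sup>+q. indicator W q * V (y q + d q - d p) \<partial>count_space UNIV) \<partial>PiM UNIV (\<lambda>_. E)) =
    (\<integral>\<^sup>+e. h e * expm (\<integral>\<^sup>+q. indicator W q * neglog (\<integral>\<^sup>+e'. expm (V (y q - e + e')) \<partial>E) \<partial>count_space UNIV) \<partial>E)"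
proof -
  let ?P = "PiM (UNIV - {p}) (\<lambda>_. E)"
  note E(2)[measurable_cong]
  interpret E: prob_space E by fact
  have [measurable]: "(\<lambda>d. \<integral>\<^sup>+q. indicator W q * V (y q + d q - d p) \<partial>count_space UNIV) \<in> borel_measurable (PiM UNIV (\<lambda>_. E))"
    by (intro borel_measurable_nn_integral_count_space) auto
  have "(\<integral>\<^sup>+d. h (d p) * expm (\<integral>\<^sup>+q. indicator W q * V (y q + d q - d p) \<partial>count_space UNIV) \<partial>PiM UNIV (\<lambda>_. E)) =
    (\<integral>\<^sup>+e. \<integral>\<^sup>+d. h e * expm (\<integral>\<^sup>+q. indicator W q * V (y q + (d(p := e)) q - e) \<partial>count_space UNIV) \<partial>?P \<partial>E)"
    by (subst nn_integral_PiM_split[OF E(1), where p=p]) auto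
  also have "\<dots> = (\<integral>\<^sup>+e. h e * expm (\<integral>\<^sup>+q. indicator W q * neglog (\<integral>\<^sup>+e'. expm (V (y q - e + e')) \<partial>E) \<partial>count_space UNIV) \<partial>E)"
  proof (intro nn_integral_cong)
    fix e
    have [measurable]: "(\<lambda>d. \<integral>\<^sup>+q. indicator W q * V (y q + d q - e) \<partial>count_space (UNIV - {p})) \<in> borel_measurable (?P)"
      by (intro borel_measurable_nn_integral_count_space) auto
    have "(\<integral>\<^sup>+q. indicator W q * V (y q + (d(p := e)) q - e) \<partial>count_space UNIV) =
        (\<integral>\<^sup>+q. indicator W q * V (y q + d q - e) \<partial>count_space (UNIV - {p}))" for d
    proof -
      have "(\<integral>\<^sup>+q. indicator W q * V (y q + (d(p := e)) q - e) \<partial>count_space UNIV) =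
        (\<integral>\<^sup>+q. indicator W q * V (y q + (d(p := e)) q - e) \<partial>count_space (UNIV - {p}))"
        using p by (intro nn_integral_count_space_eq) auto
      also have "\<dots> = (\<integral>\<^sup>+q. indicator W q * V (y q + d q - e) \<partial>count_space (UNIV - {p}))"
        by (intro nn_integral_cong) auto
      finally show ?thesis .
    qed
    then have "(\<integral>\<^sup>+d. h e * expm (\<integral>\<^sup>+q. indicator W q * V (y q + (d(p := e)) q - e) \<partial>count_space UNIV) \<partial>?P) =
      h e * (\<integral>\<^sup>+d. expm (\<integral>\<^sup>+q. indicator W q * V (y q + d q - e) \<partial>count_space (UNIV - {p})) \<partial>?P)"
      by (simp add: nn_integral_cmult)
    also have "(\<integral>\<^sup>+d. expm (\<integral>\<^sup>+q. indicator W q * V (y q + d q - e) \<partial>count_space (UNIV - {p})) \<partial>?P) =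
      expm (\<integral>\<^sup>+q. neglog (\<integral>\<^sup>+e'. expm (indicator W q * V (y q + e' - e)) \<partial>E) \<partial>count_space (UNIV - {p}))"
      by (intro nn_integral_PiM_expm[where U="\<lambda>q e'. indicator W q * V (y q + e' - e)"] E) auto
    also have "(\<integral>\<^sup>+q. neglog (\<integral>\<^sup>+e'. expm (indicator W q * V (y q + e' - e)) \<partial>E) \<partial>count_space (UNIV - {p})) =
      (\<integral>\<^sup>+q. indicator W q * neglog (\<integral>\<^sup>+e'. expm (V (y q - e + e')) \<partial>E) \<partial>count_space (UNIV - {p}))"
      using neglog_expm[of 0]
      by (intro nn_integral_cong) (auto split: split_indicator simp: E.emeasure_space_1 algebra_simps)
    also have "\<dots> = (\<integral>\<^sup>+q. indicator W q * neglog (\<integral>\<^sup>+e'. expm (V (y q - e + e')) \<partial>E) \<partial>count_space UNIV)"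
      using p by (intro nn_integral_count_space_eq) auto
    finally show "(\<integral>\<^sup>+d. h e * expm (\<integral>\<^sup>+q. indicator W q * V (y q + (d(p := e)) q - e) \<partial>count_space UNIV) \<partial>?P) =
      h e * expm (\<integral>\<^sup>+q. indicator W q * neglog (\<integral>\<^sup>+e'. expm (V (y q - e + e')) \<partial>E) \<partial>count_space UNIV)" .
  qed
  finally show ?thesis .
qed

text \<open>The part of the marked point's own cluster when the point has index \<open>j\<close> in
  it: the size must exceed \<open>j\<close>, and each of the \<open>k - 1\<close> siblings
  contributes the exponent \<open>b\<close>.\<close>

definition cluster_weight :: "real \<Rightarrow> ennreal \<Rightarrow> nat \<Rightarrow> ennreal" where
  "cluster_weight c b j = (\<integral>\<^sup>+k. indicator {..<k} j * expm (of_nat (k - 1) * b) \<partial>measure_pmf (poisson_pmf c))"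

text \<open>Summing over \<open>j\<close> turns the indicator into the cluster size: a daughter is
  met in a size-biased cluster, where the number of siblings is again Poisson with mean
  \<open>c\<close>.\<close>

lemma nn_integral_cluster_weight:
  assumes c: "0 < c"
  shows "(\<integral>\<^sup>+j. cluster_weight c b j \<partial>count_space UNIV) = ennreal c * expm (ennreal c * (1 - expm b))"
proof -
  obtain u where u: "0 \<le> u" "u \<le> 1" "expm b = ennreal u"
    using expm_le_1[of b] by (cases "expm b") (auto simp: ennreal_le_1 top_unique)
  have "(\<integral>\<^sup>+j. cluster_weight c b j \<partial>count_space UNIV) =
    (\<integral>\<^sup>+k. \<integral>\<^sup>+j. indicator {..<k} j * expm (of_nat (k - 1) * b) \<partial>count_space UNIV \<partial>measure_pmf (poisson_pmf c))"
    unfolding cluster_weight_def by (subst nn_integral_count_space_nn_integral) auto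
  also have "\<dots> = (\<integral>\<^sup>+k. of_nat k * expm (of_nat (k - 1) * b) \<partial>measure_pmf (poisson_pmf c))"
    by (intro nn_integral_cong) (simp add: nn_integral_multc)
  also have "\<dots> = (\<integral>\<^sup>+k. of_nat k * ennreal (u ^ (k - 1)) * ennreal (c ^ k / fact k * exp (- c)) \<partial>count_space UNIV)"
    unfolding nn_integral_measure_pmf expm_of_nat_mult u(3) pmf_poisson[OF c]
    by (intro nn_integral_cong) (simp only: ennreal_power[OF u(1)] mult_ac)
  also have "\<dots> = ennreal (c * exp (- (c * (1 - u))))"
    using c u by (intro nn_integral_poisson_size_biased) auto
  also have "\<dots> = ennreal c * expm (ennreal (c * (1 - u)))"
    using u c by (subst expm_ennreal) (auto simp: ennreal_mult')
  also have "ennreal (c * (1 - u)) = ennreal c * (1 - expm b)"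
    using u c by (simp add: ennreal_mult' ennreal_1[symmetric] ennreal_minus del: ennreal_1)
  finally show ?thesis .
qed

text \<open>Sizes of different clusters are independent. Every cluster but the \<open>i\<close>-th
  contributes the Poisson generating function at \<open>expm (b i')\<close>; the \<open>i\<close>-th
  must contain index \<open>j\<close> and loses that member.\<close>

lemma nn_integral_cluster_sizes:
  assumes c: "0 < c"
  shows "(\<integral>\<^sup>+n. indicator {..<n i} j * expm (\<integral>\<^sup>+q. indicator {q. snd q < n (fst q) \<and> q \<noteq> (i, j)} q * b (fst q) \<partial>count_space UNIV)
      \<partial>PiM UNIV (\<lambda>_. measure_pmf (poisson_pmf c))) =
    cluster_weight c (b i) j * expm (\<integral>\<^sup>+i'. indicator (- {i}) i' * (ennreal c * (1 - expm (b i'))) \<partial>count_space (UNIV :: nat set))"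
proof -
  \<comment> \<open>The value \<open>\<infinity>\<close> absorbs the indicator of \<open>j < n i\<close> into the exponential.\<close>
  define U where "U i' k = (if i' = i then if j < k then of_nat (k - 1) * b i else \<infinity> else of_nat k * b i')" for i' k
  have path: "indicator {..<n i} j * expm (\<integral>\<^sup>+q. indicator {q. snd q < n (fst q) \<and> q \<noteq> (i, j)} q * b (fst q) \<partial>count_space UNIV) =
    expm (\<integral>\<^sup>+i'. U i' (n i') \<partial>count_space UNIV)" for n :: "nat \<Rightarrow> nat"
  proof (cases "j < n i")
    case True
    have "(\<integral>\<^sup>+q. indicator {q. snd q < n (fst q) \<and> q \<noteq> (i, j)} q * b (fst q) \<partial>count_space UNIV) =
      (\<integral>\<^sup>+i'. \<integral>\<^sup>+j'. indicator {q. snd q < n (fst q) \<and> q \<noteq> (i, j)} (i', j') * b i' \<partial>count_space UNIV \<partial>count_space UNIV)"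
      by (subst nn_integral_fst_count_space[symmetric]) simp
    also have "\<dots> = (\<integral>\<^sup>+i'. U i' (n i') \<partial>count_space UNIV)"
    proof (intro nn_integral_cong)
      fix i'
      have "(\<integral>\<^sup>+j'. indicator {q. snd q < n (fst q) \<and> q \<noteq> (i, j)} (i', j') * b i' \<partial>count_space UNIV) =
        (\<Sum>j'\<in>{..<n i'} - (if i' = i then {j} else {}). indicator {q. snd q < n (fst q) \<and> q \<noteq> (i, j)} (i', j') * b i')"
        by (intro nn_integral_count_space') (auto split: split_indicator if_splits)
      also have "\<dots> = (\<Sum>j'\<in>{..<n i'} - (if i' = i then {j} else {}). b i')"
        by (intro sum.cong) (auto split: if_splits)
      also have "\<dots> = U i' (n i')"
        using True by (auto simp: U_def)
      finally show "(\<integral>\<^sup>+j'. indicator {q. snd q < n (fst q) \<and> q \<noteq> (i, j)} (i', j') * b i' \<partial>count_space UNIV) = U i' (n i')" .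
    qed
    finally show ?thesis using True by simp
  next
    case False
    then have "(\<integral>\<^sup>+i'. U i' (n i') \<partial>count_space UNIV) = \<infinity>"
      using nn_integral_ge_point[of i UNIV "\<lambda>i'. U i' (n i')"] by (auto simp: U_def top_unique)
    then show ?thesis using False by simp
  qed
  have other: "neglog (\<integral>\<^sup>+k. expm (U i' k) \<partial>measure_pmf (poisson_pmf c)) = ennreal c * (1 - expm (b i'))" if "i' \<noteq> i" for i'
  proof -
    obtain u where u: "0 \<le> u" "u \<le> 1" "expm (b i') = ennreal u"
      using expm_le_1[of "b i'"] by (cases "expm (b i')") (auto simp: ennreal_le_1 top_unique)
    have "(\<integral>\<^sup>+k. expm (U i' k) \<partial>measure_pmf (poisson_pmf c)) = (\<integral>\<^sup>+k. ennreal (u ^ k) * ennreal (c ^ k / fact k * exp (- c)) \<partial>count_space UNIV)"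
      using u c that by (simp add: U_def nn_integral_measure_pmf expm_of_nat_mult ennreal_power mult_ac)
    also have "\<dots> = ennreal (exp (- (c * (1 - u))))"
      using c u by (intro nn_integral_poisson_power) auto
    also have "\<dots> = expm (ennreal (c * (1 - u)))" using u c by simp
    also have "ennreal (c * (1 - u)) = ennreal c * (1 - expm (b i'))"
      using u c by (simp add: ennreal_mult' ennreal_1[symmetric] ennreal_minus del: ennreal_1)
    finally show ?thesis by (simp add: neglog_expm)
  qed
  have same: "(\<integral>\<^sup>+k. expm (U i k) \<partial>measure_pmf (poisson_pmf c)) = cluster_weight c (b i) j"
    unfolding cluster_weight_def by (intro nn_integral_cong) (auto simp: U_def)
  have cw1: "cluster_weight c (b i) j \<le> 1"
    unfolding same[symmetric] by (rule measure_pmf.nn_integral_expm_le_1)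
  have "(\<integral>\<^sup>+n. expm (\<integral>\<^sup>+i'. U i' (n i') \<partial>count_space UNIV) \<partial>PiM UNIV (\<lambda>_. measure_pmf (poisson_pmf c))) =
    expm (\<integral>\<^sup>+i'. neglog (\<integral>\<^sup>+k. expm (U i' k) \<partial>measure_pmf (poisson_pmf c)) \<partial>count_space UNIV)"
    by (intro nn_integral_PiM_expm measure_pmf.prob_space_axioms) auto
  also have "(\<integral>\<^sup>+i'. neglog (\<integral>\<^sup>+k. expm (U i' k) \<partial>measure_pmf (poisson_pmf c)) \<partial>count_space UNIV) =
    (\<integral>\<^sup>+i'. neglog (cluster_weight c (b i) j) * indicator {i} i' + indicator (- {i}) i' * (ennreal c * (1 - expm (b i'))) \<partial>count_space UNIV)"
    by (intro nn_integral_cong) (auto simp: other same split: split_indicator)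
  also have "\<dots> = neglog (cluster_weight c (b i) j) + (\<integral>\<^sup>+i'. indicator (- {i}) i' * (ennreal c * (1 - expm (b i'))) \<partial>count_space UNIV)"
    by (subst nn_integral_add) (auto simp: nn_integral_cmult_indicator)
  finally show ?thesis
    by (simp add: path expm_add expm_neglog[OF cw1])
qed

section \<open>Campbell sums over the points of a Neyman-Scott process\<close>

locale cluster_sequence = poisson_sequence M l X for M :: "'w measure" and l X +
  fixes c :: real and f :: "real^2 \<Rightarrow> real" and N :: "nat \<Rightarrow> 'w \<Rightarrow> nat" and D :: "nat \<times> nat \<Rightarrow> 'w \<Rightarrow> real^2"
  assumes c_pos: "0 < c"
    and N_measurable [measurable]: "N i \<in> measurable M (count_space UNIV)"
    and D_measurable [measurable]: "D p \<in> borel_measurable M"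
    and f_measurable [measurable]: "f \<in> borel_measurable borel"
    and f_density: "(\<integral>\<^sup>+x. ennreal (f x) \<partial>lborel) = 1"
    and joint_law: "distr M
          (PiM UNIV (\<lambda>_. borel) \<Otimes>\<^sub>M PiM UNIV (\<lambda>_. count_space UNIV) \<Otimes>\<^sub>M PiM UNIV (\<lambda>_. borel))
          (\<lambda>\<omega>. (\<lambda>i. X i \<omega>, \<lambda>i. N i \<omega>, \<lambda>p. D p \<omega>))
        = distr M (PiM UNIV (\<lambda>_. borel)) (\<lambda>\<omega> i. X i \<omega>)
          \<Otimes>\<^sub>M PiM UNIV (\<lambda>_. measure_pmf (poisson_pmf c))
          \<Otimes>\<^sub>M PiM UNIV (\<lambda>_. density lborel (\<lambda>x. ennreal (f x)))"
begin

abbreviation "E \<equiv> density lborel (\<lambda>x. ennreal (f x))"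
abbreviation "LX \<equiv> distr M (PiM UNIV (\<lambda>_. borel)) (\<lambda>\<omega> i. X i \<omega>)"
abbreviation "PN \<equiv> PiM UNIV (\<lambda>_::nat. measure_pmf (poisson_pmf c))"
abbreviation "PD \<equiv> PiM UNIV (\<lambda>_::nat \<times> nat. E)"
abbreviation "T \<equiv> PiM UNIV (\<lambda>_::nat. borel :: (real^2) measure) \<Otimes>\<^sub>M PiM UNIV (\<lambda>_::nat. count_space (UNIV :: nat set))
    \<Otimes>\<^sub>M PiM UNIV (\<lambda>_::nat \<times> nat. borel :: (real^2) measure)"

lemma prob_space_E: "prob_space E"
  using f_density by (intro prob_spaceI) (simp add: emeasure_density)

lemma X_seq_measurable [measurable]: "(\<lambda>\<omega> i. X i \<omega>) \<in> measurable M (PiM UNIV (\<lambda>_. borel))"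
  by (intro measurable_PiM_single') auto

text \<open>Sizes and displacements are independent of the parents and of each other; this order of
  integration peels off the displacements, then the sizes, and leaves the parents for Mecke's
  formula.\<close>

lemma nn_integral_joint_law:
  assumes \<Psi>: "\<Psi> \<in> borel_measurable T"
  shows "(\<integral>\<^sup>+\<omega>. \<Psi> (\<lambda>i. X i \<omega>, \<lambda>i. N i \<omega>, \<lambda>p. D p \<omega>) \<partial>M) =
    (\<integral>\<^sup>+xs. \<integral>\<^sup>+ns. \<integral>\<^sup>+ds. \<Psi> (xs, ns, ds) \<partial>PD \<partial>PN \<partial>LX)"
proof -
  interpret PD: prob_space PD by (intro prob_space_PiM prob_space_E)
  interpret PN: prob_space PN by (intro prob_space_PiM measure_pmf.prob_space_axioms)
  interpret ND: pair_sigma_finite PN PD ..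
  have sN: "sets PN = sets (PiM UNIV (\<lambda>_::nat. count_space (UNIV :: nat set)))"
    and sD: "sets PD = sets (PiM UNIV (\<lambda>_::nat \<times> nat. borel :: (real^2) measure))"
    by (intro sets_PiM_cong refl; simp)+
  have "sets (LX \<Otimes>\<^sub>M PN \<Otimes>\<^sub>M PD) = sets T"
    by (intro sets_pair_measure_cong sN sD) simp
  then have \<Psi>': "\<Psi> \<in> borel_measurable (LX \<Otimes>\<^sub>M PN \<Otimes>\<^sub>M PD)"
    using \<Psi> by (simp cong: measurable_cong_sets)
  have m: "(\<lambda>\<omega>. (\<lambda>i. X i \<omega>, \<lambda>i. N i \<omega>, \<lambda>p. D p \<omega>)) \<in> measurable M T"
    by (intro measurable_Pair measurable_PiM_single') auto
  have "(\<integral>\<^sup>+\<omega>. \<Psi> (\<lambda>i. X i \<omega>, \<lambda>i. N i \<omega>, \<lambda>p. D p \<omega>) \<partial>M) = integral\<^sup>N (LX \<Otimes>\<^sub>M PN \<Otimes>\<^sub>M PD) \<Psi>"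
    unfolding joint_law[symmetric] using m \<Psi> by (subst nn_integral_distr) auto
  also have "\<dots> = (\<integral>\<^sup>+xs. \<integral>\<^sup>+y. \<Psi> (xs, y) \<partial>(PN \<Otimes>\<^sub>M PD) \<partial>LX)"
    by (intro ND.nn_integral_fst[symmetric] \<Psi>')
  also have "\<dots> = (\<integral>\<^sup>+xs. \<integral>\<^sup>+ns. \<integral>\<^sup>+ds. \<Psi> (xs, ns, ds) \<partial>PD \<partial>PN \<partial>LX)"
  proof (intro nn_integral_cong)
    fix xs assume "xs \<in> space LX"
    then have "(\<lambda>y. \<Psi> (xs, y)) \<in> borel_measurable (PN \<Otimes>\<^sub>M PD)"
      using measurable_Pair2[OF \<Psi>'] by simp
    then show "(\<integral>\<^sup>+y. \<Psi> (xs, y) \<partial>(PN \<Otimes>\<^sub>M PD)) = (\<integral>\<^sup>+ns. \<integral>\<^sup>+ds. \<Psi> (xs, ns, ds) \<partial>PD \<partial>PN)"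
      by (rule PD.nn_integral_fst[symmetric])
  qed
  finally show ?thesis .
qed

definition active :: "'w \<Rightarrow> (nat \<times> nat) set" where
  "active \<omega> = {p. snd p < N (fst p) \<omega>}"

definition daughter :: "nat \<times> nat \<Rightarrow> 'w \<Rightarrow> real^2" where
  "daughter p \<omega> = X (fst p) \<omega> + D p \<omega>"

lemma daughter_measurable [measurable]: "daughter p \<in> borel_measurable M"
  unfolding daughter_def[abs_def] by measurable

lemma active_measurable [measurable]: "Measurable.pred M (\<lambda>\<omega>. p \<in> active \<omega>)"
  unfolding active_def by simp

text \<open>Minus the logarithm of the factor that a single cluster with parent at \<open>y\<close> contributes
  is \<open>c\<close> times one minus \<open>retain V y\<close>.\<close>

definition retain :: "(real^2 \<Rightarrow> ennreal) \<Rightarrow> real^2 \<Rightarrow> ennreal" where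
  "retain V y = (\<integral>\<^sup>+e. expm (V (y + e)) \<partial>E)"

lemma retain_measurable [measurable]:
  assumes [measurable]: "V \<in> borel_measurable borel"
  shows "retain V \<in> borel_measurable borel"
proof -
  interpret E: prob_space E by (rule prob_space_E)
  show ?thesis unfolding retain_def[abs_def] by measurable
qed

lemma expm_neglog_retain: "expm (neglog (retain V y)) = retain V y"
  unfolding retain_def by (intro expm_neglog prob_space.nn_integral_expm_le_1 prob_space_E)

definition campbell_term :: "(real^2 \<Rightarrow> ennreal) \<Rightarrow> (real^2) set \<Rightarrow> nat \<times> nat \<Rightarrow> 'w \<Rightarrow> ennreal" where
  "campbell_term V A p \<omega> = indicator (active \<omega>) p * indicator A (daughter p \<omega>) *
     expm (\<integral>\<^sup>+q. indicator (active \<omega> - {p}) q * V (daughter q \<omega> - daughter p \<omega>) \<partial>count_space UNIV)"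

lemma campbell_term_measurable:
  assumes [measurable]: "V \<in> borel_measurable borel" "A \<in> sets borel"
  shows "campbell_term V A p \<in> borel_measurable M"
proof -
  have [measurable]: "(\<lambda>\<omega>. indicator (active \<omega> - {p}) q :: ennreal) \<in> borel_measurable M"
     "(\<lambda>\<omega>. indicator (active \<omega>) q :: ennreal) \<in> borel_measurable M" for q
    by (simp_all add: indicator_def of_bool_def)
  have [measurable]: "(\<lambda>\<omega>. \<integral>\<^sup>+q. indicator (active \<omega> - {p}) q * V (daughter q \<omega> - daughter p \<omega>) \<partial>count_space UNIV) \<in> borel_measurable M"
    by (intro borel_measurable_nn_integral_count_space) auto
  show ?thesis unfolding campbell_term_def[abs_def] by measurable
qed

text \<open>The factor of all clusters except the \<open>i\<close>-th after sizes and displacements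
  are integrated out, seen from a daughter of parent \<open>i\<close> displaced by
  \<open>e\<close>.\<close>

definition others :: "(real^2 \<Rightarrow> ennreal) \<Rightarrow> nat \<Rightarrow> (nat \<Rightarrow> real^2) \<Rightarrow> real^2 \<Rightarrow> ennreal" where
  "others V i xs e = expm (\<integral>\<^sup>+i'. indicator (- {i}) i' * (ennreal c * (1 - retain V (xs i' - xs i - e))) \<partial>count_space UNIV)"

lemma others_measurable:
  assumes [measurable]: "V \<in> borel_measurable borel"
    and m: "\<And>i. (\<lambda>\<omega>. xs \<omega> i) \<in> borel_measurable K" "e \<in> borel_measurable K"
  shows "(\<lambda>\<omega>. others V i (xs \<omega>) (e \<omega>)) \<in> borel_measurable K"
proof -
  note m[measurable]
  have [measurable]: "(\<lambda>\<omega>. \<integral>\<^sup>+i'. indicator (- {i}) i' * (ennreal c * (1 - retain V (xs \<omega> i' - xs \<omega> i - e \<omega>))) \<partial>count_space UNIV) \<in> borel_measurable K"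
    by (intro borel_measurable_nn_integral_count_space) auto
  show ?thesis unfolding others_def by measurable
qed

text \<open>The displacement \<open>e\<close> of the marked daughter is kept outermost, since all
  remaining factors depend on it. Relative to that daughter its own parent lies at
  \<open>- e\<close>, so the siblings enter through \<open>retain V (- e)\<close>.\<close>

lemma nn_integral_campbell_term:
  assumes [measurable]: "V \<in> borel_measurable borel" "A \<in> sets borel"
  shows "(\<integral>\<^sup>+\<omega>. campbell_term V A (i, j) \<omega> \<partial>M) =
    (\<integral>\<^sup>+\<omega>. \<integral>\<^sup>+e. indicator A (X i \<omega> + e) * (cluster_weight c (neglog (retain V (- e))) j * others V i (\<lambda>i. X i \<omega>) e) \<partial>E \<partial>M)"
proof -
  interpret E: prob_space E by (rule prob_space_E)
  interpret PN: prob_space PN by (intro prob_space_PiM measure_pmf.prob_space_axioms)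
  interpret NE: pair_sigma_finite PN E ..
  define W where "W ns = {q. snd q < ns (fst q) \<and> q \<noteq> (i, j)}" for ns :: "nat \<Rightarrow> nat"
  define \<Psi> where "\<Psi> t = (case t of (xs, ns, ds) \<Rightarrow>
     indicator {..<ns i} j * (indicator A (xs i + ds (i, j)) *
     expm (\<integral>\<^sup>+q. indicator (W ns) q * V ((xs (fst q) - xs i) + ds q - ds (i, j)) \<partial>count_space UNIV)))" for t
  have [measurable]: "(\<lambda>t. fst t k) \<in> borel_measurable T" for k by measurable
  have [measurable]: "(\<lambda>t. fst (snd t) k) \<in> measurable T (count_space UNIV)" for k by measurable
  have [measurable]: "(\<lambda>t. snd (snd t) k) \<in> borel_measurable T" for k by measurable
  have [measurable]: "(\<lambda>t. indicator {..<fst (snd t) i} j :: ennreal) \<in> borel_measurable T"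
     "(\<lambda>t. indicator (W (fst (snd t))) q :: ennreal) \<in> borel_measurable T" for q
    by (simp_all add: indicator_def of_bool_def W_def)
  have [measurable]: "(\<lambda>t. \<integral>\<^sup>+q. indicator (W (fst (snd t))) q * V ((fst t (fst q) - fst t i) + snd (snd t) q - snd (snd t) (i, j)) \<partial>count_space UNIV) \<in> borel_measurable T"
    by (intro borel_measurable_nn_integral_count_space) auto
  have \<Psi>m: "\<Psi> \<in> borel_measurable T" unfolding \<Psi>_def split_beta' by measurable
  have term_eq: "campbell_term V A (i, j) \<omega> = \<Psi> (\<lambda>i. X i \<omega>, \<lambda>i. N i \<omega>, \<lambda>p. D p \<omega>)" for \<omega>
  proof -
    have "indicator (active \<omega>) (i, j) = (indicator {..<N i \<omega>} j :: ennreal)"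
      by (auto simp: active_def split: split_indicator)
    moreover have "active \<omega> - {(i, j)} = W (\<lambda>i. N i \<omega>)" by (auto simp: active_def W_def)
    moreover have "daughter q \<omega> - (X i \<omega> + D (i, j) \<omega>) = (X (fst q) \<omega> - X i \<omega>) + D q \<omega> - D (i, j) \<omega>" for q
      by (simp add: daughter_def algebra_simps)
    moreover have "daughter (i, j) \<omega> = X i \<omega> + D (i, j) \<omega>" by (simp add: daughter_def)
    ultimately show ?thesis unfolding campbell_term_def \<Psi>_def by (simp only: prod.case mult.assoc)
  qed
  define H where "H xs e = indicator A (xs i + e) * (cluster_weight c (neglog (retain V (- e))) j * others V i xs e)" for xs e
  have inner: "(\<integral>\<^sup>+ns. \<integral>\<^sup>+ds. \<Psi> (xs, ns, ds) \<partial>PD \<partial>PN) = (\<integral>\<^sup>+e. H xs e \<partial>E)" for xs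
  proof -
    define Q where "Q ns e = (\<integral>\<^sup>+q. indicator (W ns) q * neglog (retain V (xs (fst q) - xs i - e)) \<partial>count_space UNIV)" for ns e
    have "(\<integral>\<^sup>+ds. \<Psi> (xs, ns, ds) \<partial>PD) = (\<integral>\<^sup>+e. indicator {..<ns i} j * (indicator A (xs i + e) * expm (Q ns e)) \<partial>E)" for ns
    proof (cases "j < ns i")
      case True
      then have "(\<integral>\<^sup>+ds. \<Psi> (xs, ns, ds) \<partial>PD) = (\<integral>\<^sup>+ds. indicator A (xs i + ds (i, j)) *
          expm (\<integral>\<^sup>+q. indicator (W ns) q * V ((xs (fst q) - xs i) + ds q - ds (i, j)) \<partial>count_space UNIV) \<partial>PD)"
        by (simp add: \<Psi>_def)
      also have "\<dots> = (\<integral>\<^sup>+e. indicator A (xs i + e) * expm (Q ns e) \<partial>E)"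
        unfolding Q_def retain_def
        by (intro nn_integral_displacements[where h="\<lambda>e. indicator A (xs i + e)"] prob_space_E) (auto simp: W_def)
      finally show ?thesis using True by simp
    next
      case False
      then show ?thesis by (simp add: \<Psi>_def)
    qed
    then have "(\<integral>\<^sup>+ns. \<integral>\<^sup>+ds. \<Psi> (xs, ns, ds) \<partial>PD \<partial>PN) =
        (\<integral>\<^sup>+ns. \<integral>\<^sup>+e. indicator {..<ns i} j * (indicator A (xs i + e) * expm (Q ns e)) \<partial>E \<partial>PN)"
      by simp
    also have "\<dots> = (\<integral>\<^sup>+e. \<integral>\<^sup>+ns. indicator {..<ns i} j * (indicator A (xs i + e) * expm (Q ns e)) \<partial>PN \<partial>E)"
    proof (intro NE.Fubini'[symmetric])
      have [measurable]: "(\<lambda>t. fst t k) \<in> measurable (PN \<Otimes>\<^sub>M E) (count_space UNIV)" for k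
      proof -
        have "(\<lambda>t. fst t k) \<in> measurable (PN \<Otimes>\<^sub>M E) (measure_pmf (poisson_pmf c))"
          by (intro measurable_compose[OF measurable_fst measurable_component_singleton]) simp
        then show ?thesis by (simp cong: measurable_cong_sets)
      qed
      have [measurable]: "(\<lambda>t. snd t) \<in> borel_measurable (PN \<Otimes>\<^sub>M E)"
        using measurable_snd[of PN E] by (simp cong: measurable_cong_sets)
      have [measurable]: "(\<lambda>t. indicator {..<fst t i} j :: ennreal) \<in> borel_measurable (PN \<Otimes>\<^sub>M E)"
         "(\<lambda>t. indicator (W (fst t)) q :: ennreal) \<in> borel_measurable (PN \<Otimes>\<^sub>M E)" for q
        by (simp_all add: indicator_def of_bool_def W_def)
      have [measurable]: "(\<lambda>t. Q (fst t) (snd t)) \<in> borel_measurable (PN \<Otimes>\<^sub>M E)"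
        unfolding Q_def by (intro borel_measurable_nn_integral_count_space) auto
      show "case_prod (\<lambda>ns e. indicator {..<ns i} j * (indicator A (xs i + e) * expm (Q ns e))) \<in> borel_measurable (PN \<Otimes>\<^sub>M E)"
        unfolding split_beta' by measurable
    qed
    also have "\<dots> = (\<integral>\<^sup>+e. H xs e \<partial>E)"
    proof (intro nn_integral_cong)
      fix e
      have [measurable]: "(\<lambda>ns. ns k) \<in> measurable PN (count_space UNIV)" for k
      proof -
        have "(\<lambda>ns. ns k) \<in> measurable PN (measure_pmf (poisson_pmf c))"
          by (intro measurable_component_singleton) simp
        then show ?thesis by (simp cong: measurable_cong_sets)
      qed
      have [measurable]: "(\<lambda>ns. indicator {..<ns i} j :: ennreal) \<in> borel_measurable PN"
         "(\<lambda>ns. indicator (W ns) q :: ennreal) \<in> borel_measurable PN" for q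
        by (simp_all add: indicator_def of_bool_def W_def)
      have [measurable]: "(\<lambda>ns. Q ns e) \<in> borel_measurable PN"
        unfolding Q_def by (intro borel_measurable_nn_integral_count_space) auto
      have "(\<integral>\<^sup>+ns. indicator {..<ns i} j * (indicator A (xs i + e) * expm (Q ns e)) \<partial>PN) =
        indicator A (xs i + e) * (\<integral>\<^sup>+ns. indicator {..<ns i} j * expm (Q ns e) \<partial>PN)"
        by (subst nn_integral_cmult[symmetric]) (auto simp: mult_ac)
      also have "(\<integral>\<^sup>+ns. indicator {..<ns i} j * expm (Q ns e) \<partial>PN) =
        cluster_weight c (neglog (retain V (- e))) j * others V i xs e"
        unfolding Q_def W_def others_def
        using nn_integral_cluster_sizes[OF c_pos, of i j "\<lambda>i'. neglog (retain V (xs i' - xs i - e))"]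
        by (simp add: expm_neglog_retain)
      finally show "(\<integral>\<^sup>+ns. indicator {..<ns i} j * (indicator A (xs i + e) * expm (Q ns e)) \<partial>PN) = H xs e"
        by (simp add: H_def)
    qed
    finally show ?thesis .
  qed
  have Hm: "(\<lambda>xs. \<integral>\<^sup>+e. H xs e \<partial>E) \<in> borel_measurable (PiM UNIV (\<lambda>_. borel))"
  proof (rule E.borel_measurable_nn_integral)
    have m1: "(\<lambda>t. fst t k) \<in> borel_measurable (PiM UNIV (\<lambda>_. borel) \<Otimes>\<^sub>M E)" for k by measurable
    have m2: "snd \<in> borel_measurable (PiM UNIV (\<lambda>_. borel :: (real^2) measure) \<Otimes>\<^sub>M E)"
      using measurable_snd[of "PiM UNIV (\<lambda>_. borel :: (real^2) measure)" E] by (simp cong: measurable_cong_sets)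
    have m3: "(\<lambda>t. others V i (fst t) (snd t)) \<in> borel_measurable (PiM UNIV (\<lambda>_. borel) \<Otimes>\<^sub>M E)"
      by (intro others_measurable m1 m2) auto
    have m4: "(\<lambda>b. cluster_weight c b j) \<in> borel_measurable borel"
      unfolding cluster_weight_def by measurable
    show "case_prod H \<in> borel_measurable (PiM UNIV (\<lambda>_. borel) \<Otimes>\<^sub>M E)"
      unfolding H_def split_beta'
      by (intro borel_measurable_times_ennreal m3 measurable_compose[OF _ m4])
         (use m1 m2 in measurable)
  qed
  have "(\<integral>\<^sup>+\<omega>. campbell_term V A (i, j) \<omega> \<partial>M) = (\<integral>\<^sup>+xs. \<integral>\<^sup>+e. H xs e \<partial>E \<partial>LX)"
    unfolding term_eq nn_integral_joint_law[OF \<Psi>m] inner ..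
  also have "\<dots> = (\<integral>\<^sup>+\<omega>. \<integral>\<^sup>+e. H (\<lambda>i. X i \<omega>) e \<partial>E \<partial>M)"
    using Hm by (subst nn_integral_distr) auto
  finally show ?thesis by (simp add: H_def)
qed

text \<open>For fixed \<open>e\<close>, the sum over \<open>j\<close> affects only the own-cluster
  factor and gives it a closed form, while the sum over \<open>i\<close> is a Mecke sum of the
  parents. A daughter lies in \<open>A\<close> exactly when its parent lies in \<open>A\<close>
  shifted back by \<open>e\<close>.\<close>

lemma nn_integral_cluster_sum:
  assumes V[measurable]: "V \<in> borel_measurable borel" and A[measurable]: "A \<in> sets borel"
  shows "(\<integral>\<^sup>+\<omega>. \<integral>\<^sup>+p. campbell_term V A p \<omega> \<partial>count_space UNIV \<partial>M) =
    (\<integral>\<^sup>+e. ennreal c * expm (ennreal c * (1 - retain V (- e))) *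
      mecke_sum M X ((\<lambda>v. v + e) -` A) (\<lambda>x y. ennreal c * (1 - retain V (y - x - e))) \<partial>E)"
proof -
  let ?cw = "\<lambda>j e. cluster_weight c (neglog (retain V (- e))) j"
  interpret E: prob_space E by (rule prob_space_E)
  interpret ME: pair_sigma_finite M E ..
  define w where "w e = ennreal c * expm (ennreal c * (1 - retain V (- e)))" for e
  define K where "K i \<omega> e = indicator A (X i \<omega> + e) * others V i (\<lambda>i. X i \<omega>) e" for i \<omega> e
  have m2: "snd \<in> borel_measurable (M \<Otimes>\<^sub>M E)"
    using measurable_snd[of M E] by (simp cong: measurable_cong_sets)
  have Kpair: "(\<lambda>t. K i (fst t) (snd t)) \<in> borel_measurable (M \<Otimes>\<^sub>M E)" for i
  proof -
    have "(\<lambda>t. others V i (\<lambda>i. X i (fst t)) (snd t)) \<in> borel_measurable (M \<Otimes>\<^sub>M E)"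
      by (intro others_measurable V m2) measurable
    moreover have "(\<lambda>t. indicator A (X i (fst t) + snd t) :: ennreal) \<in> borel_measurable (M \<Otimes>\<^sub>M E)"
      using m2 by (intro measurable_compose[OF _ borel_measurable_indicator[OF A]] borel_measurable_add) auto
    ultimately show ?thesis unfolding K_def by (intro borel_measurable_times_ennreal)
  qed
  have Ke: "K i \<omega> \<in> borel_measurable E" if "\<omega> \<in> space M" for i \<omega>
    using measurable_Pair2[OF Kpair that] by simp
  have K\<omega>: "(\<lambda>\<omega>. K i \<omega> e) \<in> borel_measurable M" for i e
    using measurable_Pair1[OF Kpair, of e] by simp
  have cw: "(\<lambda>e. ?cw j e) \<in> borel_measurable E" for j
  proof -
    have "(\<lambda>b. cluster_weight c b j) \<in> borel_measurable borel"
      unfolding cluster_weight_def by measurable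
    from measurable_compose[OF _ this] show ?thesis by measurable
  qed
  have wm: "w \<in> borel_measurable E" unfolding w_def by measurable
  have cwsum: "(\<integral>\<^sup>+j. ?cw j e \<partial>count_space UNIV) = w e" for e
    by (simp add: nn_integral_cluster_weight c_pos expm_neglog_retain w_def)
  have mK: "(\<lambda>\<omega>. \<integral>\<^sup>+e. u e * K i \<omega> e \<partial>E) \<in> borel_measurable M" if u: "u \<in> borel_measurable E" for u i
  proof (rule E.borel_measurable_nn_integral)
    show "case_prod (\<lambda>\<omega> e. u e * K i \<omega> e) \<in> borel_measurable (M \<Otimes>\<^sub>M E)"
      unfolding split_beta' by (intro borel_measurable_times_ennreal Kpair measurable_compose[OF measurable_snd u])
  qed
  have "(\<integral>\<^sup>+\<omega>. \<integral>\<^sup>+p. campbell_term V A p \<omega> \<partial>count_space UNIV \<partial>M) =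
     (\<integral>\<^sup>+p. \<integral>\<^sup>+\<omega>. campbell_term V A p \<omega> \<partial>M \<partial>count_space UNIV)"
    by (intro nn_integral_count_space_nn_integral campbell_term_measurable V A) auto
  also have "\<dots> = (\<integral>\<^sup>+i. \<integral>\<^sup>+j. \<integral>\<^sup>+\<omega>. campbell_term V A (i, j) \<omega> \<partial>M \<partial>count_space UNIV \<partial>count_space UNIV)"
    by (rule nn_integral_fst_count_space[symmetric])
  also have "\<dots> = (\<integral>\<^sup>+i. \<integral>\<^sup>+j. \<integral>\<^sup>+\<omega>. \<integral>\<^sup>+e. ?cw j e * K i \<omega> e \<partial>E \<partial>M \<partial>count_space UNIV \<partial>count_space UNIV)"
    unfolding nn_integral_campbell_term[OF V A] K_def by (simp only: mult.left_commute)
  also have "\<dots> = (\<integral>\<^sup>+i. \<integral>\<^sup>+\<omega>. \<integral>\<^sup>+j. \<integral>\<^sup>+e. ?cw j e * K i \<omega> e \<partial>E \<partial>count_space UNIV \<partial>M \<partial>count_space UNIV)"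
    by (intro nn_integral_cong nn_integral_count_space_nn_integral[symmetric] mK cw) auto
  also have "\<dots> = (\<integral>\<^sup>+i. \<integral>\<^sup>+\<omega>. \<integral>\<^sup>+e. \<integral>\<^sup>+j. ?cw j e * K i \<omega> e \<partial>count_space UNIV \<partial>E \<partial>M \<partial>count_space UNIV)"
    by (intro nn_integral_cong nn_integral_count_space_nn_integral[symmetric] borel_measurable_times_ennreal Ke cw) auto
  also have "\<dots> = (\<integral>\<^sup>+i. \<integral>\<^sup>+\<omega>. \<integral>\<^sup>+e. w e * K i \<omega> e \<partial>E \<partial>M \<partial>count_space UNIV)"
    by (subst nn_integral_multc) (auto simp: cwsum)
  also have "\<dots> = (\<integral>\<^sup>+i. \<integral>\<^sup>+e. \<integral>\<^sup>+\<omega>. w e * K i \<omega> e \<partial>M \<partial>E \<partial>count_space UNIV)"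
  proof (intro nn_integral_cong ME.Fubini'[symmetric])
    show "case_prod (\<lambda>\<omega> e. w e * K i \<omega> e) \<in> borel_measurable (M \<Otimes>\<^sub>M E)" for i
      unfolding split_beta' by (intro borel_measurable_times_ennreal Kpair measurable_compose[OF measurable_snd wm])
  qed
  also have "\<dots> = (\<integral>\<^sup>+i. \<integral>\<^sup>+e. w e * (\<integral>\<^sup>+\<omega>. K i \<omega> e \<partial>M) \<partial>E \<partial>count_space UNIV)"
    by (simp add: nn_integral_cmult K\<omega>)
  also have "\<dots> = (\<integral>\<^sup>+e. \<integral>\<^sup>+i. w e * (\<integral>\<^sup>+\<omega>. K i \<omega> e \<partial>M) \<partial>count_space UNIV \<partial>E)"
  proof (intro nn_integral_count_space_nn_integral[symmetric] borel_measurable_times_ennreal wm)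
    show "(\<lambda>e. \<integral>\<^sup>+\<omega>. K i \<omega> e \<partial>M) \<in> borel_measurable E" for i
      using ME.borel_measurable_nn_integral_fst
      by (intro borel_measurable_nn_integral) (use measurable_compose[OF measurable_pair_swap' Kpair[of i]] in \<open>simp add: split_beta'\<close>)
  qed auto
  also have "\<dots> = (\<integral>\<^sup>+e. w e * (\<integral>\<^sup>+\<omega>. \<integral>\<^sup>+i. K i \<omega> e \<partial>count_space UNIV \<partial>M) \<partial>E)"
    by (simp add: nn_integral_cmult nn_integral_count_space_nn_integral K\<omega>)
  also have "\<dots> = (\<integral>\<^sup>+e. w e * mecke_sum M X ((\<lambda>v. v + e) -` A) (\<lambda>x y. ennreal c * (1 - retain V (y - x - e))) \<partial>E)"
  proof -
    have "(\<integral>\<^sup>+\<omega>. \<integral>\<^sup>+i. K i \<omega> e \<partial>count_space UNIV \<partial>M) =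
      mecke_sum M X ((\<lambda>v. v + e) -` A) (\<lambda>x y. ennreal c * (1 - retain V (y - x - e)))" for e
      unfolding mecke_sum_def K_def others_def by (simp add: indicator_def)
    then show ?thesis by simp
  qed
  finally show ?thesis by (simp add: w_def)
qed

text \<open>By translation invariance the shifts by \<open>e\<close> of the window and of the weight
  both drop out of the Mecke value, so only the own-cluster factor is still averaged over the
  displacement.\<close>

lemma nn_integral_cluster_sum_continuous:
  assumes V[measurable]: "V \<in> borel_measurable borel" and A[measurable]: "A \<in> sets borel" and bA: "bounded A"
    and \<phi>: "\<And>y. ennreal c * (1 - retain V y) = ennreal (\<phi> y)" "\<And>y. 0 \<le> \<phi> y" "continuous_on UNIV \<phi>"
    and fin: "(\<integral>\<^sup>+y. 1 - expm (ennreal (\<phi> y)) \<partial>lborel) < \<infinity>"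
  shows "(\<integral>\<^sup>+\<omega>. \<integral>\<^sup>+p. campbell_term V A p \<omega> \<partial>count_space UNIV \<partial>M) =
    ennreal c * (\<integral>\<^sup>+e. expm (ennreal (\<phi> (- e))) \<partial>E) * mecke_value A (\<lambda>y. ennreal (\<phi> y))"
proof -
  have [measurable]: "\<phi> \<in> borel_measurable borel" using \<phi>(3) by (rule borel_measurable_continuous_onI)
  have "mecke_sum M X ((\<lambda>v. v + e) -` A) (\<lambda>x y. ennreal (\<phi> (y - x - e))) = mecke_value A (\<lambda>y. ennreal (\<phi> y))" for e
  proof -
    have Ae: "(\<lambda>v. v + e) -` A \<in> sets borel"
      using measurable_sets[of "\<lambda>v. v + e" borel borel A] by simp
    have "(\<lambda>v. v + e) -` A = (+) (- e) ` A"
      by (auto simp: image_iff) (metis add.commute add.left_commute left_minus add_0_right diff_add_cancel uminus_add_conv_diff)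
    then have "bounded ((\<lambda>v. v + e) -` A)" using bounded_translation[OF bA, of "- e"] by simp
    then have "mecke_sum M X ((\<lambda>v. v + e) -` A) (\<lambda>x y. ennreal (\<phi> (y - x - e))) = mecke_value ((\<lambda>v. v + e) -` A) (\<lambda>y. ennreal (\<phi> (y - e)))"
    \<comment> \<open>The weight is continuous everywhere, so any point can be named as the
      exceptional one.\<close>
    proof (rule mecke_sum_stationary[where \<phi>="\<lambda>y. \<phi> (y - e)" and z=0, OF Ae])
      have "continuous_on UNIV (\<lambda>y. \<phi> (y - e))"
        by (intro continuous_on_compose2[OF \<phi>(3)] continuous_intros) auto
      then show "continuous_on (- {0}) (\<lambda>y. \<phi> (y - e))" by (rule continuous_on_subset) auto
      show "(\<integral>\<^sup>+y. 1 - expm (ennreal (\<phi> (y - e))) \<partial>lborel) < \<infinity>"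
        using fin nn_integral_lborel_shift[of "\<lambda>y. 1 - expm (ennreal (\<phi> y))" "- e"] by simp
    qed (use \<phi> in auto)
    also have "\<dots> = mecke_value ((\<lambda>v. v + e) -` A) (\<lambda>y. ennreal (\<phi> y))"
      by (rule mecke_value_shift[of "\<lambda>y. ennreal (\<phi> y)"]) simp
    also have "emeasure lborel ((\<lambda>v. v + e) -` A) = emeasure lborel A"
    proof -
      have "emeasure lborel ((\<lambda>v. v + e) -` A) = (\<integral>\<^sup>+y. indicator ((\<lambda>v. v + e) -` A) y \<partial>lborel)"
        using Ae by simp
      also have "\<dots> = (\<integral>\<^sup>+y. indicator A (y + e) \<partial>lborel)"
        by (intro nn_integral_cong) (simp add: indicator_def)
      also have "\<dots> = emeasure lborel A" by (subst nn_integral_lborel_shift) auto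
      finally show ?thesis .
    qed
    then have "mecke_value ((\<lambda>v. v + e) -` A) (\<lambda>y. ennreal (\<phi> y)) = mecke_value A (\<lambda>y. ennreal (\<phi> y))"
      by (simp add: mecke_value_def)
    finally show ?thesis .
  qed
  then have "(\<integral>\<^sup>+\<omega>. \<integral>\<^sup>+p. campbell_term V A p \<omega> \<partial>count_space UNIV \<partial>M) =
    (\<integral>\<^sup>+e. ennreal c * expm (ennreal (\<phi> (- e))) * mecke_value A (\<lambda>y. ennreal (\<phi> y)) \<partial>E)"
    unfolding nn_integral_cluster_sum[OF V A] \<phi>(1) by simp
  also have "\<dots> = ennreal c * (\<integral>\<^sup>+e. expm (ennreal (\<phi> (- e))) \<partial>E) * mecke_value A (\<lambda>y. ennreal (\<phi> y))"
    by (simp add: nn_integral_multc nn_integral_cmult)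
  finally show ?thesis .
qed

section \<open>Intensity, local finiteness and simplicity of the daughter process\<close>

lemma nn_integral_active:
  assumes A: "A \<in> sets borel" "bounded A"
  shows "(\<integral>\<^sup>+\<omega>. \<integral>\<^sup>+p. indicator (active \<omega>) p * indicator A (daughter p \<omega>) \<partial>count_space UNIV \<partial>M) =
    ennreal (c * l) * emeasure lborel A"
proof -
  interpret E: prob_space E by (rule prob_space_E)
  have "retain (\<lambda>_. 0) y = 1" for y using E.emeasure_space_1 by (simp add: retain_def)
  then have "(\<integral>\<^sup>+\<omega>. \<integral>\<^sup>+p. campbell_term (\<lambda>_. 0) A p \<omega> \<partial>count_space UNIV \<partial>M) =
    ennreal c * (\<integral>\<^sup>+e. expm (ennreal 0) \<partial>E) * mecke_value A (\<lambda>y. ennreal 0)"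
    by (intro nn_integral_cluster_sum_continuous A) auto
  then show ?thesis
    using c_pos l_pos E.emeasure_space_1 by (simp add: campbell_term_def mecke_value_def ennreal_mult' mult.assoc)
qed

text \<open>Local finiteness is not built into \<open>neyman_scott\<close>. It follows from the
  first moment: a ball has a finite mean count, and every bounded set lies in one of countably many
  balls.\<close>

lemma AE_active_finite: "AE \<omega> in M. \<forall>B. bounded B \<longrightarrow> finite {p\<in>active \<omega>. daughter p \<omega> \<in> B}"
proof -
  have "AE \<omega> in M. finite {p\<in>active \<omega>. daughter p \<omega> \<in> ball 0 (real n)}" for n
  proof -
    have ind: "(\<lambda>\<omega>. indicator (active \<omega>) q :: ennreal) \<in> borel_measurable M" for q
      by (simp_all add: indicator_def of_bool_def)
    have m: "(\<lambda>\<omega>. \<integral>\<^sup>+p. indicator (active \<omega>) p * indicator (ball 0 (real n)) (daughter p \<omega>) \<partial>count_space UNIV) \<in> borel_measurable M"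
      by (intro borel_measurable_nn_integral_count_space borel_measurable_times_ennreal ind
          measurable_compose[OF daughter_measurable borel_measurable_indicator]) auto
    have "(\<integral>\<^sup>+\<omega>. \<integral>\<^sup>+p. indicator (active \<omega>) p * indicator (ball 0 (real n)) (daughter p \<omega>) \<partial>count_space UNIV \<partial>M) < \<infinity>"
      using emeasure_lborel_bounded[of "ball 0 (real n) :: (real^2) set"]
      by (subst nn_integral_active) (auto simp: ennreal_mult_less_top)
    then have "AE \<omega> in M. (\<integral>\<^sup>+p. indicator (active \<omega>) p * indicator (ball 0 (real n)) (daughter p \<omega>) \<partial>count_space UNIV) \<noteq> \<infinity>"
      by (intro nn_integral_PInf_AE m) auto
    then show ?thesis
    proof eventually_elim
      case (elim \<omega>)
      have "(\<integral>\<^sup>+p. indicator (active \<omega>) p * indicator (ball 0 (real n)) (daughter p \<omega>) \<partial>count_space UNIV) =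
        (\<integral>\<^sup>+p. indicator {p\<in>active \<omega>. daughter p \<omega> \<in> ball 0 (real n)} p \<partial>count_space UNIV)"
        by (intro nn_integral_cong) (auto split: split_indicator)
      also have "\<dots> = emeasure (count_space UNIV) {p\<in>active \<omega>. daughter p \<omega> \<in> ball 0 (real n)}"
        by simp
      finally show ?case using elim by (auto simp: emeasure_count_space split: if_splits)
    qed
  qed
  then have "AE \<omega> in M. \<forall>n. finite {p\<in>active \<omega>. daughter p \<omega> \<in> ball 0 (real n)}"
    by (simp add: AE_all_countable)
  then show ?thesis
  proof eventually_elim
    case (elim \<omega>)
    show ?case
    proof (intro allI impI)
      fix B :: "(real^2) set" assume "bounded B"
      then obtain r where "B \<subseteq> ball 0 r" using bounded_subset_ballD by blast
      moreover obtain n where "r < real n" using reals_Archimedean2 by blast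
      ultimately have "B \<subseteq> ball 0 (real n)" using subset_ball[of r "real n" 0] by fastforce
      then have "{p\<in>active \<omega>. daughter p \<omega> \<in> B} \<subseteq> {p\<in>active \<omega>. daughter p \<omega> \<in> ball 0 (real n)}" by auto
      then show "finite {p\<in>active \<omega>. daughter p \<omega> \<in> B}" using elim finite_subset by blast
    qed
  qed
qed

text \<open>The displacement of \<open>p\<close> has a density and is independent of everything that
  locates another daughter \<open>q\<close>, also within the same cluster, so a coincidence is null.
  Only then does the set \<open>\<Phi> \<omega>\<close> count every daughter once, as the indexed
  form of the Palm distribution demands.\<close>

lemma AE_daughter_inj: "AE \<omega> in M. inj_on (\<lambda>p. daughter p \<omega>) (active \<omega>)"
proof -
  interpret E: prob_space E by (rule prob_space_E)
  have "AE \<omega> in M. daughter p \<omega> \<noteq> daughter q \<omega>" if pq: "p \<noteq> q" for p q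
  proof -
    let ?P = "PiM (UNIV - {p}) (\<lambda>_. E)"
    interpret P: prob_space "?P" by (intro prob_space_PiM prob_space_E)
    interpret EP: pair_sigma_finite E "?P" ..
    define \<Psi> :: "_ \<Rightarrow> ennreal" where "\<Psi> t = (case t of (xs, ns, ds) \<Rightarrow> indicator {0} (xs (fst p) + ds p - (xs (fst q) + ds q)))"
      for t :: "(nat \<Rightarrow> real^2) \<times> (nat \<Rightarrow> nat) \<times> (nat \<times> nat \<Rightarrow> real^2)"
    have a: "(\<lambda>t. fst t k) \<in> borel_measurable T" for k by measurable
    have b: "(\<lambda>t. snd (snd t) k) \<in> borel_measurable T" for k by measurable
    have \<Psi>m: "\<Psi> \<in> borel_measurable T"
      unfolding \<Psi>_def split_beta'
      by (intro measurable_compose[OF _ borel_measurable_indicator[of "{0}" borel]] borel_measurable_diff borel_measurable_add a b) auto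
    have zero: "(\<integral>\<^sup>+ds. \<Psi> (xs, ns, ds) \<partial>PD) = 0" for xs ns
    proof -
      have "(\<lambda>ds. ds k) \<in> borel_measurable PD" for k
      proof -
        have "(\<lambda>ds. ds k) \<in> measurable PD E" by (intro measurable_component_singleton) simp
        then show ?thesis by (simp cong: measurable_cong_sets)
      qed
      then have m: "(\<lambda>ds. \<Psi> (xs, ns, ds)) \<in> borel_measurable PD"
        unfolding \<Psi>_def by (auto intro!: measurable_compose[OF _ borel_measurable_indicator[of "{0}" borel]] borel_measurable_diff borel_measurable_add)
      have "(\<integral>\<^sup>+ds. \<Psi> (xs, ns, ds) \<partial>PD) =
        (\<integral>\<^sup>+e. \<integral>\<^sup>+d. indicator {0} (xs (fst p) + e - (xs (fst q) + d q)) \<partial>?P \<partial>E)"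
        using pq by (subst nn_integral_PiM_split[OF prob_space_E m, of p]) (simp add: \<Psi>_def)
      also have "\<dots> = (\<integral>\<^sup>+d. \<integral>\<^sup>+e. indicator {0} (xs (fst p) + e - (xs (fst q) + d q)) \<partial>E \<partial>?P)"
      proof (intro EP.Fubini'[symmetric])
        have m1: "fst \<in> borel_measurable (E \<Otimes>\<^sub>M ?P)"
          using measurable_fst[of E "?P"] by (simp cong: measurable_cong_sets)
        have "(\<lambda>t. snd t q) \<in> measurable (E \<Otimes>\<^sub>M ?P) E"
          using pq by (intro measurable_compose[OF measurable_snd measurable_component_singleton]) auto
        then have m2: "(\<lambda>t. snd t q) \<in> borel_measurable (E \<Otimes>\<^sub>M ?P)"
          by (simp cong: measurable_cong_sets)
        show "(\<lambda>(e, d). indicator {0} (xs (fst p) + e - (xs (fst q) + d q)) :: ennreal) \<in> borel_measurable (E \<Otimes>\<^sub>M ?P)"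
          unfolding split_beta'
          by (intro measurable_compose[OF _ borel_measurable_indicator[of "{0}" borel]] borel_measurable_diff borel_measurable_add m1 m2) auto
      qed
      also have "\<dots> = (\<integral>\<^sup>+d. 0 \<partial>?P)"
      proof (intro nn_integral_cong)
        fix d :: "nat \<times> nat \<Rightarrow> real^2"
        define v where "v = xs (fst q) + d q - xs (fst p)"
        have "(\<integral>\<^sup>+e. indicator {0} (xs (fst p) + e - (xs (fst q) + d q)) \<partial>E) = (\<integral>\<^sup>+e. indicator {v} e \<partial>E)"
          by (intro nn_integral_cong) (auto simp: v_def algebra_simps split: split_indicator)
        also have "\<dots> = (\<integral>\<^sup>+e. ennreal (f e) * indicator {v} e \<partial>lborel)"
          by (subst nn_integral_density) auto
        also have "\<dots> = (\<integral>\<^sup>+e. 0 \<partial>(lborel :: (real^2) measure))"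
          using AE_lborel_singleton[of v] by (intro nn_integral_cong_AE) (auto elim!: eventually_mono)
        finally show "(\<integral>\<^sup>+e. indicator {0} (xs (fst p) + e - (xs (fst q) + d q)) \<partial>E) = 0" by simp
      qed
      finally show ?thesis by simp
    qed
    have "(\<integral>\<^sup>+\<omega>. \<Psi> (\<lambda>i. X i \<omega>, \<lambda>i. N i \<omega>, \<lambda>p. D p \<omega>) \<partial>M) = 0"
      unfolding nn_integral_joint_law[OF \<Psi>m] zero by simp
    moreover have "\<Psi> (\<lambda>i. X i \<omega>, \<lambda>i. N i \<omega>, \<lambda>p. D p \<omega>) = indicator {0} (daughter p \<omega> - daughter q \<omega>)" for \<omega>
      by (simp add: \<Psi>_def daughter_def)
    ultimately have "AE \<omega> in M. indicator {0} (daughter p \<omega> - daughter q \<omega>) = (0 :: ennreal)"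
      by (subst (asm) nn_integral_0_iff_AE) auto
    then show ?thesis by eventually_elim (auto simp: indicator_def split: if_splits)
  qed
  then have "AE \<omega> in M. \<forall>p q. p \<noteq> q \<longrightarrow> daughter p \<omega> \<noteq> daughter q \<omega>"
    by (simp add: AE_all_countable)
  then show ?thesis by eventually_elim (auto simp: inj_on_def)
qed

end

section \<open>Comparison of the two success probabilities\<close>

text \<open>It serves to move a receiver anywhere on the circle of radius \<open>R\<close> to
  \<open>(R, 0)\<close>, where \<open>beta\<close> is anchored. Boxes keep their area because an
  orthogonal matrix has determinant 1 or -1.\<close>

lemma distr_lborel_orthogonal:
  fixes Q :: "real^2 \<Rightarrow> real^2"
  assumes Q: "orthogonal_transformation Q"
  shows "distr lborel borel Q = lborel"
proof (rule lborel_eqI[symmetric])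
  have bijQ: "bij Q" using Q by (rule orthogonal_transformation_bij)
  have Qi: "orthogonal_transformation (inv Q)" using Q by (rule orthogonal_transformation_inv)
  have linQ: "linear Q" "linear (inv Q)" using Q Qi by (auto simp: orthogonal_transformation_def)
  have Qm: "Q \<in> borel_measurable borel"
    using linQ by (intro borel_measurable_continuous_onI linear_continuous_on) (simp add: linear_conv_bounded_linear)
  fix u v :: "real^2" assume uv: "\<And>b. b \<in> Basis \<Longrightarrow> u \<bullet> b \<le> v \<bullet> b"
  have S: "inv Q ` box u v \<in> sets borel"
    using measurable_sets[OF Qm, of "box u v"] by (simp add: bij_vimage_eq_inv_image[OF bijQ])
  have bS: "bounded (inv Q ` box u v)"
    using linQ by (intro bounded_linear_image bounded_box) (simp add: linear_conv_bounded_linear)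
  have "emeasure (distr lborel borel Q) (box u v) = emeasure lborel (inv Q ` box u v)"
    using Qm by (simp add: emeasure_distr bij_vimage_eq_inv_image[OF bijQ])
  also have "\<dots> = ennreal (measure lborel (inv Q ` box u v))"
    using emeasure_lborel_bounded[OF bS] by (intro emeasure_eq_ennreal_measure) auto
  also have "measure lborel (inv Q ` box u v) = measure lebesgue (inv Q ` box u v)"
    using S by (simp add: measure_completion)
  also have "\<dots> = \<bar>det (matrix (inv Q))\<bar> * measure lebesgue (box u v)"
    using linQ by (intro measure_lebesgue_linear_transformation) auto
  also have "\<bar>det (matrix (inv Q))\<bar> = 1"
    using Qi det_orthogonal_matrix[of "matrix (inv Q)"] by (auto simp: orthogonal_transformation_matrix)
  also have "measure lebesgue (box u v) = measure lborel (box u v)"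
    by (simp add: measure_completion)
  also have "ennreal (1 * measure lborel (box u v)) = (\<Prod>b\<in>Basis. (v - u) \<bullet> b)"
    using uv by (simp add: measure_lborel_box_eq)
  finally show "emeasure (distr lborel borel Q) (box u v) = (\<Prod>b\<in>Basis. (v - u) \<bullet> b)" .
qed simp

section \<open>Convexity bounds on the cluster success probability\<close>

lemma exp_chord:
  fixes b B c :: real
  assumes "0 \<le> b" "b \<le> B" "0 < B"
  shows "exp (- (c * b)) \<le> 1 - b / B * (1 - exp (- (c * B)))"
proof -
  have "exp ((1 - b / B) *\<^sub>R 0 + (b / B) *\<^sub>R (- (c * B))) \<le> (1 - b / B) * exp 0 + (b / B) * exp (- (c * B))"
    using assms exp_convex by (intro convex_onD) auto
  then show ?thesis using assms by (simp add: algebra_simps)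
qed

lemma integrable_one_minus_exp:
  fixes b :: "'a \<Rightarrow> real"
  assumes b: "integrable \<mu> b" "\<And>x. 0 \<le> b x" and c: "0 < c"
  shows "integrable \<mu> (\<lambda>x. 1 - exp (- (c * b x)))"
proof (rule Bochner_Integration.integrable_bound[OF integrable_mult_right[OF b(1), of c]])
  have [measurable]: "b \<in> borel_measurable \<mu>" using b by auto
  show "(\<lambda>x. 1 - exp (- (c * b x))) \<in> borel_measurable \<mu>" by simp
  have "norm (1 - exp (- (c * b x))) \<le> norm (c * b x)" for x
    using exp_ge_add_one_self[of "- (c * b x)"] b(2)[of x] c by (simp add: abs_of_nonneg)
  then show "AE x in \<mu>. norm (1 - exp (- (c * b x))) \<le> norm (c * b x)" by simp
qed

text \<open>Writing \<open>U = c B\<close> and \<open>a = (1 - exp (- U)) / U\<close>, the chord bound gives the exponent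
  \<open>\<delta> a\<close> for the first factor and \<open>\<delta> U a\<close> for the second one, and \<open>a (1 + U) \<ge> 1\<close>.\<close>

lemma cluster_upper_bound:
  fixes b :: "'a \<Rightarrow> real" and b' :: "'b \<Rightarrow> real"
  assumes b: "integrable \<mu> b" "\<And>x. 0 \<le> b x" "\<And>x. b x \<le> B"
    and \<nu>: "prob_space \<nu>" and b': "b' \<in> borel_measurable \<nu>" "\<And>x. 0 \<le> b' x" "\<And>x. b' x \<le> B"
    and B: "0 < B" and \<delta>: "0 < \<delta>" "\<delta> \<le> (\<integral>x. b' x \<partial>\<nu>) / B"
    and lc: "0 < l" "0 < c" "\<delta> < l * c * (\<integral>x. b x \<partial>\<mu>)"
  shows "exp (- (l * (\<integral>x. 1 - exp (- (c * b x)) \<partial>\<mu>))) * (\<integral>x. exp (- (c * b' x)) \<partial>\<nu>) < exp (- \<delta>)"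
proof -
  interpret \<nu>: prob_space \<nu> by fact
  define U where "U = c * B"
  define a where "a = (1 - exp (- U)) / U"
  define k where "k = (\<integral>x. b' x \<partial>\<nu>)"
  have U: "0 < U" using B lc by (simp add: U_def)
  have a: "0 < a" using U by (simp add: a_def)
  have ib': "integrable \<nu> b'"
    by (rule \<nu>.integrable_const_bound[where B=B]) (use b' in auto)
  have i1: "integrable \<mu> (\<lambda>x. 1 - exp (- (c * b x)))"
    by (rule integrable_one_minus_exp[OF b(1,2) lc(2)])
  have "(\<integral>x. b x / B * (1 - exp (- U)) \<partial>\<mu>) \<le> (\<integral>x. 1 - exp (- (c * b x)) \<partial>\<mu>)"
    using exp_chord[OF b(2,3) B, where c=c] b(1) i1 unfolding U_def
    by (intro integral_mono) (auto simp: algebra_simps)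
  then have "l * (c * a * (\<integral>x. b x \<partial>\<mu>)) \<le> l * (\<integral>x. 1 - exp (- (c * b x)) \<partial>\<mu>)"
    using lc B by (intro mult_left_mono) (auto simp: a_def U_def mult.commute)
  \<comment> \<open>The strictness of the conclusion originates here, from \<open>l * c\<close>
    lying strictly above the Poisson optimum; the other estimates are weak.\<close>
  moreover have "\<delta> * a < l * c * (\<integral>x. b x \<partial>\<mu>) * a" using lc a by simp
  ultimately have first: "\<delta> * a < l * (\<integral>x. 1 - exp (- (c * b x)) \<partial>\<mu>)" by (simp add: mult_ac)
  have i2: "integrable \<nu> (\<lambda>x. exp (- (c * b' x)))"
    by (rule \<nu>.integrable_const_bound[where B=1]) (use b' lc in auto)
  have "(\<integral>x. exp (- (c * b' x)) \<partial>\<nu>) \<le> (\<integral>x. 1 - b' x / B * (1 - exp (- U)) \<partial>\<nu>)"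
    using exp_chord[OF b'(2,3) B, where c=c] ib' i2 unfolding U_def by (intro integral_mono) auto
  also have "\<dots> = 1 - k / B * (1 - exp (- U))"
    using ib' by (simp add: k_def \<nu>.prob_space)
  \<comment> \<open>Here \<open>\<delta> \<le> k / B\<close> enters, and with it the bound on
    \<epsilon> in the theorem.\<close>
  also have "\<dots> \<le> 1 - \<delta> * (1 - exp (- U))"
    using mult_right_mono[OF \<delta>(2), of "1 - exp (- U)"] U by (simp add: k_def)
  also have "\<dots> = 1 - \<delta> * (U * a)" using U by (simp add: a_def)
  also have "\<dots> \<le> exp (- (\<delta> * (U * a)))"
    using exp_ge_add_one_self[of "- (\<delta> * (U * a))"] by simp
  finally have second: "(\<integral>x. exp (- (c * b' x)) \<partial>\<nu>) \<le> exp (- (\<delta> * (U * a)))" .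
  \<comment> \<open>\<open>1 + U \<le> exp U\<close>, to be rearranged into
    \<open>1 \<le> a * (1 + U)\<close>.\<close>
  have "(1 + U) * exp (- U) \<le> exp U * exp (- U)"
    using exp_ge_add_one_self[of U] by (intro mult_right_mono) auto
  then have "U \<le> (1 - exp (- U)) * (1 + U)" by (simp add: algebra_simps flip: exp_add)
  then have a1: "1 \<le> a * (1 + U)" using U by (simp add: a_def field_simps)
  have "exp (- (l * (\<integral>x. 1 - exp (- (c * b x)) \<partial>\<mu>))) * (\<integral>x. exp (- (c * b' x)) \<partial>\<nu>)
    \<le> exp (- (l * (\<integral>x. 1 - exp (- (c * b x)) \<partial>\<mu>))) * exp (- (\<delta> * (U * a)))"
    using second by (intro mult_left_mono) auto
  also have "\<dots> < exp (- (\<delta> * a)) * exp (- (\<delta> * (U * a)))"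
    using first by simp
  also have "\<dots> = exp (- (\<delta> * (a * (1 + U))))"
    by (simp add: algebra_simps flip: exp_add)
  also have "\<dots> \<le> exp (- \<delta>)" using \<delta>(1) a1 by simp
  finally show ?thesis .
qed

text \<open>The product \<open>l * c = v\<close> is kept while \<open>c\<close> is made small. As 1
  - exp(- t) \<le> t, the first factor stays above exp(- v \<integral>b) for every \<open>c\<close>;
  the second tends to 1 and finally fits into the gap left by the strict inequality on
  \<open>v\<close>.\<close>

lemma cluster_lower_bound:
  fixes b :: "'a \<Rightarrow> real" and b' :: "'b \<Rightarrow> real"
  assumes b: "integrable \<mu> b" "\<And>x. 0 \<le> b x"
    and \<nu>: "prob_space \<nu>" and b': "b' \<in> borel_measurable \<nu>" "\<And>x. 0 \<le> b' x" "\<And>x. b' x \<le> B"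
    and v: "0 < v" "v * (\<integral>x. b x \<partial>\<mu>) < \<delta>"
  obtains c where "0 < c"
    "exp (- \<delta>) \<le> exp (- (v / c * (\<integral>x. 1 - exp (- (c * b x)) \<partial>\<mu>))) * (\<integral>x. exp (- (c * b' x)) \<partial>\<nu>)"
proof -
  interpret \<nu>: prob_space \<nu> by fact
  define k where "k = (\<integral>x. b' x \<partial>\<nu>)"
  define \<beta> where "\<beta> = (\<integral>x. b x \<partial>\<mu>)"
  define q where "q = exp (- (\<delta> - v * \<beta>))"
  have k0: "0 \<le> k" unfolding k_def using b' by (intro integral_nonneg_AE) auto
  have q: "0 < q" "q < 1" using v by (auto simp: q_def \<beta>_def)
  \<comment> \<open>Chosen so that the linear bound \<open>1 - c * k\<close> on the second factor
    does not fall below \<open>q\<close>, the factor by which the target may be missed;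
    \<open>k + 1\<close> avoids dividing by \<open>k\<close>, which may be 0.\<close>
  define c where "c = (1 - q) / (k + 1)"
  have c: "0 < c" using q k0 by (simp add: c_def)
  have ck: "q \<le> 1 - c * k"
  proof -
    have "c * k \<le> c * (k + 1)" using c by simp
    also have "\<dots> = 1 - q" using k0 by (simp add: c_def)
    finally show ?thesis by simp
  qed
  have ib': "integrable \<nu> b'"
    by (rule \<nu>.integrable_const_bound[where B=B]) (use b' in auto)
  have i2: "integrable \<nu> (\<lambda>x. exp (- (c * b' x)))"
    by (rule \<nu>.integrable_const_bound[where B=1]) (use b' c in auto)
  have exp_le: "1 - exp (- (c * b x)) \<le> c * b x" for x
    using exp_ge_add_one_self[of "- (c * b x)"] by simp
  have i1: "integrable \<mu> (\<lambda>x. 1 - exp (- (c * b x)))"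
    by (rule integrable_one_minus_exp[OF b c])
  have "(\<integral>x. 1 - exp (- (c * b x)) \<partial>\<mu>) \<le> (\<integral>x. c * b x \<partial>\<mu>)"
    using b(1) i1 exp_le by (intro integral_mono) auto
  then have "v / c * (\<integral>x. 1 - exp (- (c * b x)) \<partial>\<mu>) \<le> v / c * (c * \<beta>)"
    using v c by (intro mult_left_mono) (auto simp: \<beta>_def)
  then have first: "exp (- (v * \<beta>)) \<le> exp (- (v / c * (\<integral>x. 1 - exp (- (c * b x)) \<partial>\<mu>)))"
    using c by simp
  have "1 - c * k = (\<integral>x. 1 - c * b' x \<partial>\<nu>)" using ib' by (simp add: k_def \<nu>.prob_space)
  also have "\<dots> \<le> (\<integral>x. exp (- (c * b' x)) \<partial>\<nu>)"
    using ib' i2 exp_ge_add_one_self[of "- (c * b' x)" for x] by (intro integral_mono) auto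
  finally have second: "q \<le> (\<integral>x. exp (- (c * b' x)) \<partial>\<nu>)" using ck by simp
  have "exp (- \<delta>) = exp (- (v * \<beta>)) * q" by (simp add: q_def flip: exp_add)
  also have "\<dots> \<le> exp (- (v / c * (\<integral>x. 1 - exp (- (c * b x)) \<partial>\<mu>))) * (\<integral>x. exp (- (c * b' x)) \<partial>\<nu>)"
    using first second q by (intro mult_mono) auto
  finally show ?thesis using that c by blast
qed

text \<open>Only values strictly below \<open>a\<close> have to be attained: with clusters the
  capacity is approached as \<open>c\<close> tends to 0 and need not be a maximum.\<close>

lemma Sup_ennreal_eq:
  assumes upper: "\<And>x. x \<in> S \<Longrightarrow> x \<le> ennreal a"
    and lower: "\<And>v. 0 < v \<Longrightarrow> v < a \<Longrightarrow> ennreal v \<in> S"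
  shows "Sup S = ennreal a"
proof (rule antisym)
  show "ennreal a \<le> Sup S"
  proof (rule dense_le)
    fix x assume x: "x < ennreal a"
    then obtain u where u: "0 \<le> u" "x = ennreal u" by (cases x) (auto simp: top_unique)
    with x have "u < a" by (simp add: ennreal_less_iff)
    then have "ennreal ((u + a) / 2) \<in> S" using u by (intro lower) auto
    then have "ennreal ((u + a) / 2) \<le> Sup S" by (rule Sup_upper)
    moreover have "x \<le> ennreal ((u + a) / 2)" using u \<open>u < a\<close> by (simp add: ennreal_leI)
    ultimately show "x \<le> Sup S" by simp
  qed
qed (auto intro: Sup_least upper)

text \<open>The outage probability due to a lone interferer at \<open>x\<close>, that is, one minus
  exp of minus \<open>loss_exponent\<close>. Off the pole it is the quotient in \<open>beta\<close>,
  multiplied through by \<open>T\<close>.\<close>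

definition hit :: "(real^2 \<Rightarrow> real) \<Rightarrow> real^2 \<Rightarrow> real \<Rightarrow> real^2 \<Rightarrow> real" where
  "hit g z T x = T * max 0 (g (x - z)) / (g z + T * max 0 (g (x - z)))"

text \<open>The same outage probability for a single daughter of a parent at \<open>y\<close>. The
  position \<open>y\<close> is added here and subtracted in \<open>beta\<close>, so the two agree up
  to a reflection.\<close>

definition cluster_hit :: "(real^2 \<Rightarrow> real) \<Rightarrow> (real^2 \<Rightarrow> real) \<Rightarrow> real^2 \<Rightarrow> real \<Rightarrow> real^2 \<Rightarrow> real" where
  "cluster_hit g f z T y = (LINT x|lborel. hit g z T (y + x) * f x)"

section \<open>Integrability, continuity and isotropy of the outage functions\<close>

locale link =
  fixes g f :: "real^2 \<Rightarrow> real" and z :: "real^2" and T :: real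
  assumes T_pos: "0 < T" and z_nz: "z \<noteq> 0" and g: "path_loss g" and f: "isotropic_density f"
begin

lemma g_pos: "x \<noteq> 0 \<Longrightarrow> 0 < g x"
  and g_continuous: "continuous_on (- {0}) g"
  and g_integrable: "set_integrable lborel (- ball 0 1) g"
  and g_antimono: "x \<noteq> 0 \<Longrightarrow> norm x \<le> norm y \<Longrightarrow> g y \<le> g x"
  using g unfolding path_loss_def by (blast intro: zero_less_one)+

lemma gz_pos: "0 < g z"
  using g_pos z_nz by simp

lemma g_measurable [measurable]: "g \<in> borel_measurable borel"
  using g_continuous by (intro borel_measurable_continuous_countable_exceptions[where X="{0}"]) auto

lemma f_measurable [measurable]: "f \<in> borel_measurable borel"
  and f_props: "\<And>x. 0 \<le> f x" "(\<integral>\<^sup>+x. ennreal (f x) \<partial>lborel) = 1"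
  and f_radial: "norm x = norm y \<Longrightarrow> f x = f y"
  using f unfolding isotropic_density_def by blast+

lemma f_integrable: "integrable lborel f" "(LINT x|lborel. f x) = 1"
proof -
  show i: "integrable lborel f"
  proof (rule integrableI_nonneg)
    show "f \<in> borel_measurable lborel" by simp
    show "AE x in lborel. 0 \<le> f x" using f_props(1) by simp
    show "(\<integral>\<^sup>+x. ennreal (f x) \<partial>lborel) < \<infinity>" by (simp add: f_props(2))
  qed
  have "(\<integral>\<^sup>+x. ennreal (f x) \<partial>lborel) = ennreal (LINT x|lborel. f x)"
    by (intro nn_integral_eq_integral i) (simp add: f_props(1))
  then show "(LINT x|lborel. f x) = 1" by (simp add: f_props(2))
qed

abbreviation "loss \<equiv> loss_exponent g z T"
abbreviation "h \<equiv> hit g z T"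
abbreviation "b \<equiv> cluster_hit g f z T"

lemma loss_nonneg: "0 \<le> loss x"
  using T_pos gz_pos by (simp add: loss_exponent_def)

lemma loss_measurable [measurable]: "loss \<in> borel_measurable borel"
  unfolding loss_exponent_def[abs_def] by measurable

lemma h_measurable [measurable]: "h \<in> borel_measurable borel"
  unfolding hit_def[abs_def] by measurable

lemma h_bounds: "0 \<le> h x" "h x < 1"
proof -
  define m where "m = T * max 0 (g (x - z))"
  have "0 \<le> m" using T_pos by (simp add: m_def)
  moreover have "h x = m / (g z + m)" by (simp add: hit_def m_def)
  ultimately show "0 \<le> h x" "h x < 1" using gz_pos by simp_all
qed

lemma expm_loss: "expm (ennreal (loss x)) = ennreal (1 - h x)"
proof -
  have p: "0 < g z + T * max 0 (g (x - z))" using T_pos gz_pos by (intro add_pos_nonneg) auto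
  have q: "0 < 1 + T * max 0 (g (x - z)) / g z" using T_pos gz_pos by (intro add_pos_nonneg) auto
  have "exp (- loss x) = inverse (1 + T * max 0 (g (x - z)) / g z)"
    using q by (simp add: loss_exponent_def exp_minus)
  also have "\<dots> = 1 - h x" using p q gz_pos by (simp add: hit_def field_simps)
  finally show ?thesis by (simp add: loss_nonneg)
qed

lemma one_minus_expm_loss: "1 - expm (ennreal (loss x)) = ennreal (h x)"
  using h_bounds[of x] by (simp add: expm_loss ennreal_minus flip: ennreal_1)

lemma g_continuous_off: "continuous_on (- {z}) (\<lambda>x. g (x - z))"
  by (rule continuous_on_compose2[of "- {0}" g]) (auto intro!: continuous_intros g_continuous)

lemma loss_continuous: "continuous_on (- {z}) loss"
  unfolding loss_exponent_def[abs_def]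
proof (intro continuous_on_ln continuous_intros g_continuous_off ballI)
  fix x
  have "0 < 1 + T * max 0 (g (x - z)) / g z" using T_pos gz_pos by (intro add_pos_nonneg) auto
  then show "1 + T * max 0 (g (x - z)) / g z \<noteq> 0" by (rule less_imp_neq[symmetric])
qed (use gz_pos in auto)

lemma h_isCont: "x \<noteq> z \<Longrightarrow> isCont h x"
proof -
  assume "x \<noteq> z"
  moreover have "continuous_on (- {z}) h"
    unfolding hit_def[abs_def]
  proof (intro continuous_intros g_continuous_off ballI)
    fix x
    have "0 < g z + T * max 0 (g (x - z))" using T_pos gz_pos by (intro add_pos_nonneg) auto
    then show "g z + T * max 0 (g (x - z)) \<noteq> 0" by (rule less_imp_neq[symmetric])
  qed
  ultimately show ?thesis using continuous_on_eq_continuous_at[of "- {z}" h] by auto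
qed

text \<open>Near the receiver the bound 1 absorbs any singularity of \<open>g\<close>; outside the
  unit disc around it the quotient is at most \<open>T / g z\<close> times the path loss, which is
  integrable there.\<close>

lemma nn_integral_h_finite: "(\<integral>\<^sup>+x. ennreal (h x) \<partial>lborel) < \<infinity>"
proof -
  have gfin: "(\<integral>\<^sup>+x. ennreal (indicator (- ball 0 1) x * g x) \<partial>lborel) < \<infinity>"
  proof -
    have "integrable lborel (\<lambda>x. indicator (- ball 0 1) x * g x)"
      using g_integrable by (simp add: set_integrable_def)
    moreover have "0 \<le> indicator (- ball 0 1) x * g x" for x
      using g_pos[of x] by (cases "x = 0") (auto simp: less_imp_le)
    ultimately show ?thesis by (subst nn_integral_eq_integral) auto
  qed
  have "ennreal (h (y + z)) \<le> indicator (ball 0 1) y + ennreal (T / g z) * ennreal (indicator (- ball 0 1) y * g y)" for y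
  proof (cases "y \<in> ball 0 1")
    case True
    then show ?thesis using h_bounds[of "y + z"] by (simp add: ennreal_le_1)
  next
    case False
    then have "y \<noteq> 0" by auto
    then have gy: "0 < g y" by (rule g_pos)
    have "h (y + z) = T * g y / (g z + T * g y)" using gy by (simp add: hit_def max_def)
    also have "\<dots> \<le> T * g y / g z" using gy gz_pos T_pos by (intro divide_left_mono mult_pos_pos add_pos_nonneg) auto
    finally show ?thesis using False gz_pos T_pos gy by (simp add: ennreal_leI flip: ennreal_mult')
  qed
  then have "(\<integral>\<^sup>+y. ennreal (h (y + z)) \<partial>lborel) \<le>
    (\<integral>\<^sup>+y. indicator (ball 0 1) y + ennreal (T / g z) * ennreal (indicator (- ball 0 1) y * g y) \<partial>lborel)"
    by (intro nn_integral_mono)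
  also have "\<dots> = emeasure lborel (ball 0 1 :: (real^2) set) + ennreal (T / g z) * (\<integral>\<^sup>+x. ennreal (indicator (- ball 0 1) x * g x) \<partial>lborel)"
  proof -
    have "(\<lambda>y. indicator (ball 0 1) y :: ennreal) \<in> borel_measurable (lborel :: (real^2) measure)"
      by (intro borel_measurable_indicator) simp
    then show ?thesis by (simp add: nn_integral_add nn_integral_cmult)
  qed
  also have "\<dots> < \<infinity>"
    using gfin emeasure_lborel_bounded[of "ball 0 1 :: (real^2) set"] by (simp add: ennreal_mult_less_top)
  finally show ?thesis using nn_integral_lborel_shift[of "\<lambda>x. ennreal (h x)" z] by simp
qed

lemma h_integrable: "integrable lborel h"
  using nn_integral_h_finite h_bounds(1) by (intro integrableI_nonneg AE_I2) auto

lemma integral_h_pos: "0 < (LINT x|lborel. h x)"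
proof -
  have "(LINT x|lborel. h x) \<noteq> 0"
  proof
    assume "(LINT x|lborel. h x) = 0"
    then have "AE x in lborel. h x = 0"
      using integral_nonneg_eq_0_iff_AE[OF h_integrable] h_bounds by simp
    moreover have "AE x in lborel. x \<noteq> z" by (rule AE_lborel_singleton)
    ultimately have "AE x in (lborel :: (real^2) measure). False"
    proof eventually_elim
      case (elim x)
      have "0 < g (x - z)" using elim by (intro g_pos) auto
      then have "0 < h x" using T_pos gz_pos by (simp add: hit_def max_def add_pos_pos)
      with elim show ?case by simp
    qed
    then have "AE x in (lborel :: (real^2) measure). (1 :: ennreal) = 0"
      by (rule eventually_mono) simp
    then have "(\<integral>\<^sup>+x. 1 \<partial>(lborel :: (real^2) measure)) = (\<integral>\<^sup>+x. 0 \<partial>(lborel :: (real^2) measure))"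
      by (rule nn_integral_cong_AE)
    then show False by (simp add: emeasure_lborel_UNIV)
  qed
  moreover have "0 \<le> (LINT x|lborel. h x)" using h_bounds by (intro integral_nonneg_AE) auto
  ultimately show ?thesis by simp
qed

lemma h_f_integrable: "integrable lborel (\<lambda>x. h (y + x) * f x)"
  by (rule Bochner_Integration.integrable_bound[OF f_integrable(1)])
     (use h_bounds f_props in \<open>auto simp: abs_mult less_imp_le intro!: mult_left_le_one_le\<close>)

lemma b_bounds: "0 \<le> b y" "b y \<le> 1"
proof -
  show "0 \<le> b y" unfolding cluster_hit_def
    using h_bounds f_props by (intro integral_nonneg_AE) auto
  have "b y \<le> (LINT x|lborel. f x)" unfolding cluster_hit_def
    using h_bounds f_props by (intro integral_mono h_f_integrable f_integrable mult_left_le_one_le) (auto simp: less_imp_le)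
  then show "b y \<le> 1" by (simp add: f_integrable)
qed

text \<open>For fixed \<open>y\<close> only \<open>x = z - y\<close> meets the discontinuity of
  \<open>h\<close>, a null set, and \<open>f\<close> dominates. The random displacement thus smooths
  the pole away before Mecke's formula is applied to the parents.\<close>

lemma b_continuous: "continuous_on UNIV b"
proof (rule continuous_at_imp_continuous_on, rule ballI)
  fix y
  show "isCont b y"
    unfolding continuous_at_sequentially
  proof (intro allI impI)
    fix u assume u: "u \<longlonglongrightarrow> y"
    show "(b \<circ> u) \<longlonglongrightarrow> b y"
      unfolding cluster_hit_def comp_def
    proof (rule integral_dominated_convergence[where w=f])
      show "AE x in lborel. (\<lambda>n. h (u n + x) * f x) \<longlonglongrightarrow> h (y + x) * f x"
        using AE_lborel_singleton[of "z - y"]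
      proof eventually_elim
        case (elim x)
        then have "isCont h (y + x)" by (intro h_isCont) (auto simp: algebra_simps)
        then show ?case by (intro tendsto_mult tendsto_const isCont_tendsto_compose[where g=h] tendsto_add u)
      qed
      show "AE x in lborel. norm (h (u n + x) * f x) \<le> f x" for n
        using h_bounds f_props by (auto simp: abs_mult less_imp_le intro!: mult_left_le_one_le)
    qed (use f_integrable in auto)
  qed
qed

lemma b_measurable [measurable]: "b \<in> borel_measurable borel"
  using b_continuous by (rule borel_measurable_continuous_onI)

text \<open>Tonelli, translation invariance and the total mass 1 of \<open>f\<close>. This equality
  is why both capacities have the same denominator.\<close>

lemma nn_integral_b: "(\<integral>\<^sup>+y. ennreal (b y) \<partial>lborel) = (\<integral>\<^sup>+x. ennreal (h x) \<partial>lborel)"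
proof -
  have "(\<integral>\<^sup>+y. ennreal (b y) \<partial>lborel) = (\<integral>\<^sup>+y. \<integral>\<^sup>+x. ennreal (h (y + x) * f x) \<partial>lborel \<partial>lborel)"
    unfolding cluster_hit_def using h_bounds f_props
    by (intro nn_integral_cong nn_integral_eq_integral[symmetric] h_f_integrable) auto
  also have "\<dots> = (\<integral>\<^sup>+x. \<integral>\<^sup>+y. ennreal (h (y + x) * f x) \<partial>lborel \<partial>lborel)"
    by (rule lborel_pair.Fubini') measurable
  also have "\<dots> = (\<integral>\<^sup>+x. ennreal (f x) * (\<integral>\<^sup>+y. ennreal (h (y + x)) \<partial>lborel) \<partial>lborel)"
    using h_bounds f_props
    by (intro nn_integral_cong) (simp add: ennreal_mult mult.commute nn_integral_cmult)
  also have "\<dots> = (\<integral>\<^sup>+x. ennreal (f x) * (\<integral>\<^sup>+y. ennreal (h y) \<partial>lborel) \<partial>lborel)"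
    by (subst nn_integral_lborel_shift) auto
  also have "\<dots> = (\<integral>\<^sup>+x. ennreal (h x) \<partial>lborel)"
    by (subst nn_integral_multc) (auto simp: f_props)
  finally show ?thesis .
qed

lemma b_integrable: "integrable lborel b"
  using nn_integral_b nn_integral_h_finite b_bounds by (intro integrableI_nonneg) auto

lemma integral_b: "(LINT y|lborel. b y) = (LINT x|lborel. h x)"
proof -
  have "ennreal (LINT y|lborel. b y) = ennreal (LINT x|lborel. h x)"
    using nn_integral_b b_bounds h_bounds
    by (subst (1 2) nn_integral_eq_integral[symmetric]) (auto intro: b_integrable h_integrable)
  moreover have "0 \<le> (LINT y|lborel. b y)" "0 \<le> (LINT x|lborel. h x)"
    using b_bounds h_bounds by (auto intro!: integral_nonneg_AE)
  ultimately show ?thesis by (simp add: ennreal_inj)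
qed

end

text \<open>Path loss, density and Lebesgue measure are all invariant under \<open>Q\<close>; off
  the origin, the symmetry of \<open>g\<close> follows from its monotonicity in the norm, used in
  both directions.\<close>

lemma link_rotate:
  assumes "link g f z T" "link g f z' T" and Q: "orthogonal_transformation Q" "Q z = z'"
  shows "cluster_hit g f z' T (Q y) = cluster_hit g f z T y"
proof -
  interpret z: link g f z T by fact
  interpret z': link g f z' T by fact
  have iso: "g x = g y" if "norm x = norm y" "x \<noteq> 0" for x y
  proof -
    have "y \<noteq> 0" using that by auto
    then show ?thesis using that z.g_antimono[of x y] z.g_antimono[of y x] by simp
  qed
  have nQ: "norm (Q x) = norm x" for x using Q(1) by (simp add: orthogonal_transformation)
  have linQ: "linear Q" using Q(1) by (simp add: orthogonal_transformation_def)
  have [measurable]: "Q \<in> borel_measurable borel"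
    using linQ by (intro borel_measurable_continuous_onI linear_continuous_on) (simp add: linear_conv_bounded_linear)
  have gz: "g z' = g z" using iso[of z z'] nQ[of z] Q z.z_nz by auto
  have "cluster_hit g f z' T (Q y) = (LINT x|distr lborel borel Q. hit g z' T (Q y + x) * f x)"
    by (simp add: cluster_hit_def distr_lborel_orthogonal[OF Q(1)])
  also have "\<dots> = (LINT x|lborel. hit g z' T (Q y + Q x) * f (Q x))"
    by (subst integral_distr) auto
  also have "\<dots> = (LINT x|lborel. hit g z T (y + x) * f x)"
  proof (intro integral_cong_AE)
    show "AE x in lborel. hit g z' T (Q y + Q x) * f (Q x) = hit g z T (y + x) * f x"
      using AE_lborel_singleton[of "z - y"]
    proof eventually_elim
      case (elim x)
      have "Q y + Q x - z' = Q (y + x - z)" by (simp add: linear_add[OF linQ] linear_diff[OF linQ] Q)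
      moreover have "y + x - z \<noteq> 0" using elim by (auto simp: algebra_simps)
      ultimately have "g (Q y + Q x - z') = g (y + x - z)" using iso[of "y + x - z" "Q (y + x - z)"] nQ by simp
      moreover have "f (Q x) = f x" by (intro z.f_radial nQ)
      ultimately show ?case by (simp add: hit_def gz)
    qed
  qed measurable
  finally show ?thesis by (simp add: cluster_hit_def)
qed

lemma beta_eq_cluster_hit:
  assumes "link g f (vector [R, 0]) T"
  shows "beta g f T R y = cluster_hit g f (vector [R, 0]) T (- y)"
proof -
  interpret link g f "vector [R, 0]" T by fact
  show ?thesis unfolding beta_def cluster_hit_def Let_def
  proof (intro integral_cong_AE)
    \<comment> \<open>At the pole the integrands may differ: \<open>beta\<close> takes
      \<open>g 0\<close> as it is, \<open>hit\<close> truncates it at 0.\<close>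
    show "AE x in lborel. g (x - y - vector [R, 0]) / (g (vector [R, 0]) / T + g (x - y - vector [R, 0])) * f x =
      hit g (vector [R, 0]) T (- y + x) * f x"
      using AE_lborel_singleton[of "y + vector [R, 0]"]
    proof eventually_elim
      case (elim x)
      have "0 < g (x - y - vector [R, 0])" using elim by (intro g_pos) (auto simp: algebra_simps)
      moreover have "- y + x - vector [R, 0] = x - y - vector [R, 0]" by simp
      ultimately show ?case using T_pos gz_pos by (simp add: hit_def max_def field_simps)
    qed
  qed measurable
qed

section \<open>Success probabilities and capacities\<close>

lemma emeasure_unit_box: "emeasure lborel (cbox 0 1 :: (real^2) set) = 1"
proof -
  have "(0 :: real^2) \<bullet> b \<le> 1 \<bullet> b" "(1 - 0 :: real^2) \<bullet> b = 1" if "b \<in> Basis" for b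
    using that by (auto simp: Basis_vec_def inner_axis)
  then show ?thesis by (subst emeasure_lborel_cbox) auto
qed

lemma expm_mult_nn_integral:
  assumes l: "0 < l" and U: "\<And>y. 1 - expm (U y) = ennreal (u y)" "\<And>y. 0 \<le> u y" "integrable lborel u"
  shows "expm (ennreal l * (\<integral>\<^sup>+y. 1 - expm (U y) \<partial>lborel)) = ennreal (exp (- (l * (LINT y|lborel. u y))))"
proof -
  have "(\<integral>\<^sup>+y. 1 - expm (U y) \<partial>lborel) = ennreal (LINT y|lborel. u y)"
    unfolding U(1) by (intro nn_integral_eq_integral U AE_I2)
  moreover have "0 \<le> (LINT y|lborel. u y)" using U(2) by (intro integral_nonneg_AE) auto
  moreover have "ennreal l * ennreal (LINT y|lborel. u y) = ennreal (l * (LINT y|lborel. u y))"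
    using l by (simp add: ennreal_mult')
  ultimately show ?thesis using l by simp
qed

context link
begin

text \<open>The loss is continuous away from the receiver, so the stationary Mecke formula applies
  with every index active; the window has area 1, and dividing by the intensity leaves the Laplace
  functional alone.\<close>

lemma success_prob_poisson:
  assumes r: "0 < r" and l: "0 < l" and \<Psi>: "poisson_process M l \<Psi>"
  shows "success_prob r g z T M \<Psi> = ennreal (exp (- (l * (LINT x|lborel. h x))))"
proof -
  obtain X where X: "poisson_points M l X" "AE \<omega> in M. \<Psi> \<omega> = range (\<lambda>i. X i \<omega>)"
    using \<Psi> by (auto simp: poisson_process_def)
  have pM: "prob_space M" using X(1) by (simp add: poisson_points_def)
  interpret M: prob_space M by (rule pM)
  interpret P: poisson_sequence M l X by unfold_locales (fact X(1), fact l)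
  have box: "cbox 0 (1 :: real^2) \<in> sets borel" "bounded (cbox 0 (1 :: real^2))" by auto
  have I0: "ennreal l = (\<integral>\<^sup>+\<omega>. \<integral>\<^sup>+p. indicator UNIV p * indicator (cbox 0 1) (X p \<omega>) \<partial>count_space UNIV \<partial>M)"
    using P.mecke_sum_zero(1)[OF box] by (simp add: emeasure_unit_box)
  have fin: "(\<integral>\<^sup>+y. 1 - expm (ennreal (loss y)) \<partial>lborel) < \<infinity>"
    using nn_integral_h_finite by (simp add: one_minus_expm_loss)
  have "success_prob r g z T M \<Psi> =
    (\<integral>\<^sup>+\<omega>. \<integral>\<^sup>+p. indicator UNIV p * indicator (cbox 0 1) (X p \<omega>) *
        expm (\<integral>\<^sup>+q. indicator (UNIV - {p}) q * ennreal (loss (X q \<omega> - X p \<omega>)) \<partial>count_space UNIV)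
      \<partial>count_space UNIV \<partial>M) / ennreal l"
  proof (rule success_prob_indexed[where Z=X and J="\<lambda>_. UNIV", OF pM])
    show "AE \<omega> in M. inj (\<lambda>p. X p \<omega>)" "AE \<omega> in M. \<forall>B. bounded B \<longrightarrow> finite {p \<in> UNIV. X p \<omega> \<in> B}"
      using P.AE_good by (auto elim!: eventually_mono)
  qed (use X(2) I0 r T_pos gz_pos in auto)
  also have "(\<integral>\<^sup>+\<omega>. \<integral>\<^sup>+p. indicator UNIV p * indicator (cbox 0 1) (X p \<omega>) *
        expm (\<integral>\<^sup>+q. indicator (UNIV - {p}) q * ennreal (loss (X q \<omega> - X p \<omega>)) \<partial>count_space UNIV)
      \<partial>count_space UNIV \<partial>M) = mecke_sum M X (cbox 0 1) (\<lambda>x y. ennreal (loss (y - x)))"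
    by (simp add: mecke_sum_def Compl_eq_Diff_UNIV)
  also have "\<dots> = P.mecke_value (cbox 0 1) (\<lambda>y. ennreal (loss y))"
    by (intro P.mecke_sum_stationary[OF box loss_continuous loss_nonneg loss_measurable fin])
  also have "\<dots> = ennreal l * ennreal (exp (- (l * (LINT x|lborel. h x))))"
    unfolding P.mecke_value_def emeasure_unit_box
    by (simp add: expm_mult_nn_integral[OF l one_minus_expm_loss h_bounds(1) h_integrable])
  also have "\<dots> / ennreal l = ennreal (exp (- (l * (LINT x|lborel. h x))))"
    using l by (simp add: divide_ennreal flip: ennreal_mult')
  finally show ?thesis .
qed

abbreviation "E \<equiv> density lborel (\<lambda>x. ennreal (f x))"

lemma prob_space_E: "prob_space E"
  using f_props by (intro prob_spaceI) (simp add: emeasure_density)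

lemma integral_E:
  fixes k :: "real^2 \<Rightarrow> real"
  assumes [measurable]: "k \<in> borel_measurable borel"
  shows "(\<integral>x. k x \<partial>E) = (LINT x|lborel. k x * f x)"
  using f_props by (subst integral_density) (auto simp: mult.commute)

text \<open>Averaging \<open>1 - h\<close> over a displacement gives \<open>1 - b\<close>, so a
  parent at \<open>y\<close> acts like a point with loss \<open>c * b y\<close>. The last factor
  belongs to the tagged point's own cluster, whose parent lies at minus its displacement.\<close>

lemma success_prob_cluster:
  assumes r: "0 < r" and l: "0 < l" and c: "0 < c" and \<Phi>: "neyman_scott M l c f \<Phi>"
  shows "success_prob r g z T M \<Phi> =
    ennreal (exp (- (l * (LINT y|lborel. 1 - exp (- (c * b y))))) * (\<integral>y. exp (- (c * b (- y))) \<partial>E))"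
proof -
  obtain X N D where X: "poisson_points M l X"
    and N: "\<And>i. N i \<in> measurable M (count_space UNIV)" and D: "\<And>p. D p \<in> borel_measurable M"
    and law: "distr M
          (PiM UNIV (\<lambda>_. borel) \<Otimes>\<^sub>M PiM UNIV (\<lambda>_. count_space UNIV) \<Otimes>\<^sub>M PiM UNIV (\<lambda>_. borel))
          (\<lambda>\<omega>. (\<lambda>i. X i \<omega>, \<lambda>i. N i \<omega>, \<lambda>p. D p \<omega>))
        = distr M (PiM UNIV (\<lambda>_. borel)) (\<lambda>\<omega> i. X i \<omega>)
          \<Otimes>\<^sub>M PiM UNIV (\<lambda>_. measure_pmf (poisson_pmf c))
          \<Otimes>\<^sub>M PiM UNIV (\<lambda>_. density lborel (\<lambda>x. ennreal (f x)))"
    and \<Phi>': "AE \<omega> in M. \<Phi> \<omega> = (\<Union>i. {X i \<omega> + D (i, j) \<omega> | j. j < N i \<omega>})"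
    using \<Phi> unfolding neyman_scott_def by blast
  have pM: "prob_space M" using X(1) by (simp add: poisson_points_def)
  interpret M: prob_space M by (rule pM)
  interpret C: cluster_sequence M l X c f N D
    by unfold_locales (fact X l c N D law f_measurable f_props)+
  interpret E: prob_space E by (rule prob_space_E)
  have box: "cbox 0 (1 :: real^2) \<in> sets borel" "bounded (cbox 0 (1 :: real^2))" by auto
  have V: "(\<lambda>y. ennreal (loss y)) \<in> borel_measurable borel" by simp
  have retain: "ennreal c * (1 - C.retain (\<lambda>y. ennreal (loss y)) y) = ennreal (c * b y)" for y
  proof -
    have nn: "0 \<le> h x" "0 \<le> 1 - h x" for x using h_bounds[of x] by auto
    have "C.retain (\<lambda>y. ennreal (loss y)) y + (\<integral>\<^sup>+e. ennreal (h (y + e)) \<partial>E) = (\<integral>\<^sup>+e. ennreal (1 - h (y + e)) + ennreal (h (y + e)) \<partial>E)"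
      unfolding C.retain_def expm_loss by (subst nn_integral_add) auto
    also have "\<dots> = (\<integral>\<^sup>+e. 1 \<partial>E)"
      using nn by (intro nn_integral_cong) (simp flip: ennreal_plus)
    also have "\<dots> = 1" using E.emeasure_space_1 by simp
    also have "(\<integral>\<^sup>+e. ennreal (h (y + e)) \<partial>E) = (\<integral>\<^sup>+e. ennreal (h (y + e) * f e) \<partial>lborel)"
      using nn f_props by (subst nn_integral_density) (auto simp: ennreal_mult mult.commute)
    also have "\<dots> = ennreal (b y)"
      unfolding cluster_hit_def using nn f_props by (intro nn_integral_eq_integral h_f_integrable) auto
    \<comment> \<open>Stated as a sum because subtraction in \<open>ennreal\<close> is truncated and
      cancels finite terms only.\<close>
    finally have sum: "C.retain (\<lambda>y. ennreal (loss y)) y + ennreal (b y) = 1" .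
    then have "C.retain (\<lambda>y. ennreal (loss y)) y \<noteq> top" by auto
    then have "1 - C.retain (\<lambda>y. ennreal (loss y)) y = ennreal (b y)"
      unfolding sum[symmetric] by simp
    then show ?thesis using c by (simp add: ennreal_mult')
  qed
  have cb: "0 \<le> c * b y" for y using c b_bounds(1)[of y] by simp
  have i1: "integrable lborel (\<lambda>y. 1 - exp (- (c * b y)))"
    by (rule integrable_one_minus_exp[OF b_integrable b_bounds(1) c])
  have ome: "1 - expm (ennreal (c * b y)) = ennreal (1 - exp (- (c * b y)))" for y
    using cb[of y] by (simp add: ennreal_minus flip: ennreal_1)
  have fin: "(\<integral>\<^sup>+y. 1 - expm (ennreal (c * b y)) \<partial>lborel) < \<infinity>"
    unfolding ome using cb by (subst nn_integral_eq_integral[OF i1]) auto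
  have bc: "continuous_on UNIV (\<lambda>y. c * b y)" by (intro continuous_intros b_continuous)
  have term_eq: "C.campbell_term (\<lambda>y. ennreal (loss y)) A p \<omega> = indicator (C.active \<omega>) p * indicator A (C.daughter p \<omega>) *
     expm (\<integral>\<^sup>+q. indicator (C.active \<omega> - {p}) q * ennreal (loss (C.daughter q \<omega> - C.daughter p \<omega>)) \<partial>count_space UNIV)" for A p \<omega>
    by (simp add: C.campbell_term_def)
  have "success_prob r g z T M \<Phi> =
    (\<integral>\<^sup>+\<omega>. \<integral>\<^sup>+p. C.campbell_term (\<lambda>y. ennreal (loss y)) (cbox 0 1) p \<omega> \<partial>count_space UNIV \<partial>M) / ennreal (c * l)"
    unfolding term_eq
  proof (rule success_prob_indexed[where Z=C.daughter and J=C.active, OF pM])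
    show "AE \<omega> in M. inj_on (\<lambda>p. C.daughter p \<omega>) (C.active \<omega>)" by (rule C.AE_daughter_inj)
    show "AE \<omega> in M. \<forall>B. bounded B \<longrightarrow> finite {p \<in> C.active \<omega>. C.daughter p \<omega> \<in> B}" by (rule C.AE_active_finite)
    show "AE \<omega> in M. \<Phi> \<omega> = (\<lambda>p. C.daughter p \<omega>) ` C.active \<omega>"
      using \<Phi>'
    proof eventually_elim
      case (elim \<omega>)
      show ?case unfolding elim by (force simp: C.daughter_def C.active_def image_iff)
    qed
    show "ennreal (c * l) = (\<integral>\<^sup>+\<omega>. \<integral>\<^sup>+p. indicator (C.active \<omega>) p * indicator (cbox 0 1) (C.daughter p \<omega>) \<partial>count_space UNIV \<partial>M)"
      using C.nn_integral_active[OF box] by (simp add: emeasure_unit_box)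
  qed (use r T_pos gz_pos C.daughter_measurable C.active_measurable g_measurable in auto)
  also have "(\<integral>\<^sup>+\<omega>. \<integral>\<^sup>+p. C.campbell_term (\<lambda>y. ennreal (loss y)) (cbox 0 1) p \<omega> \<partial>count_space UNIV \<partial>M) =
    ennreal c * (\<integral>\<^sup>+e. expm (ennreal (c * b (- e))) \<partial>E) * C.mecke_value (cbox 0 1) (\<lambda>y. ennreal (c * b y))"
    by (intro C.nn_integral_cluster_sum_continuous V box retain cb bc fin)
  also have "C.mecke_value (cbox 0 1) (\<lambda>y. ennreal (c * b y)) =
      ennreal l * ennreal (exp (- (l * (LINT y|lborel. 1 - exp (- (c * b y))))))"
    unfolding C.mecke_value_def emeasure_unit_box
    using cb by (subst expm_mult_nn_integral[OF l ome _ i1]) auto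
  also have "(\<integral>\<^sup>+e. expm (ennreal (c * b (- e))) \<partial>E) = ennreal (\<integral>e. exp (- (c * b (- e))) \<partial>E)"
  proof -
    have "(\<integral>\<^sup>+e. expm (ennreal (c * b (- e))) \<partial>E) = (\<integral>\<^sup>+e. ennreal (exp (- (c * b (- e)))) \<partial>E)"
      using cb by simp
    also have "\<dots> = ennreal (\<integral>e. exp (- (c * b (- e))) \<partial>E)"
      by (intro nn_integral_eq_integral E.integrable_const_bound[where B=1] AE_I2) (use cb in auto)
    finally show ?thesis .
  qed
  also have "ennreal c * ennreal (\<integral>e. exp (- (c * b (- e))) \<partial>E) *
      (ennreal l * ennreal (exp (- (l * (LINT y|lborel. 1 - exp (- (c * b y))))))) / ennreal (c * l) =
    ennreal (exp (- (l * (LINT y|lborel. 1 - exp (- (c * b y))))) * (\<integral>y. exp (- (c * b (- y))) \<partial>E))"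
  proof -
    have "0 \<le> (\<integral>e. exp (- (c * b (- e))) \<partial>E)" by (intro integral_nonneg_AE) auto
    then show ?thesis using c l by (simp add: divide_ennreal flip: ennreal_mult')
  qed
  finally show ?thesis .
qed

section \<open>The two suprema\<close>

lemma Sup_poisson:
  assumes "0 < \<delta>"
  shows "Sup {ennreal l | l. 0 < l \<and> ennreal (exp (- \<delta>)) \<le> ennreal (exp (- (l * (LINT x|lborel. h x))))} =
    ennreal (\<delta> / (LINT x|lborel. h x))"
proof (rule Sup_ennreal_eq)
  fix v assume "0 < v" "v < \<delta> / (LINT x|lborel. h x)"
  then show "ennreal v \<in> {ennreal l | l. 0 < l \<and> ennreal (exp (- \<delta>)) \<le> ennreal (exp (- (l * (LINT x|lborel. h x))))}"
    using integral_h_pos by (auto simp: field_simps)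
qed (use integral_h_pos in \<open>auto simp: field_simps intro!: ennreal_leI\<close>)

text \<open>Above the Poisson value \<open>cluster_upper_bound\<close> rules out every pair; each
  value \<open>v\<close> below it is realised by \<open>l = v / c\<close> with the small
  \<open>c\<close> of \<open>cluster_lower_bound\<close>.\<close>

lemma Sup_cluster:
  assumes \<delta>: "0 < \<delta>" "\<delta> \<le> (\<integral>y. b (- y) \<partial>E) / B" and B: "\<And>y. b y \<le> B" "0 < B"
  shows "Sup {ennreal (l * c) | l c. 0 < l \<and> 0 < c \<and> ennreal (exp (- \<delta>)) \<le>
      ennreal (exp (- (l * (LINT y|lborel. 1 - exp (- (c * b y))))) * (\<integral>y. exp (- (c * b (- y))) \<partial>E))} =
    ennreal (\<delta> / (LINT x|lborel. h x))"
proof (rule Sup_ennreal_eq)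
  have bm: "(\<lambda>y. b (- y)) \<in> borel_measurable E" by simp
  fix x assume "x \<in> {ennreal (l * c) | l c. 0 < l \<and> 0 < c \<and> ennreal (exp (- \<delta>)) \<le>
      ennreal (exp (- (l * (LINT y|lborel. 1 - exp (- (c * b y))))) * (\<integral>y. exp (- (c * b (- y))) \<partial>E))}"
  then obtain l c where x: "x = ennreal (l * c)" "0 < l" "0 < c" and "ennreal (exp (- \<delta>)) \<le>
      ennreal (exp (- (l * (LINT y|lborel. 1 - exp (- (c * b y))))) * (\<integral>y. exp (- (c * b (- y))) \<partial>E))"
    by blast
  then have le: "exp (- \<delta>) \<le> exp (- (l * (LINT y|lborel. 1 - exp (- (c * b y))))) * (\<integral>y. exp (- (c * b (- y))) \<partial>E)"
    by (subst (asm) ennreal_le_iff) (auto intro!: mult_nonneg_nonneg integral_nonneg_AE)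
  have "\<not> \<delta> < l * c * (LINT y|lborel. b y)"
    using cluster_upper_bound[OF b_integrable b_bounds(1) B(1) prob_space_E bm b_bounds(1) B(1) B(2) \<delta> x(2,3)] le
    by auto
  then show "x \<le> ennreal (\<delta> / (LINT x|lborel. h x))"
    using integral_h_pos x unfolding integral_b by (auto simp: field_simps intro!: ennreal_leI)
next
  have bm: "(\<lambda>y. b (- y)) \<in> borel_measurable E" by simp
  fix v assume v: "0 < v" "v < \<delta> / (LINT x|lborel. h x)"
  then have "v * (LINT y|lborel. b y) < \<delta>" unfolding integral_b using integral_h_pos by (simp add: field_simps)
  from cluster_lower_bound[OF b_integrable b_bounds(1) prob_space_E bm b_bounds(1) B(1) v(1) this]
  obtain c where "0 < c" "exp (- \<delta>) \<le> exp (- (v / c * (LINT y|lborel. 1 - exp (- (c * b y))))) * (\<integral>y. exp (- (c * b (- y))) \<partial>E)"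
    by blast
  then show "ennreal v \<in> {ennreal (l * c) | l c. 0 < l \<and> 0 < c \<and> ennreal (exp (- \<delta>)) \<le>
      ennreal (exp (- (l * (LINT y|lborel. 1 - exp (- (c * b y))))) * (\<integral>y. exp (- (c * b (- y))) \<partial>E))}"
    using v(1) by (intro CollectI exI[of _ "v / c"] exI[of _ c]) (auto intro!: ennreal_leI)
qed

text \<open>\<open>rho\<close> is anchored at the receiver \<open>(R, 0)\<close>, the link at an
  arbitrary \<open>z\<close> of norm \<open>R\<close>. A rotation carries one to the other; it
  permutes the arguments of the supremum and, \<open>f\<close> being radial, preserves the
  average.\<close>

lemma rho_bounds:
  assumes R: "norm z = R"
  obtains B where "\<And>y. b y \<le> B" "0 < B" "rho g f T R = (\<integral>y. b (- y) \<partial>E) / B"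
proof -
  define z0 where "z0 = (vector [R, 0] :: real^2)"
  have Rpos: "0 < R" using R z_nz by auto
  have nz0: "norm z0 = R"
    using Rpos by (simp add: z0_def norm_eq_sqrt_inner inner_vec_def sum_2 flip: power2_eq_square)
  have "z0 \<noteq> 0" using nz0 Rpos by auto
  then have link0: "link g f z0 T" using T_pos g f by (simp add: link_def)
  interpret z0: link g f z0 T by (rule link0)
  obtain Q where Q: "orthogonal_transformation Q" "Q z = z0"
    using orthogonal_transformation_exists[of z z0] R nz0 by metis
  have rot: "cluster_hit g f z0 T (Q y) = b y" for y
    by (intro link_rotate[OF _ link0 Q]) unfold_locales
  have linQ: "linear Q" using Q(1) by (simp add: orthogonal_transformation_def)
  have [measurable]: "Q \<in> borel_measurable borel"
    using linQ by (intro borel_measurable_continuous_onI linear_continuous_on) (simp add: linear_conv_bounded_linear)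
  have nQ: "norm (Q x) = norm x" for x using Q(1) by (simp add: orthogonal_transformation)
  have beta: "beta g f T R y = cluster_hit g f z0 T (- y)" for y
    using beta_eq_cluster_hit[of g f R T y] link0 by (simp add: z0_def)
  define B where "B = (SUP y. beta g f T R y)"
  have bdd: "bdd_above (range (beta g f T R))"
    using z0.b_bounds(2) by (intro bdd_aboveI[where M=1]) (auto simp: beta)
  have le: "b y \<le> B" for y
  proof -
    have "b y = beta g f T R (- Q y)" by (simp add: beta rot)
    also have "\<dots> \<le> B" unfolding B_def by (intro cSUP_upper bdd) simp
    finally show ?thesis .
  qed
  have "0 < B"
  proof (rule ccontr)
    assume "\<not> 0 < B"
    then have "b y = 0" for y using le[of y] b_bounds(1)[of y] by simp
    then show False using integral_h_pos integral_b by simp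
  qed
  moreover have "(LINT y|lborel. beta g f T R y * f y) = (\<integral>y. b (- y) \<partial>E)"
  proof -
    have "(LINT y|lborel. beta g f T R y * f y) = (LINT y|distr lborel borel Q. cluster_hit g f z0 T (- y) * f y)"
      by (simp add: distr_lborel_orthogonal[OF Q(1)] beta)
    also have "\<dots> = (LINT y|lborel. cluster_hit g f z0 T (- Q y) * f (Q y))"
      by (subst integral_distr) (auto intro!: borel_measurable_times measurable_compose[OF borel_measurable_uminus z0.b_measurable])
    also have "\<dots> = (LINT y|lborel. b (- y) * f y)"
    proof (intro Bochner_Integration.integral_cong refl arg_cong2[where f="(*)"])
      fix y
      show "cluster_hit g f z0 T (- Q y) = b (- y)" using rot[of "- y"] by (simp add: linear_neg[OF linQ])
      show "f (Q y) = f y" by (intro f_radial nQ)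
    qed
    finally show ?thesis by (simp add: integral_E)
  qed
  ultimately show thesis using that[of B] le by (simp add: rho_def B_def)
qed

end

theorem theorem2:
  fixes g f :: "real^2 \<Rightarrow> real" and z :: "real^2" and T R r \<epsilon> :: real
    and M :: "real \<Rightarrow> real \<Rightarrow> 'w measure" and \<Phi> :: "real \<Rightarrow> real \<Rightarrow> 'w \<Rightarrow> (real^2) set"
    and M' :: "real \<Rightarrow> 'v measure" and \<Psi> :: "real \<Rightarrow> 'v \<Rightarrow> (real^2) set"
  assumes "0 < T" and "0 < R" and "0 < r"
    and "path_loss g"
    and "isotropic_density f"
    and "norm z = R"
    and "\<And>l c. 0 < l \<Longrightarrow> 0 < c \<Longrightarrow> neyman_scott (M l c) l c f (\<Phi> l c)"
    and "\<And>l. 0 < l \<Longrightarrow> poisson_process (M' l) l (\<Psi> l)"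
    and "0 < \<epsilon>" and "\<epsilon> \<le> 1 - exp (- rho g f T R)"
  shows "cluster_capacity (\<lambda>l c. success_prob r g z T (M l c) (\<Phi> l c)) \<epsilon>
       = poisson_capacity (\<lambda>l. success_prob r g z T (M' l) (\<Psi> l)) \<epsilon>"
proof -
  have "z \<noteq> 0" using assms(2,6) by auto
  then interpret link g f z T using assms(1,4,5) by unfold_locales
  \<comment> \<open>With this \<delta> the success constraint has the form exp(- \<delta>) \<le>
    success probability, and the bound on \<epsilon> reads
    \<open>\<delta> \<le> rho g f T R\<close>.\<close>
  define \<delta> where "\<delta> = - ln (1 - \<epsilon>)"
  have pos: "0 < 1 - \<epsilon>" using assms(10) exp_gt_zero[of "- rho g f T R"] by linarith
  then have \<epsilon>: "1 - \<epsilon> = exp (- \<delta>)" by (simp add: \<delta>_def)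
  have \<delta>0: "0 < \<delta>" using pos assms(9) by (simp add: \<delta>_def)
  obtain B where B: "\<And>y. b y \<le> B" "0 < B" "rho g f T R = (\<integral>y. b (- y) \<partial>E) / B"
    using rho_bounds[OF assms(6)] by blast
  have "exp (- rho g f T R) \<le> exp (- \<delta>)" using assms(10) \<epsilon> by linarith
  then have \<delta>: "\<delta> \<le> (\<integral>y. b (- y) \<partial>E) / B" using B(3) by simp
  have "{ennreal (l * c) | l c. 0 < l \<and> 0 < c \<and> ennreal (exp (- \<delta>)) \<le> success_prob r g z T (M l c) (\<Phi> l c)} =
    {ennreal (l * c) | l c. 0 < l \<and> 0 < c \<and> ennreal (exp (- \<delta>)) \<le>
      ennreal (exp (- (l * (LINT y|lborel. 1 - exp (- (c * b y))))) * (\<integral>y. exp (- (c * b (- y))) \<partial>E))}"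
    by (intro Collect_cong ex_cong1 conj_cong refl)
       (simp add: success_prob_cluster[OF assms(3) _ _ assms(7)])
  moreover have "{ennreal l | l. 0 < l \<and> ennreal (exp (- \<delta>)) \<le> success_prob r g z T (M' l) (\<Psi> l)} =
    {ennreal l | l. 0 < l \<and> ennreal (exp (- \<delta>)) \<le> ennreal (exp (- (l * (LINT x|lborel. h x))))}"
    by (intro Collect_cong ex_cong1 conj_cong refl)
       (simp add: success_prob_poisson[OF assms(3) _ assms(8)])
  ultimately show ?thesis
    unfolding cluster_capacity_def poisson_capacity_def \<epsilon>
    by (simp only: Sup_cluster[OF \<delta>0 \<delta> B(1,2)] Sup_poisson[OF \<delta>0])
qed

end
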